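(* For every positive integer $n$, the map $\Phi_{\mathcal{F}}$ is a bijection from $\mathcal{T}_n$ (the set of Baxter tree-like tableaux of size $n$) onto $\mathcal{F}_n$ (the set of packed floorplans of size $n$).
   Context: Ferrers diagrams are drawn in English notation: left-justified rows of unit cells whose lengths weakly decrease from top to bottom. A tree-like tableau (TLT) is a nonempty Ferrers diagram each of whose cells is either empty or pointed (contains a point), such that: (1) the top-left cell is pointed (the root point); (2) for every non-root pointed cell $c$ there is a pointed cell above $c$ in the same column or a pointed cell to the left of $c$ in the same row, but not both; the nearest such pointed cell is the parent of $c$; (3) every row and every column contains at least one pointed cell. The size of a TLT is its number of points; a TLT with $k$ rows and $\ell$ columns has size $k+\ell-1$. A TLT contains the pattern H if there are rows $r_1$ above $r_2$ and columns $c_1<c_2<c_3$ (left to right) with all six cells $(r_a,c_b)$ in the diagram such that $(r_1,c_2),(r_2,c_1),(r_2,c_3)$ are pointed and $(r_1,c_3),(r_2,c_2)$ are empty (the cell $(r_1,c_1)$ being arbitrary); it contains the pattern V if there are rows $r_1$ above $r_2$ above $r_3$ and columns $c_1<c_2$ with all six cells in the diagram such that $(r_1,c_2),(r_2,c_1),(r_3,c_2)$ are pointed and $(r_2,c_2),(r_3,c_1)$ are empty (the cell $(r_1,c_1)$ being arbitrary). A Baxter TLT is a TLT containing neither H nor V; $\mathcal{T}_n$ is the set of Baxter TLTs of size $n$. Insertion labeling: the points of a TLT $T$ of size $n$ are labeled bijectively by $1,\dots,n$ recursively. If $n=1$ the point gets label $1$. If $n\ge 2$, the special point $s$ is the rightmost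 among the pointed cells that are the lowest cell of their column; $s$ gets label $n$. Call a cell a rim cell if the cell diagonally adjacent to it on the south-east is not in the diagram; rim cells form a path of edge-adjacent cells from the bottom cell of the first column to the rightmost cell of the first row, each step going right or up. If the cell immediately to the right of $s$ is in the diagram, the ribbon of $s$ consists of the cells met when following this path from that cell up to, but excluding, the first pointed cell met; otherwise the ribbon is empty. Exactly one of the following holds: no pointed cell lies above $s$ in its column, or no pointed cell lies to its left in its row. Delete the column of $s$ in the first case (the row of $s$ in the second case) and the ribbon of $s$, closing up the gap; this yields a TLT $T'$ of size $n-1$ whose points are those of $T$ other than $s$, and each such point receives its label in $T'$. Packed floorplans: for positive integers $k,\ell$, a packed floorplan (PFP) of size $(k,\ell)$ is a partition of a rectangle of height $k$ and width $\ell$ into $k+\ell-1$ rectangular tiles with integer side lengths such that there is no pair of tiles $(t_1,t_2)$ for which, writing $(x_1,y_1)$ for the bottom-right corner of $t_1$ and $(x_2,y_2)$ for the top-left corner of $t_2$ (x-axis pointing right, y-axis pointing up), both $x_1\le x_2$ and $y_1\ge y_2$ hold. $\mathcal{F}_n$ is the set of PFPs of size $(k,\ell)$ with $k+\ell-1=n$. The map $\Phi_{\mathcal{F}}$: for $T\in\mathcal{T}_n$ with $k$ rows and $\ell$ columns, identify the cells of $T$ with unit cells of a $k\times\ell$ rectangle (top-left corners aligned). For $j=n,n-1,\dots,1$ in turn, let $c_j$ be the cell containing the point labeled $j$; from the top-left corner of $c_j$ draw a horizontal segment going east and a vertical segment going south, each extended until it meets the boundary of the rectangle or a previously drawn segment.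 The resulting segments cut the rectangle into $n$ tiles (the tile labeled $j$ having top-left cell $c_j$); this partition is $\Phi_{\mathcal{F}}(T)$. *)

theory Defs
  imports "HOL-Analysis.Analysis"
begin

section \<open>Tree-like tableaux\<close>

text \<open>A cell is a pair (row, column), both counted from 0, rows from top to bottom and columns
  from left to right.\<close>

type_synonym cell = "nat \<times> nat"

definition ferrers_diagram :: "cell set \<Rightarrow> bool" where
  "ferrers_diagram D \<longleftrightarrow>
     (\<exists>ls. ls \<noteq> [] \<and> (\<forall>x\<in>set ls. 0 < x) \<and> sorted_wrt (\<ge>) ls \<and>
           D = {(i, j). i < length ls \<and> j < ls ! i})"

datatype tableau = Tableau (diagram: "cell set") (points: "cell set")

definition point_above :: "tableau \<Rightarrow> cell \<Rightarrow> bool" where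
  "point_above T c \<longleftrightarrow> (\<exists>i < fst c. (i, snd c) \<in> points T)"

definition point_left :: "tableau \<Rightarrow> cell \<Rightarrow> bool" where
  "point_left T c \<longleftrightarrow> (\<exists>j < snd c. (fst c, j) \<in> points T)"

definition tree_like_tableau :: "tableau \<Rightarrow> bool" where
  "tree_like_tableau T \<longleftrightarrow>
     ferrers_diagram (diagram T) \<and> points T \<subseteq> diagram T \<and>
     (0, 0) \<in> points T \<and>
     (\<forall>c \<in> points T - {(0, 0)}. point_above T c \<noteq> point_left T c) \<and>
     (\<forall>i \<in> fst ` diagram T. \<exists>j. (i, j) \<in> points T) \<and>
     (\<forall>j \<in> snd ` diagram T. \<exists>i. (i, j) \<in> points T)"

definition tableau_size :: "tableau \<Rightarrow> nat" where
  "tableau_size T = card (points T)"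

definition num_rows :: "tableau \<Rightarrow> nat" where
  "num_rows T = card (fst ` diagram T)"

definition num_cols :: "tableau \<Rightarrow> nat" where
  "num_cols T = card (snd ` diagram T)"

definition contains_H :: "tableau \<Rightarrow> bool" where
  "contains_H T \<longleftrightarrow>
     (\<exists>r1 r2 c1 c2 c3. r1 < r2 \<and> c1 < c2 \<and> c2 < c3 \<and>
        {r1, r2} \<times> {c1, c2, c3} \<subseteq> diagram T \<and>
        (r1, c2) \<in> points T \<and> (r2, c1) \<in> points T \<and> (r2, c3) \<in> points T \<and>
        (r1, c3) \<notin> points T \<and> (r2, c2) \<notin> points T)"

definition contains_V :: "tableau \<Rightarrow> bool" where
  "contains_V T \<longleftrightarrow>
     (\<exists>r1 r2 r3 c1 c2. r1 < r2 \<and> r2 < r3 \<and> c1 < c2 \<and>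
        {r1, r2, r3} \<times> {c1, c2} \<subseteq> diagram T \<and>
        (r1, c2) \<in> points T \<and> (r2, c1) \<in> points T \<and> (r3, c2) \<in> points T \<and>
        (r2, c2) \<notin> points T \<and> (r3, c1) \<notin> points T)"

definition baxter_tlts :: "nat \<Rightarrow> tableau set" where
  "baxter_tlts n =
     {T. tree_like_tableau T \<and> \<not> contains_H T \<and> \<not> contains_V T \<and> tableau_size T = n}"


section \<open>Insertion labeling\<close>

definition bottom_points :: "tableau \<Rightarrow> cell set" where
  "bottom_points T = {(i, j). (i, j) \<in> points T \<and> (\<forall>i'>i. (i', j) \<notin> diagram T)}"

definition special_point :: "tableau \<Rightarrow> cell" where
  "special_point T = (THE s. s \<in> bottom_points T \<and> (\<forall>c \<in> bottom_points T. snd c \<le> snd s))"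

definition rim :: "cell set \<Rightarrow> cell set" where
  "rim D = {(i, j). (i, j) \<in> D \<and> (Suc i, Suc j) \<notin> D}"

text \<open>The rim cells of a Ferrers diagram form a path going right and up: the right and the upper
  neighbour of a rim cell are never both rim cells, so the two step rules below follow that path.
  The walk stops just before the first pointed cell.\<close>

inductive_set ribbon :: "tableau \<Rightarrow> cell set" for T :: tableau where
  start: "\<lbrakk>special_point T = (i, j); (i, Suc j) \<in> diagram T; (i, Suc j) \<notin> points T\<rbrakk>
          \<Longrightarrow> (i, Suc j) \<in> ribbon T"
| step_right: "\<lbrakk>(i, j) \<in> ribbon T; (i, Suc j) \<in> rim (diagram T); (i, Suc j) \<notin> points T\<rbrakk>
          \<Longrightarrow> (i, Suc j) \<in> ribbon T"
| step_up: "\<lbrakk>(Suc i, j) \<in> ribbon T; (i, j) \<in> rim (diagram T); (i, j) \<notin> points T\<rbrakk>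
          \<Longrightarrow> (i, j) \<in> ribbon T"

text \<open>The row or column deleted together with the special point, and the resulting
  renumbering of the remaining cells (closing up the gap).\<close>

definition deleted_line :: "tableau \<Rightarrow> cell set" where
  "deleted_line T =
     (let s = special_point T in
      if \<not> point_above T s then {c \<in> diagram T. snd c = snd s}
      else {c \<in> diagram T. fst c = fst s})"

definition close_gap :: "tableau \<Rightarrow> cell \<Rightarrow> cell" where
  "close_gap T c =
     (let s = special_point T in
      if \<not> point_above T s then (fst c, if snd s < snd c then snd c - 1 else snd c)
      else (if fst s < fst c then fst c - 1 else fst c, snd c))"

definition remove_special :: "tableau \<Rightarrow> tableau" where
  "remove_special T =
     (let keep = diagram T - deleted_line T - ribbon T in
      Tableau (close_gap T ` keep) (close_gap T ` (points T \<inter> keep)))"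

text \<open>The first argument is the size of the tableau. Values outside the points of the
  tableau, and the value for size 0, are irrelevant.\<close>

fun label_of_size :: "nat \<Rightarrow> tableau \<Rightarrow> cell \<Rightarrow> nat" where
  "label_of_size 0 T c = 0"
| "label_of_size (Suc 0) T c = 1"
| "label_of_size (Suc (Suc n)) T c =
     (if c = special_point T then Suc (Suc n)
      else label_of_size (Suc n) (remove_special T) (close_gap T c))"

definition insertion_label :: "tableau \<Rightarrow> cell \<Rightarrow> nat" where
  "insertion_label T = label_of_size (tableau_size T) T"

definition labeled_cell :: "tableau \<Rightarrow> nat \<Rightarrow> cell" where
  "labeled_cell T m = (THE c. c \<in> points T \<and> insertion_label T c = m)"


section \<open>Packed floorplans\<close>

text \<open>The plane has its x-axis pointing right and its y-axis pointing up. The rectangle of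
  height \<open>k\<close> and width \<open>l\<close> is placed with its bottom-left corner at the origin.\<close>

definition rectangle :: "nat \<Rightarrow> nat \<Rightarrow> (real \<times> real) set" where
  "rectangle k l = cbox (0, 0) (real l, real k)"

text \<open>In the last condition, \<open>(r1, b1)\<close> is the bottom-right corner of the first tile and
  \<open>(l2, t2)\<close> is the top-left corner of the second tile.\<close>

definition packed_floorplan :: "nat \<Rightarrow> nat \<Rightarrow> (real \<times> real) set set \<Rightarrow> bool" where
  "packed_floorplan k l F \<longleftrightarrow>
     0 < k \<and> 0 < l \<and>
     F division_of rectangle k l \<and>
     card F = k + l - 1 \<and>
     (\<forall>t\<in>F. \<exists>x1 y1 x2 y2. t = cbox (x1, y1) (x2, y2) \<and>
        0 < x2 - x1 \<and> x2 - x1 \<in> \<int> \<and> 0 < y2 - y1 \<and> y2 - y1 \<in> \<int>) \<and>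
     \<not> (\<exists>l1 b1 r1 t1 l2 b2 r2 t2.
          cbox (l1, b1) (r1, t1) \<in> F \<and> cbox (l2, b2) (r2, t2) \<in> F \<and>
          r1 \<le> l2 \<and> b1 \<ge> t2)"

definition packed_floorplans :: "nat \<Rightarrow> (real \<times> real) set set set" where
  "packed_floorplans n = {F. \<exists>k l. packed_floorplan k l F \<and> k + l - 1 = n}"


section \<open>From tableaux to floorplans\<close>

text \<open>The top-left corner of a cell when the diagram is placed in the rectangle with as many rows
  and columns, top-left corners aligned.\<close>

definition top_left_corner :: "tableau \<Rightarrow> cell \<Rightarrow> real \<times> real" where
  "top_left_corner T c = (real (snd c), real (num_rows T) - real (fst c))"

text \<open>The segment from \<open>p\<close> in direction \<open>d\<close> up to the first point of \<open>S\<close> after \<open>p\<close>. When the ray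
  starts out running inside \<open>S\<close> (a segment along the boundary of the rectangle), the infimum is 0,
  so that nothing new is drawn.\<close>

definition extended_segment ::
  "(real \<times> real) set \<Rightarrow> real \<times> real \<Rightarrow> real \<times> real \<Rightarrow> (real \<times> real) set" where
  "extended_segment S p d = closed_segment p (p + Inf {t. 0 < t \<and> p + t *\<^sub>R d \<in> S} *\<^sub>R d)"

definition draw_segments :: "real \<times> real \<Rightarrow> (real \<times> real) set \<Rightarrow> (real \<times> real) set" where
  "draw_segments p S = S \<union> extended_segment S p (1, 0) \<union> extended_segment S p (0, -1)"

text \<open>The boundary of the rectangle together with the segments drawn for the labels
  \<open>n, n - 1, \<dots>, 1\<close>, in this order.\<close>

definition drawing :: "tableau \<Rightarrow> (real \<times> real) set" where
  "drawing T =
     fold (\<lambda>m. draw_segments (top_left_corner T (labeled_cell T m)))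
       (rev [1..<Suc (tableau_size T)])
       (frontier (rectangle (num_rows T) (num_cols T)))"

definition Phi_F :: "tableau \<Rightarrow> (real \<times> real) set set" where
  "Phi_F T = closure ` components (rectangle (num_rows T) (num_cols T) - drawing T)"

end

theory Submission
  imports Defs
begin

text \<open>
  The patterns H and V only concern the points. For every numbering of the points of a Baxter
  tree-like tableau that increases towards the south-east, the part of the rectangle south-east of a
  point and not south-east of a later point is again a rectangle, and these rectangles form a packed
  floorplan, which is what the drawing procedure produces. Conversely the top-left corners of the
  tiles of a packed floorplan satisfy the conditions on the points, and each floorplan arises from some
  numbering because disjoint rectangles can be removed one by one towards the south-east.

  Several numberings may produce the same floorplan. Exactly one of them is greedy, in the sense that
  always the rightmost removable tile is removed first. The insertion labelings are greedy: an insertion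
  inside a ribbon would create H or V. Finally the diagram and the insertion labeling determine each
  other once the points are given: the last point together with the preceding one tells where the ribbon
  runs, and for a greedy numbering the last point always sits at a border edge of the smaller diagram,
  by H- and V-avoidance and because every crossing (a cell with points above it and to its left) lies
  in the ribbon of some step.
\<close>

section \<open>Baxter point configurations\<close>

text \<open>The tiles do not record an order on the points: exchanging consecutive labels changes no
  tile when a later point already cuts off every cell south-east of both points. Hence a canonical
  order is needed, and it must be recognised without looking at diagrams. Greediness of the
  insertion labeling does not follow by induction alone, since deleting the special point loses the
  reason why no later point falls between a point and the end of its ribbon. Crossings keep that
  reason: they persist under later insertions, and by H and V no point may follow them in their row
  or column. The induction therefore carries two further statements: ribbons leave crossings in all
  their rows and columns (\<open>blocked\<close>), and every crossing of the diagram comes from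
  consecutive labels around it (\<open>covered\<close>). The first makes insertion labelings greedy,
  the second makes greedy labelings realizable. The tile count \<open>k + l - 1\<close> enters
  through counting row and column starts: it forces a top-left corner into every row and every
  column of a floorplan.\<close>

definition has_above :: "cell set \<Rightarrow> cell \<Rightarrow> bool" where
  "has_above P p \<longleftrightarrow> (\<exists>i < fst p. (i, snd p) \<in> P)"

definition has_left :: "cell set \<Rightarrow> cell \<Rightarrow> bool" where
  "has_left P p \<longleftrightarrow> (\<exists>j < snd p. (fst p, j) \<in> P)"

text \<open>Three pointed cells suffice to record each pattern: the lowest rightmost of them puts
  all six cells into any Ferrers diagram containing the points, and the exclusive choice between a
  point above and a point to the left keeps the two remaining cells empty.\<close>

definition baxter_points :: "nat \<Rightarrow> nat \<Rightarrow> cell set \<Rightarrow> bool" where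
  "baxter_points k l P \<longleftrightarrow>
     fst ` P = {..<k} \<and> snd ` P = {..<l} \<and> (0, 0) \<in> P \<and>
     (\<forall>p \<in> P - {(0, 0)}. has_above P p \<noteq> has_left P p) \<and>
     (\<forall>r1 r2 c1 c2 c3. r1 < r2 \<longrightarrow> c1 < c2 \<longrightarrow> c2 < c3 \<longrightarrow>
        (r1, c2) \<in> P \<longrightarrow> (r2, c1) \<in> P \<longrightarrow> (r2, c3) \<notin> P) \<and>
     (\<forall>r1 r2 r3 c1 c2. r1 < r2 \<longrightarrow> r2 < r3 \<longrightarrow> c1 < c2 \<longrightarrow>
        (r1, c2) \<in> P \<longrightarrow> (r2, c1) \<in> P \<longrightarrow> (r3, c2) \<notin> P)"

lemma baxter_pointsD:
  assumes "baxter_points k l P"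
  shows "fst ` P = {..<k}" "snd ` P = {..<l}" "(0, 0) \<in> P"
    "p \<in> P \<Longrightarrow> p \<noteq> (0, 0) \<Longrightarrow> has_above P p \<noteq> has_left P p"
    "r1 < r2 \<Longrightarrow> c1 < c2 \<Longrightarrow> c2 < c3 \<Longrightarrow> (r1, c2) \<in> P \<Longrightarrow> (r2, c1) \<in> P \<Longrightarrow> (r2, c3) \<notin> P"
    "r1 < r2 \<Longrightarrow> r2 < r3 \<Longrightarrow> c1 < c2 \<Longrightarrow> (r1, c2) \<in> P \<Longrightarrow> (r2, c1) \<in> P \<Longrightarrow> (r3, c2) \<notin> P"
proof -
  note * = assms[unfolded baxter_points_def]
  note xor = *[THEN conjunct2, THEN conjunct2, THEN conjunct2, THEN conjunct1, rule_format]
  note H = *[THEN conjunct2, THEN conjunct2, THEN conjunct2, THEN conjunct2, THEN conjunct1, rule_format]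
  note V = *[THEN conjunct2, THEN conjunct2, THEN conjunct2, THEN conjunct2, THEN conjunct2, rule_format]
  show "fst ` P = {..<k}" by (rule *[THEN conjunct1])
  show "snd ` P = {..<l}" by (rule *[THEN conjunct2, THEN conjunct1])
  show "(0, 0) \<in> P" by (rule *[THEN conjunct2, THEN conjunct2, THEN conjunct1])
  show "p \<in> P \<Longrightarrow> p \<noteq> (0, 0) \<Longrightarrow> has_above P p \<noteq> has_left P p" by (rule xor) simp
  show "r1 < r2 \<Longrightarrow> c1 < c2 \<Longrightarrow> c2 < c3 \<Longrightarrow> (r1, c2) \<in> P \<Longrightarrow> (r2, c1) \<in> P \<Longrightarrow> (r2, c3) \<notin> P"
    by (rule H)
  show "r1 < r2 \<Longrightarrow> r2 < r3 \<Longrightarrow> c1 < c2 \<Longrightarrow> (r1, c2) \<in> P \<Longrightarrow> (r2, c1) \<in> P \<Longrightarrow> (r3, c2) \<notin> P"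
    by (rule V)
qed

lemma baxter_points_bounded:
  assumes "baxter_points k l P" "(r, c) \<in> P"
  shows "r < k" "c < l"
proof -
  have "fst (r, c) \<in> fst ` P" "snd (r, c) \<in> snd ` P" using assms(2) by blast+
  then show "r < k" "c < l" unfolding baxter_pointsD(1,2)[OF assms(1)] by simp_all
qed

lemma baxter_points_finite:
  assumes "baxter_points k l P"
  shows "finite P"
proof (rule finite_subset)
  show "P \<subseteq> {..<k} \<times> {..<l}" using baxter_points_bounded[OF assms] by (simp add: subrelI)
qed simp

lemma baxter_points_row:
  assumes "baxter_points k l P" "r < k" obtains c where "(r, c) \<in> P"
proof -
  have "r \<in> fst ` P" unfolding baxter_pointsD(1)[OF assms(1)] using assms(2) by simp
  then show ?thesis using that by auto
qed

lemma baxter_points_col: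
  assumes "baxter_points k l P" "c < l" obtains r where "(r, c) \<in> P"
proof -
  have "c \<in> snd ` P" unfolding baxter_pointsD(2)[OF assms(1)] using assms(2) by simp
  then show ?thesis using that by auto
qed

section \<open>Crossings and the lines they close\<close>

definition crossing :: "cell set \<Rightarrow> cell \<Rightarrow> bool" where
  "crossing P p \<longleftrightarrow> has_above P p \<and> has_left P p"

text \<open>A point at the crossing itself would have points both above it and to its left; a point
  further right would complete H with the two witnesses of the crossing.\<close>

lemma crossing_row:
  assumes "baxter_points k l P" "crossing P (x, y)" "(x, z) \<in> P"
  shows "z < y"
proof (rule ccontr)
  assume "\<not> z < y"
  obtain i j where *: "i < x" "(i, y) \<in> P" "j < y" "(x, j) \<in> P"
    using assms(2) by (auto simp: crossing_def has_above_def has_left_def)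
  show False
  proof (cases "z = y")
    case True
    then show False using assms * baxter_pointsD(4)[OF assms(1), of "(x, y)"]
      by (auto simp: crossing_def)
  next
    case False
    then show False using baxter_pointsD(5)[OF assms(1) *(1,3) _ *(2,4), of z] \<open>\<not> z < y\<close> assms(3) by auto
  qed
qed

lemma crossing_col:
  assumes "baxter_points k l P" "crossing P (x, y)" "(z, y) \<in> P"
  shows "z < x"
proof (rule ccontr)
  assume "\<not> z < x"
  obtain i j where *: "i < x" "(i, y) \<in> P" "j < y" "(x, j) \<in> P"
    using assms(2) by (auto simp: crossing_def has_above_def has_left_def)
  show False
  proof (cases "z = x")
    case True
    then show False using assms * baxter_pointsD(4)[OF assms(1), of "(x, y)"]
      by (auto simp: crossing_def)
  next
    case False
    then show False using baxter_pointsD(6)[OF assms(1) *(1) _ *(3) *(2,4), of z] \<open>\<not> z < x\<close> assms(3) by auto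
  qed
qed

text \<open>A point with a point above it has none to its left, so it is the first of its row;
  conversely the first point of a row below the top one has a point above it. The equivalence is
  used in both directions: for configurations it yields the number of points, for floorplans the
  number of corners yields that no row is empty.\<close>

lemma card_row_starts:
  assumes fst: "fst ` P \<subseteq> {..<k}" and zero: "(0, 0) \<in> P" and finP: "finite P"
    and xor: "\<And>p. p \<in> P \<Longrightarrow> p \<noteq> (0, 0) \<Longrightarrow> has_above P p \<noteq> has_left P p"
  shows "inj_on fst {p \<in> P. has_above P p}" "fst ` {p \<in> P. has_above P p} \<subseteq> {1..<k}"
    "fst ` {p \<in> P. has_above P p} = {1..<k} \<longleftrightarrow> fst ` P = {..<k}"
proof -
  let ?A = "{p \<in> P. has_above P p}"
  show inj: "inj_on fst ?A"
  proof (rule inj_onI)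
    fix p q assume pq: "p \<in> ?A" "q \<in> ?A" "fst p = fst q"
    have *: False if "p \<in> ?A" "q \<in> ?A" "fst p = fst q" "snd p < snd q" for p q
    proof -
      have "(fst q, snd p) \<in> P" using that by (metis (no_types, lifting) mem_Collect_eq prod.collapse)
      then have "has_left P q" using that(4) by (auto simp: has_left_def)
      moreover have "q \<noteq> (0, 0)" using that by auto
      ultimately show False using xor that by blast
    qed
    have "\<not> snd p < snd q" using *[of p q] pq by blast
    moreover have "\<not> snd q < snd p" using *[of q p] pq by auto
    ultimately have "snd p = snd q" by linarith
    then show "p = q" using pq(3) by (simp add: prod_eq_iff)
  qed
  show sub: "fst ` ?A \<subseteq> {1..<k}" using fst by (auto simp: has_above_def)
  show "fst ` ?A = {1..<k} \<longleftrightarrow> fst ` P = {..<k}"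
  proof
    assume *: "fst ` ?A = {1..<k}"
    have "{..<k} \<subseteq> fst ` P"
    proof
      fix x assume "x \<in> {..<k}"
      then have "x = 0 \<or> x \<in> {1..<k}" by auto
      then show "x \<in> fst ` P"
      proof
        assume "x = 0"
        then show ?thesis using zero by force
      next
        assume "x \<in> {1..<k}"
        then have "x \<in> fst ` ?A" unfolding * .
        then show ?thesis by blast
      qed
    qed
    then show "fst ` P = {..<k}" using fst by blast
  next
    assume *: "fst ` P = {..<k}"
    have "{1..<k} \<subseteq> fst ` ?A"
    proof
      fix r assume r: "r \<in> {1..<k}"
      then have "r \<in> fst ` P" using * by auto
      then have ex: "\<exists>c. (r, c) \<in> P" by auto
      define c where "c = (LEAST c. (r, c) \<in> P)"
      have c: "(r, c) \<in> P" unfolding c_def using ex by (rule LeastI_ex)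
      have "\<not> has_left P (r, c)" unfolding c_def has_left_def using not_less_Least by auto
      then have "has_above P (r, c)" using xor[OF c] r by auto
      then show "r \<in> fst ` ?A" using c by force
    qed
    then show "fst ` ?A = {1..<k}" using sub by blast
  qed
qed

lemma card_col_starts:
  assumes snd: "snd ` P \<subseteq> {..<l}" and zero: "(0, 0) \<in> P" and finP: "finite P"
    and xor: "\<And>p. p \<in> P \<Longrightarrow> p \<noteq> (0, 0) \<Longrightarrow> has_above P p \<noteq> has_left P p"
  shows "inj_on snd {p \<in> P. has_left P p}" "snd ` {p \<in> P. has_left P p} \<subseteq> {1..<l}"
    "snd ` {p \<in> P. has_left P p} = {1..<l} \<longleftrightarrow> snd ` P = {..<l}"
proof -
  let ?P = "prod.swap ` P"
  have hs: "has_above ?P p \<longleftrightarrow> has_left P (prod.swap p)" "has_left ?P p \<longleftrightarrow> has_above P (prod.swap p)" for p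
    by (force simp: has_above_def has_left_def prod.swap_def)+
  have eq: "{p \<in> ?P. has_above ?P p} = prod.swap ` {p \<in> P. has_left P p}"
    unfolding hs by force
  note * = card_row_starts[of ?P l]
  have "fst ` ?P \<subseteq> {..<l}" "(0, 0) \<in> ?P" "finite ?P"
    using assms by (force simp: prod.swap_def image_image)+
  moreover have "has_above ?P p \<noteq> has_left ?P p" if "p \<in> ?P" "p \<noteq> (0, 0)" for p
    unfolding hs using xor[of "prod.swap p"] that by (force simp: prod.swap_def)
  ultimately have **: "inj_on fst {p \<in> ?P. has_above ?P p}" "fst ` {p \<in> ?P. has_above ?P p} \<subseteq> {1..<l}"
    "fst ` {p \<in> ?P. has_above ?P p} = {1..<l} \<longleftrightarrow> fst ` ?P = {..<l}"
    using * by blast+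
  show "inj_on snd {p \<in> P. has_left P p}"
    using **(1) unfolding eq by (auto simp: inj_on_def)
  show "snd ` {p \<in> P. has_left P p} \<subseteq> {1..<l}"
    using **(2) unfolding eq by (simp add: image_image)
  show "snd ` {p \<in> P. has_left P p} = {1..<l} \<longleftrightarrow> snd ` P = {..<l}"
    using **(3) unfolding eq by (simp add: image_image)
qed

lemma card_starts:
  assumes "(0, 0) \<in> P" "finite P"
    and xor: "\<And>p. p \<in> P \<Longrightarrow> p \<noteq> (0, 0) \<Longrightarrow> has_above P p \<noteq> has_left P p"
  shows "card P = Suc (card {p \<in> P. has_above P p} + card {p \<in> P. has_left P p})"
proof -
  let ?A = "{p \<in> P. has_above P p}" and ?B = "{p \<in> P. has_left P p}"
  have "P = insert (0, 0) (?A \<union> ?B)" using assms by auto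
  moreover have "(0, 0) \<notin> ?A \<union> ?B" by (auto simp: has_above_def has_left_def)
  ultimately have "card P = Suc (card (?A \<union> ?B))" using assms(2) by (metis (no_types, lifting) card_insert_disjoint finite_insert)
  moreover have "?A \<inter> ?B = {}" using xor by (force simp: has_above_def has_left_def)
  then have "card (?A \<union> ?B) = card ?A + card ?B"
    using assms(2) by (intro card_Un_disjoint) auto
  ultimately show ?thesis by simp
qed

lemma baxter_points_card:
  assumes "baxter_points k l P"
  shows "card P = k + l - 1" "0 < k" "0 < l"
proof -
  note D = baxter_pointsD[OF assms] baxter_points_finite[OF assms]
  show kl: "0 < k" "0 < l" using baxter_points_bounded[OF assms D(3)] by auto
  have "card {p \<in> P. has_above P p} = k - 1"
    using card_row_starts[of P k] D by (metis (no_types, lifting) card_atLeastLessThan card_image order_refl)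
  moreover have "card {p \<in> P. has_left P p} = l - 1"
    using card_col_starts[of P l] D by (metis (no_types, lifting) card_atLeastLessThan card_image order_refl)
  ultimately show "card P = k + l - 1" using card_starts[of P] D kl by simp
qed

section \<open>Tiles of a labeled configuration\<close>

text \<open>The order on cells is the componentwise one, so these are the linear extensions of the
  points ordered towards the south-east, with labels starting at 1.\<close>

definition linext :: "cell set \<Rightarrow> (cell \<Rightarrow> nat) \<Rightarrow> bool" where
  "linext P lab \<longleftrightarrow> bij_betw lab P {1..card P} \<and> (\<forall>p\<in>P. \<forall>q\<in>P. p \<le> q \<longrightarrow> lab p \<le> lab q)"

lemma linext_inj: "linext P lab \<Longrightarrow> p \<in> P \<Longrightarrow> q \<in> P \<Longrightarrow> lab p = lab q \<Longrightarrow> p = q"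
  by (auto simp: linext_def bij_betw_def inj_on_def)

lemma linext_mono: "linext P lab \<Longrightarrow> p \<in> P \<Longrightarrow> q \<in> P \<Longrightarrow> p \<le> q \<Longrightarrow> lab p \<le> lab q"
  by (auto simp: linext_def)

lemma linext_range: "linext P lab \<Longrightarrow> p \<in> P \<Longrightarrow> 1 \<le> lab p \<and> lab p \<le> card P"
  by (auto simp: linext_def bij_betw_def)

lemma linext_obtain:
  assumes "linext P lab" "1 \<le> m" "m \<le> card P" obtains p where "p \<in> P" "lab p = m"
proof -
  have "m \<in> lab ` P" using assms unfolding linext_def bij_betw_def by auto
  then show ?thesis using that by blast
qed

definition tile :: "nat \<Rightarrow> nat \<Rightarrow> cell set \<Rightarrow> (cell \<Rightarrow> nat) \<Rightarrow> cell \<Rightarrow> cell set" where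
  "tile k l P lab p = {x \<in> {..<k} \<times> {..<l}. p \<le> x \<and> (\<forall>q\<in>P. lab p < lab q \<longrightarrow> \<not> q \<le> x)}"

text \<open>A later point in a column up to that of \<open>p\<close> lies strictly below
  \<open>p\<close>, since otherwise it would precede \<open>p\<close> in the componentwise order.
  The highest such point cuts the tile off from below; \<open>k\<close> stands for the bottom of the
  rectangle.\<close>

definition tile_bottom :: "nat \<Rightarrow> cell set \<Rightarrow> (cell \<Rightarrow> nat) \<Rightarrow> cell \<Rightarrow> nat" where
  "tile_bottom k P lab p = Min (insert k (fst ` {q \<in> P. lab p < lab q \<and> snd q \<le> snd p}))"

definition tile_right :: "nat \<Rightarrow> cell set \<Rightarrow> (cell \<Rightarrow> nat) \<Rightarrow> cell \<Rightarrow> nat" where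
  "tile_right l P lab p = Min (insert l (snd ` {q \<in> P. lab p < lab q \<and> fst q \<le> fst p}))"

definition cells :: "cell \<times> cell \<Rightarrow> cell set" where
  "cells b = {fst (fst b)..<fst (snd b)} \<times> {snd (fst b)..<snd (snd b)}"

definition tile_box :: "nat \<Rightarrow> nat \<Rightarrow> cell set \<Rightarrow> (cell \<Rightarrow> nat) \<Rightarrow> cell \<Rightarrow> cell \<times> cell" where
  "tile_box k l P lab p = (p, (tile_bottom k P lab p, tile_right l P lab p))"

text \<open>Follow the parents of \<open>(i, j)\<close> upwards and to the left. A parent that jumps
  over row \<open>r\<close> completes V with \<open>(r, c)\<close>, one that jumps over column
  \<open>c\<close> completes H, so the walk must hit the row or the column of
  \<open>(r, c)\<close>.\<close>

lemma baxter_southeast: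
  assumes P: "baxter_points k l P" and p: "(r, c) \<in> P" and "(i, j) \<in> P" "r < i" "c < j"
  shows "(\<exists>i'. r < i' \<and> i' \<le> i \<and> (i', c) \<in> P) \<or> (\<exists>j'. c < j' \<and> j' \<le> j \<and> (r, j') \<in> P)"
  using assms(3-5)
proof (induction "i + j" arbitrary: i j rule: less_induct)
  case less
  have "has_above P (i, j) \<or> has_left P (i, j)"
    using baxter_pointsD(4)[OF P less(2)] less(3) by auto
  then consider i' where "i' < i" "(i', j) \<in> P" | j' where "j' < j" "(i, j') \<in> P"
    by (auto simp: has_above_def has_left_def)
  then show ?case
  proof cases
    case 1
    consider "i' < r" | "i' = r" | "i' > r" by linarith
    then show ?thesis
    proof cases
      case 1
      then show ?thesis
        using baxter_pointsD(6)[OF P 1 less(3) less(4) \<open>(i', j) \<in> P\<close> p] less(2) by blast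
    next
      case 2
      then show ?thesis using \<open>(i', j) \<in> P\<close> less(4) by blast
    next
      case 3
      then show ?thesis using less(1)[of i' j] less(4) \<open>(i', j) \<in> P\<close> \<open>i' < i\<close>
        by (meson add_less_mono1 less_imp_le_nat order_trans)
    qed
  next
    case 2
    consider "j' < c" | "j' = c" | "j' > c" by linarith
    then show ?thesis
    proof cases
      case 1
      then show ?thesis
        using baxter_pointsD(5)[OF P less(3) 1 less(4) p \<open>(i, j') \<in> P\<close>] less(2) by blast
    next
      case 2
      then show ?thesis using \<open>(i, j') \<in> P\<close> less(3) by blast
    next
      case 3
      then show ?thesis using less(1)[of i j'] less(3) \<open>(i, j') \<in> P\<close> \<open>j' < j\<close>
        by (meson add_less_cancel_left less_imp_le_nat order_trans)
    qed
  qed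
qed

context
  fixes k l P lab
  assumes P: "baxter_points k l P" and lab: "linext P lab"
begin

private lemma finP: "finite P" by (rule baxter_points_finite[OF P])

lemma tile_bottom_le: "tile_bottom k P lab p \<le> k"
  "q \<in> P \<Longrightarrow> lab p < lab q \<Longrightarrow> snd q \<le> snd p \<Longrightarrow> tile_bottom k P lab p \<le> fst q"
  unfolding tile_bottom_def using finP by (auto intro!: Min_le)

lemma tile_right_le: "tile_right l P lab p \<le> l"
  "q \<in> P \<Longrightarrow> lab p < lab q \<Longrightarrow> fst q \<le> fst p \<Longrightarrow> tile_right l P lab p \<le> snd q"
  unfolding tile_right_def using finP by (auto intro!: Min_le)

lemma tile_bottom_attained:
  assumes "tile_bottom k P lab p < k"
  obtains q where "q \<in> P" "lab p < lab q" "snd q \<le> snd p" "fst q = tile_bottom k P lab p"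
proof -
  have "tile_bottom k P lab p \<in> insert k (fst ` {q \<in> P. lab p < lab q \<and> snd q \<le> snd p})"
    unfolding tile_bottom_def using finP by (intro Min_in) auto
  then have "tile_bottom k P lab p \<in> fst ` {q \<in> P. lab p < lab q \<and> snd q \<le> snd p}" using assms by auto
  then show ?thesis using that by auto
qed

lemma tile_right_attained:
  assumes "tile_right l P lab p < l"
  obtains q where "q \<in> P" "lab p < lab q" "fst q \<le> fst p" "snd q = tile_right l P lab p"
proof -
  have "tile_right l P lab p \<in> insert l (snd ` {q \<in> P. lab p < lab q \<and> fst q \<le> fst p})"
    unfolding tile_right_def using finP by (intro Min_in) auto
  then have "tile_right l P lab p \<in> snd ` {q \<in> P. lab p < lab q \<and> fst q \<le> fst p}" using assms by auto
  then show ?thesis using that by auto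
qed

lemma later_not_le: "p \<in> P \<Longrightarrow> q \<in> P \<Longrightarrow> lab p < lab q \<Longrightarrow> \<not> q \<le> p"
  using linext_mono[OF lab] by (meson leD)

lemma tile_bottom_gt: assumes "p \<in> P" shows "fst p < tile_bottom k P lab p"
proof (cases "tile_bottom k P lab p = k")
  case True
  then show ?thesis using baxter_points_bounded[OF P, of "fst p" "snd p"] assms by simp
next
  case False
  then have "tile_bottom k P lab p < k" using tile_bottom_le(1)[of p] by simp
  then obtain q where "q \<in> P" "lab p < lab q" "snd q \<le> snd p" "fst q = tile_bottom k P lab p"
    by (rule tile_bottom_attained)
  then show ?thesis using later_not_le[OF assms, of q] by (auto simp: less_eq_prod_def)
qed

lemma tile_right_gt: assumes "p \<in> P" shows "snd p < tile_right l P lab p"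
proof (cases "tile_right l P lab p = l")
  case True
  then show ?thesis using baxter_points_bounded[OF P, of "fst p" "snd p"] assms by simp
next
  case False
  then have "tile_right l P lab p < l" using tile_right_le(1)[of p] by simp
  then obtain q where "q \<in> P" "lab p < lab q" "fst q \<le> fst p" "snd q = tile_right l P lab p"
    by (rule tile_right_attained)
  then show ?thesis using later_not_le[OF assms, of q] by (auto simp: less_eq_prod_def)
qed

lemma tile_eq_cells: assumes p: "p \<in> P" shows "tile k l P lab p = cells (tile_box k l P lab p)"
proof (intro set_eqI iffI)
  fix x assume x: "x \<in> tile k l P lab p"
  then have px: "fst p \<le> fst x" "snd p \<le> snd x" by (auto simp: tile_def less_eq_prod_def)
  have "fst x < tile_bottom k P lab p"
  proof (rule ccontr)
    assume *: "\<not> ?thesis"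
    then have "tile_bottom k P lab p < k" using x by (auto simp: tile_def)
    then obtain q where "q \<in> P" "lab p < lab q" "snd q \<le> snd p" "fst q = tile_bottom k P lab p"
      by (rule tile_bottom_attained)
    then show False using x px * by (auto simp: tile_def less_eq_prod_def)
  qed
  moreover have "snd x < tile_right l P lab p"
  proof (rule ccontr)
    assume *: "\<not> ?thesis"
    then have "tile_right l P lab p < l" using x by (auto simp: tile_def)
    then obtain q where "q \<in> P" "lab p < lab q" "fst q \<le> fst p" "snd q = tile_right l P lab p"
      by (rule tile_right_attained)
    then show False using x px * by (auto simp: tile_def less_eq_prod_def)
  qed
  ultimately show "x \<in> cells (tile_box k l P lab p)"
    using px by (auto simp: cells_def tile_box_def mem_Times_iff)
next
  fix x assume x: "x \<in> cells (tile_box k l P lab p)"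
  have px: "p \<le> x" and xb: "fst x < tile_bottom k P lab p" "snd x < tile_right l P lab p"
    using x by (auto simp: cells_def tile_box_def mem_Times_iff less_eq_prod_def)
  have "\<not> q \<le> x" if q: "q \<in> P" "lab p < lab q" for q
  proof
    assume qx: "q \<le> x"
    have 1: "snd p < snd q"
    proof (rule ccontr)
      assume "\<not> ?thesis"
      then have "tile_bottom k P lab p \<le> fst q" using tile_bottom_le(2)[OF q] by simp
      then show False using qx xb by (auto simp: less_eq_prod_def)
    qed
    have 2: "fst p < fst q"
    proof (rule ccontr)
      assume "\<not> ?thesis"
      then have "tile_right l P lab p \<le> snd q" using tile_right_le(2)[OF q] by simp
      then show False using qx xb by (auto simp: less_eq_prod_def)
    qed
    \<comment> \<open>A later point strictly south-east of \<open>p\<close> yields a point in the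
      row or column of \<open>p\<close>. That point is itself later than \<open>p\<close> and bounds
      the tile before \<open>x\<close>.\<close>
    consider i' where "fst p < i'" "i' \<le> fst q" "(i', snd p) \<in> P" | j' where "snd p < j'" "j' \<le> snd q" "(fst p, j') \<in> P"
      using baxter_southeast[OF P, of "fst p" "snd p" "fst q" "snd q"] p q 1 2 by auto
    then show False
    proof cases
      case 1
      have "lab p < lab (i', snd p)"
        using linext_mono[OF lab p 1(3)] linext_inj[OF lab p 1(3)] 1(1)
        by (cases p) (force simp: less_eq_prod_def)
      then show False using tile_bottom_le(2)[OF 1(3), of p] 1(2) qx xb by (auto simp: less_eq_prod_def)
    next
      case 2
      have "lab p < lab (fst p, j')"
        using linext_mono[OF lab p 2(3)] linext_inj[OF lab p 2(3)] 2(1)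
        by (cases p) (force simp: less_eq_prod_def)
      then show False using tile_right_le(2)[OF 2(3), of p] 2(2) qx xb by (auto simp: less_eq_prod_def)
    qed
  qed
  moreover have "x \<in> {..<k} \<times> {..<l}"
    using xb tile_bottom_le(1)[of p] tile_right_le(1)[of p] by (auto simp: mem_Times_iff)
  ultimately show "x \<in> tile k l P lab p" using px by (auto simp: tile_def)
qed

text \<open>The owner is the point with the largest label among those weakly north-west of the cell;
  the root is always among them.\<close>

lemma tile_exists:
  assumes "x \<in> {..<k} \<times> {..<l}"
  obtains p where "p \<in> P" "x \<in> tile k l P lab p"
proof -
  let ?A = "{p \<in> P. p \<le> x}"
  have "(0, 0) \<in> ?A" using baxter_pointsD(3)[OF P] by (auto simp: less_eq_prod_def)
  moreover have "finite ?A" using finP by simp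
  ultimately have "Max (lab ` ?A) \<in> lab ` ?A" by (intro Max_in) auto
  then obtain p where p: "p \<in> P" "p \<le> x" "lab p = Max (lab ` ?A)" by auto
  have "\<not> q \<le> x" if "q \<in> P" "lab p < lab q" for q
  proof
    assume "q \<le> x"
    then have "lab q \<le> Max (lab ` ?A)" using that \<open>finite ?A\<close> by (intro Max_ge) auto
    then show False using p that by simp
  qed
  then show ?thesis using that[of p] p assms by (auto simp: tile_def)
qed

lemma tile_unique:
  assumes "p \<in> P" "q \<in> P" "x \<in> tile k l P lab p" "x \<in> tile k l P lab q"
  shows "p = q"
proof -
  have "\<not> lab p < lab q" "\<not> lab q < lab p" using assms by (auto simp: tile_def)
  then show ?thesis using linext_inj[OF lab assms(1,2)] by simp
qed

text \<open>If the bottom and the right side of a tile both stop inside the rectangle, the points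
  that stop them make its outer corner a crossing. No point lies south-east of a crossing: following
  parents towards it, a point can neither land on the closed row or column nor jump over them
  without forming V or H.\<close>

lemma tile_packed:
  assumes p: "p \<in> P" and "q \<in> P"
  shows "\<not> snd (tile_box k l P lab p) \<le> q"
proof
  define B where "B = tile_bottom k P lab p"
  define R where "R = tile_right l P lab p"
  have B: "fst p < B" and R: "snd p < R"
    unfolding B_def R_def using tile_bottom_gt[OF p] tile_right_gt[OF p] by auto
  assume "snd (tile_box k l P lab p) \<le> q"
  then have q: "B \<le> fst q" "R \<le> snd q" by (auto simp: tile_box_def B_def R_def less_eq_prod_def)
  have qb: "fst q < k" "snd q < l" using baxter_points_bounded[OF P, of "fst q" "snd q"] assms by auto
  \<comment> \<open>The point \<open>q\<close> shows that \<open>B\<close> and \<open>R\<close> are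
    below the defaults \<open>k\<close> and \<open>l\<close>, so both minima are attained by
    points.\<close>
  obtain x1 where x1: "x1 \<in> P" "snd x1 \<le> snd p" "fst x1 = B"
    using tile_bottom_attained[of p] q qb unfolding B_def by (metis order.strict_trans1)
  obtain x2 where x2: "x2 \<in> P" "fst x2 \<le> fst p" "snd x2 = R"
    using tile_right_attained[of p] q qb unfolding R_def by (metis order.strict_trans1)
  have x1': "(B, snd x1) \<in> P" and x2': "(fst x2, R) \<in> P" using x1 x2 by (metis prod.collapse)+
  have cr: "crossing P (B, R)"
    unfolding crossing_def has_above_def has_left_def
    using x1' x2' B R x1(2) x2(2) by (metis fst_conv le_less_trans snd_conv)
  have False if "(i, j) \<in> P" "B \<le> i" "R \<le> j" for i j
    using that
  proof (induction "i + j" arbitrary: i j rule: less_induct)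
    case less
    have i: "B < i" using crossing_row[OF P cr, of j] less(2-4) by (metis le_neq_implies_less leD)
    have j: "R < j" using crossing_col[OF P cr, of i] less(2-4) by (metis le_neq_implies_less leD)
    have "has_above P (i, j) \<or> has_left P (i, j)"
      using baxter_pointsD(4)[OF P less(2)] i by auto
    then consider i' where "i' < i" "(i', j) \<in> P" | j' where "j' < j" "(i, j') \<in> P"
      by (auto simp: has_above_def has_left_def)
    then show ?case
    proof cases
      case 1
      show ?thesis
      proof (cases "B \<le> i'")
        case True
        then show ?thesis using less(1)[of i' j] 1 less(4) by simp
      next
        case False
        then show ?thesis
          using baxter_pointsD(6)[OF P, of i' B i "snd x1" j] i j 1 x1' x1(2) R less(2) by simp
      qed
    next
      case 2
      show ?thesis
      proof (cases "R \<le> j'")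
        case True
        then show ?thesis using less(1)[of i j'] 2 less(3) by simp
      next
        case False
        then show ?thesis
          using baxter_pointsD(5)[OF P, of "fst x2" i j' R j] i j 2 x2' x2(2) B less(2) by simp
      qed
    qed
  qed
  then show False using q assms(2) by (metis prod.collapse)
qed

end

section \<open>Floorplans made of cells\<close>

text \<open>A tile is given by its top-left cell and by the corner just beyond its bottom-right cell.\<close>

definition floorplan :: "nat \<Rightarrow> nat \<Rightarrow> (cell \<times> cell) set \<Rightarrow> bool" where
  "floorplan k l B \<longleftrightarrow>
     0 < k \<and> 0 < l \<and> card B = k + l - 1 \<and>
     (\<forall>b\<in>B. fst (fst b) < fst (snd b) \<and> snd (fst b) < snd (snd b) \<and> snd b \<le> (k, l)) \<and>
     (\<forall>x \<in> {..<k} \<times> {..<l}. \<exists>b\<in>B. x \<in> cells b) \<and>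
     (\<forall>b\<in>B. \<forall>b'\<in>B. cells b \<inter> cells b' \<noteq> {} \<longrightarrow> b = b') \<and>
     (\<forall>b\<in>B. \<forall>b'\<in>B. \<not> snd b \<le> fst b')"

lemma floorplan_tiles:
  assumes P: "baxter_points k l P" and lab: "linext P lab"
  shows "floorplan k l (tile_box k l P lab ` P)"
proof -
  have eq: "tile k l P lab p = cells (tile_box k l P lab p)" if "p \<in> P" for p
    by (rule tile_eq_cells[OF P lab that])
  have inj: "inj_on (tile_box k l P lab) P" by (auto simp: inj_on_def tile_box_def)
  have 1: "card (tile_box k l P lab ` P) = k + l - 1"
    using card_image[OF inj] baxter_points_card[OF P] by simp
  have 2: "\<exists>b\<in>tile_box k l P lab ` P. x \<in> cells b" if "x \<in> {..<k} \<times> {..<l}" for x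
    using tile_exists[OF P lab that] eq by (metis imageI)
  have 3: "p = q" if "p \<in> P" "q \<in> P" "cells (tile_box k l P lab p) \<inter> cells (tile_box k l P lab q) \<noteq> {}" for p q
    using that tile_unique[OF P lab that(1,2)] eq by blast
  have 4: "fst p < tile_bottom k P lab p \<and> snd p < tile_right l P lab p \<and>
     tile_bottom k P lab p \<le> k \<and> tile_right l P lab p \<le> l" if "p \<in> P" for p
    using tile_bottom_gt[OF P lab that] tile_right_gt[OF P lab that] tile_bottom_le(1)[OF P lab, of p] tile_right_le(1)[OF P lab, of p] by simp
  show ?thesis unfolding floorplan_def
  proof (intro conjI ballI impI)
    show "0 < k" "0 < l" by (rule baxter_points_card[OF P])+
    show "card (tile_box k l P lab ` P) = k + l - 1" by fact
    fix b assume b: "b \<in> tile_box k l P lab ` P"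
    show "fst (fst b) < fst (snd b)" "snd (fst b) < snd (snd b)" "snd b \<le> (k, l)"
      using 4 b by (auto simp: tile_box_def less_eq_prod_def)
    fix b' assume b': "b' \<in> tile_box k l P lab ` P"
    show "cells b \<inter> cells b' \<noteq> {} \<Longrightarrow> b = b'" using 3 b b' by blast
    have "fst b' \<in> P" using b' by (auto simp: tile_box_def)
    then show "\<not> snd b \<le> fst b'" using b tile_packed[OF P lab] by blast
  qed (use 2 in blast)
qed

lemma floorplanD:
  assumes "floorplan k l B"
  shows "0 < k" "0 < l" "card B = k + l - 1"
    "b \<in> B \<Longrightarrow> fst (fst b) < fst (snd b)" "b \<in> B \<Longrightarrow> snd (fst b) < snd (snd b)"
    "b \<in> B \<Longrightarrow> snd b \<le> (k, l)"
    "x \<in> {..<k} \<times> {..<l} \<Longrightarrow> \<exists>b\<in>B. x \<in> cells b"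
    "b \<in> B \<Longrightarrow> b' \<in> B \<Longrightarrow> x \<in> cells b \<Longrightarrow> x \<in> cells b' \<Longrightarrow> b = b'"
    "b \<in> B \<Longrightarrow> b' \<in> B \<Longrightarrow> \<not> snd b \<le> fst b'"
    "finite B"
proof -
  note * = assms[unfolded floorplan_def]
  show kl: "0 < k" "0 < l" using * by (simp_all only:)
  show card: "card B = k + l - 1" using * by (simp only:)
  note 1 = *[THEN conjunct2, THEN conjunct2, THEN conjunct2, THEN conjunct1, rule_format]
  note 2 = *[THEN conjunct2, THEN conjunct2, THEN conjunct2, THEN conjunct2]
  note 3 = 2[THEN conjunct1, rule_format] 2[THEN conjunct2, THEN conjunct1, rule_format]
    2[THEN conjunct2, THEN conjunct2, rule_format]
  show "b \<in> B \<Longrightarrow> fst (fst b) < fst (snd b)" "b \<in> B \<Longrightarrow> snd (fst b) < snd (snd b)"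
    "b \<in> B \<Longrightarrow> snd b \<le> (k, l)" using 1 by simp_all
  show "x \<in> {..<k} \<times> {..<l} \<Longrightarrow> \<exists>b\<in>B. x \<in> cells b" by (rule 3(1))
  show "b \<in> B \<Longrightarrow> b' \<in> B \<Longrightarrow> x \<in> cells b \<Longrightarrow> x \<in> cells b' \<Longrightarrow> b = b'" using 3(2) by blast
  show "b \<in> B \<Longrightarrow> b' \<in> B \<Longrightarrow> \<not> snd b \<le> fst b'" by (rule 3(3))
  show "finite B" using card kl by (intro card_ge_0_finite) simp
qed

text \<open>Used to carry what is proved about rows, points to the left and H over to columns,
  points above and V.\<close>

lemma floorplan_transpose:
  assumes "floorplan k l B"
  shows "floorplan l k (map_prod prod.swap prod.swap ` B)"
proof -
  let ?t = "map_prod prod.swap prod.swap"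
  have c: "x \<in> cells (?t b) \<longleftrightarrow> prod.swap x \<in> cells b" for x :: cell and b
    by (cases x; cases b) (auto simp: cells_def)
  have inj: "inj_on ?t B" by (auto simp: inj_on_def)
  note F = floorplanD[OF assms]
  show ?thesis unfolding floorplan_def
  proof (intro conjI ballI impI)
    show "0 < l" "0 < k" "card (?t ` B) = l + k - 1" using F(1-3) card_image[OF inj] by simp_all
    fix b assume "b \<in> ?t ` B"
    then obtain b0 where b: "b = ?t b0" "b0 \<in> B" by (rule imageE)
    show "fst (fst b) < fst (snd b)" "snd (fst b) < snd (snd b)" "snd b \<le> (l, k)"
      using F(4-6)[OF b(2)] unfolding b(1) by (simp_all add: less_eq_prod_def)
    fix b' assume "b' \<in> ?t ` B"
    then obtain b1 where b': "b' = ?t b1" "b1 \<in> B" by (rule imageE)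
    show "b = b'" if ne: "cells b \<inter> cells b' \<noteq> {}"
    proof -
      obtain x where "x \<in> cells b" "x \<in> cells b'" using ne by blast
      then show ?thesis using F(8)[OF b(2) b'(2)] c unfolding b b' by metis
    qed
    show "\<not> snd b \<le> fst b'"
      using F(9)[OF b(2) b'(2)] unfolding b(1) b'(1) by (simp add: less_eq_prod_def conj_commute)
  next
    fix x :: cell assume "x \<in> {..<l} \<times> {..<k}"
    then have "prod.swap x \<in> {..<k} \<times> {..<l}" by auto
    from F(7)[OF this] obtain b where "b \<in> B" "prod.swap x \<in> cells b" by (rule bexE)
    then show "\<exists>b\<in>?t ` B. x \<in> cells b" using c[of x b] by (intro bexI[of _ "?t b"] imageI) simp_all
  qed
qed

section \<open>The top-left corners of a floorplan\<close>

definition owner :: "(cell \<times> cell) set \<Rightarrow> cell \<Rightarrow> cell \<times> cell" where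
  "owner B x = (SOME b. b \<in> B \<and> x \<in> cells b)"

context
  fixes k l B
  assumes F: "floorplan k l B"
begin

private abbreviation "own \<equiv> owner B"

lemma owner_in: assumes "i < k" "j < l" shows "own (i, j) \<in> B" "(i, j) \<in> cells (own (i, j))"
proof -
  have "\<exists>b. b \<in> B \<and> (i, j) \<in> cells b" using floorplanD(7)[OF F, of "(i, j)"] assms by auto
  from someI_ex[OF this] show "own (i, j) \<in> B" "(i, j) \<in> cells (own (i, j))" unfolding owner_def by auto
qed

lemma owner_eq: assumes "b \<in> B" "(i, j) \<in> cells b" shows "own (i, j) = b"
proof -
  have "\<exists>b. b \<in> B \<and> (i, j) \<in> cells b" using assms by blast
  from someI_ex[OF this] show ?thesis unfolding owner_def using floorplanD(8)[OF F _ assms(1) _ assms(2)] by blast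
qed

lemma cells_bound: assumes "b \<in> B" "(i, j) \<in> cells b" shows "i < k" "j < l"
  using floorplanD(6)[OF F assms(1)] assms(2) by (auto simp: cells_def less_eq_prod_def)

lemma corner_in_cells: assumes "b \<in> B" shows "fst b \<in> cells b" 
  using floorplanD(4,5)[OF F assms] by (cases b) (auto simp: cells_def)

lemma owner_corner: assumes "(r, c) \<in> fst ` B" shows "fst (own (r, c)) = (r, c)" "own (r, c) \<in> B" "r < k" "c < l"
proof -
  obtain b where b: "b \<in> B" "fst b = (r, c)" using assms by auto
  have "own (r, c) = b" using owner_eq[OF b(1)] corner_in_cells[OF b(1)] b(2) by simp
  then show "fst (own (r, c)) = (r, c)" "own (r, c) \<in> B" using b by auto
  show "r < k" "c < l" using cells_bound[OF b(1)] corner_in_cells[OF b(1)] b(2) by auto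
qed

lemma owner_cells:
  assumes "i < k" "j < l"
  shows "fst (fst (own (i, j))) \<le> i" "i < fst (snd (own (i, j)))"
    "snd (fst (own (i, j))) \<le> j" "j < snd (snd (own (i, j)))"
  using owner_in(2)[OF assms] by (auto simp: cells_def mem_Times_iff)

lemma owner_eqI:
  assumes "i < k" "j < l" "fst (fst (own (i, j))) \<le> i'" "i' < fst (snd (own (i, j)))"
    "snd (fst (own (i, j))) \<le> j'" "j' < snd (snd (own (i, j)))"
  shows "own (i', j') = own (i, j)"
  by (rule owner_eq[OF owner_in(1)[OF assms(1,2)]]) (use assms(3-) in \<open>auto simp: cells_def mem_Times_iff\<close>)

text \<open>A tile whose right neighbour does not continue its bottom edge ends at a corner that no
  later top-left corner may dominate.\<close>

lemma floorplan_row_line: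
  assumes "(r, c) \<in> fst ` B" "j \<le> x" "x \<le> c" "fst (fst (own (r, j))) = r"
  shows "fst (fst (own (r, x))) = r"
  using assms(2,3)
proof (induction x rule: dec_induct)
  case base
  then show ?case using assms(4) by simp
next
  case (step x)
  then have IH: "fst (fst (own (r, x))) = r" by simp
  have rk: "r < k" and cl: "c < l" using owner_corner[OF assms(1)] by auto
  have xl: "x < l" "Suc x < l" using step cl by auto
  show ?case
  proof (cases "r = 0")
    case True
    then show ?thesis using owner_cells(1)[OF rk xl(2)] by simp
  next
    case False
    then have r1: "r - 1 < k" using rk by simp
    show ?thesis
    proof (rule ccontr)
      assume "fst (fst (own (r, Suc x))) \<noteq> r"
      then have lt: "fst (fst (own (r, Suc x))) \<le> r - 1" using owner_cells(1)[OF rk xl(2)] by simp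
      note o = owner_cells[OF rk xl(2)] owner_cells[OF r1 xl(1)]
      \<comment> \<open>The tile at \<open>(r, Suc x)\<close> begins above row \<open>r\<close>, so
        it covers the cell above as well. The tile \<open>?t\<close> at \<open>(r - 1, x)\<close> is
        then closed in, from below by a tile that starts in row \<open>r\<close> and on the right by
        this one, and its outer corner is dominated by \<open>(r, c)\<close>.\<close>
      have eq: "own (r - 1, Suc x) = own (r, Suc x)"
        by (rule owner_eqI[OF rk xl(2)]) (use lt o in auto)
      let ?t = "own (r - 1, x)"
      have bot: "fst (snd ?t) \<le> r"
      proof (rule ccontr)
        assume "\<not> ?thesis"
        then have "own (r, x) = ?t" by (intro owner_eqI[OF r1 xl(1)]) (use o in auto)
        then show False using IH o False by simp
      qed
      have right: "snd (snd ?t) \<le> Suc x"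
      proof (rule ccontr)
        assume "\<not> ?thesis"
        then have "own (r - 1, Suc x) = ?t" by (intro owner_eqI[OF r1 xl(1)]) (use o in auto)
        then show False using eq o bot by simp
      qed
      have "snd ?t \<le> fst (own (r, c))"
        using bot right step(4) owner_corner(1)[OF assms(1)] by (simp add: less_eq_prod_def)
      then show False using floorplanD(9)[OF F owner_in(1)[OF r1 xl(1)] owner_corner(2)[OF assms(1)]] by simp
    qed
  qed
qed

text \<open>This makes the condition local: by \<open>floorplan_row_line\<close> the top edges
  starting at a corner of row \<open>r\<close> continue without a break up to \<open>(r, c)\<close>,
  so the cell just before decides.\<close>

lemma floorplan_has_left_iff:
  assumes rc: "(r, c) \<in> fst ` B"
  shows "has_left (fst ` B) (r, c) \<longleftrightarrow> 0 < c \<and> fst (fst (own (r, c - 1))) = r"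
proof
  assume "has_left (fst ` B) (r, c)"
  then obtain j where j: "j < c" "(r, j) \<in> fst ` B" by (auto simp: has_left_def)
  then show "0 < c \<and> fst (fst (own (r, c - 1))) = r"
    using floorplan_row_line[OF rc, of j "c - 1"] owner_corner(1)[OF j(2)] by simp
next
  assume *: "0 < c \<and> fst (fst (own (r, c - 1))) = r"
  have b: "r < k" "c - 1 < l" using owner_corner(3,4)[OF rc] by auto
  have "snd (fst (own (r, c - 1))) < c" using owner_cells(3)[OF b] * by linarith
  moreover have "(r, snd (fst (own (r, c - 1)))) \<in> fst ` B"
    using owner_in(1)[OF b] * by (metis image_eqI prod.collapse)
  ultimately show "has_left (fst ` B) (r, c)" by (auto simp: has_left_def)
qed

text \<open>Follow the line left of column \<open>c2\<close> down from \<open>(r1, c2)\<close> to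
  the last row \<open>i\<close> above \<open>r2\<close> in which it is still a tile edge. The tile
  on its left in that row must end there, and its outer corner is dominated by the assumed corner
  \<open>(r2, c3)\<close>.\<close>

lemma floorplan_no_H:
  assumes "r1 < r2" "c1 < c2" "c2 < c3" "(r1, c2) \<in> fst ` B" "(r2, c1) \<in> fst ` B"
  shows "(r2, c3) \<notin> fst ` B"
proof
  assume P3: "(r2, c3) \<in> fst ` B"
  let ?I = "{i. r1 \<le> i \<and> i < r2 \<and> snd (fst (own (i, c2))) = c2}"
  define i where "i = Max ?I"
  have "r1 \<in> ?I" using assms owner_corner(1)[OF assms(4)] by simp
  moreover have finI: "finite ?I" by simp
  ultimately have "i \<in> ?I" unfolding i_def by (intro Max_in) auto
  then have i: "r1 \<le> i" "i < r2" "snd (fst (own (i, c2))) = c2" by auto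
  have imax: "x \<le> i" if "x \<in> ?I" for x unfolding i_def using finI that by (rule Max_ge)
  have bd: "i < k" "Suc i < k" "c2 - 1 < l" "c2 < l"
    using i owner_corner(3,4)[OF P3] owner_corner(3,4)[OF assms(4)] by auto
  define t where "t = own (i, c2 - 1)"
  note o = owner_cells[OF bd(1,3), folded t_def] owner_cells[OF bd(1,4)]
  have right: "snd (snd t) \<le> c2"
  proof (rule ccontr)
    assume "\<not> ?thesis"
    then have "own (i, c2) = t" unfolding t_def by (intro owner_eqI[OF bd(1,3)]) (use o in \<open>auto simp: t_def\<close>)
    then show False using o i(3) assms(2) by simp
  qed
  \<comment> \<open>If \<open>t\<close> went on below row \<open>i\<close>, then either row
    \<open>r2\<close> comes next, where all tiles between \<open>c1\<close> and \<open>c3\<close>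
    begin, or the tile in the next row runs across the line, whereas \<open>t\<close> stops at
    it.\<close>
  have bot: "fst (snd t) \<le> Suc i"
  proof (rule ccontr)
    assume "\<not> ?thesis"
    then have eq: "own (Suc i, c2 - 1) = t" unfolding t_def by (intro owner_eqI[OF bd(1,3)]) (use o in \<open>auto simp: t_def\<close>)
    show False
    proof (cases "Suc i = r2")
      case True
      then have "fst (fst (own (Suc i, c2 - 1))) = r2"
        using floorplan_row_line[OF P3, of c1 "c2 - 1"] owner_corner(1)[OF assms(5)] assms(2,3) by simp
      then show False using eq o True by simp
    next
      case False
      note o' = owner_cells[OF bd(2,4)]
      have "snd (fst (own (Suc i, c2))) \<noteq> c2" using imax[of "Suc i"] False i by auto
      then have "own (Suc i, c2 - 1) = own (Suc i, c2)"
        by (intro owner_eqI[OF bd(2,4)]) (use o' in auto)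
      then show False using eq o' right by simp
    qed
  qed
  have "snd t \<le> fst (own (r2, c3))"
    using right bot i(2) assms(3) owner_corner(1)[OF P3] by (simp add: less_eq_prod_def)
  then show False using floorplanD(9)[OF F owner_in(1)[OF bd(1,3)] owner_corner(2)[OF P3]] by (simp add: t_def)
qed

lemma floorplan_corner_inj: "inj_on fst B"
proof (rule inj_onI)
  fix b b' assume *: "b \<in> B" "b' \<in> B" "fst b = fst b'"
  then show "b = b'" using floorplanD(8)[OF F *(1,2)] corner_in_cells[OF *(1)] corner_in_cells[OF *(2)] by simp
qed

lemma floorplan_root: "(0, 0) \<in> fst ` B"
proof -
  have kl: "0 < k" "0 < l" by (rule floorplanD[OF F])+
  have "fst (own (0, 0)) = (0, 0)" using owner_cells(1,3)[OF kl] by (simp add: prod_eq_iff)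
  then show ?thesis using owner_in(1)[OF kl] by (metis image_eqI)
qed

lemma floorplan_has_left_row0: "(0, c) \<in> fst ` B \<Longrightarrow> has_left (fst ` B) (0, c) \<longleftrightarrow> 0 < c"
  using floorplan_has_left_iff[of 0 c] owner_cells(1)[of 0 "c - 1"] owner_corner[of 0 c] by fastforce

text \<open>Look at the four cells around the corner. If both neighbours start at its lines, the
  tile \<open>t\<close> diagonally opposite ends exactly at the corner, which packedness forbids. If
  neither does, \<open>t\<close> contains both neighbours and, being a rectangle, the corner cell as
  well.\<close>

lemma floorplan_corner_xor:
  assumes rc: "(r, c) \<in> fst ` B" and pos: "0 < r" "0 < c"
  shows "(fst (fst (own (r, c - 1))) = r) \<noteq> (snd (fst (own (r - 1, c))) = c)"
proof -
  have b: "r < k" "c < l" "r - 1 < k" "c - 1 < l" using owner_corner(3,4)[OF rc] by auto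
  note o = owner_cells[OF b(1,4)] owner_cells[OF b(3,2)] owner_cells[OF b(3,4)]
  define t where "t = own (r - 1, c - 1)"
  show ?thesis
  proof (cases "fst (fst (own (r, c - 1))) = r")
    case True
    have "snd (fst (own (r - 1, c))) \<noteq> c"
    proof
      assume *: "snd (fst (own (r - 1, c))) = c"
      have "fst (snd t) \<le> r"
      proof (rule ccontr)
        assume "\<not> ?thesis"
        then have "own (r, c - 1) = t" unfolding t_def by (intro owner_eqI[OF b(3,4)]) (use o pos in \<open>linarith+\<close>)
        then have "fst (fst t) = r" using True by simp
        then show False using o(9) pos(1) unfolding t_def by linarith
      qed
      moreover have "snd (snd t) \<le> c"
      proof (rule ccontr)
        assume "\<not> ?thesis"
        then have "own (r - 1, c) = t" unfolding t_def by (intro owner_eqI[OF b(3,4)]) (use o pos in \<open>linarith+\<close>)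
        then have "snd (fst t) = c" using * by simp
        then show False using o(11) pos(2) unfolding t_def by linarith
      qed
      ultimately have "snd t \<le> fst (own (r, c))" using owner_corner(1)[OF rc] by (simp add: less_eq_prod_def)
      then show False using floorplanD(9)[OF F owner_in(1)[OF b(3,4)] owner_corner(2)[OF rc]] by (simp add: t_def)
    qed
    then show ?thesis using True by simp
  next
    case False
    have "snd (fst (own (r - 1, c))) = c"
    proof (rule ccontr)
      assume *: "snd (fst (own (r - 1, c))) \<noteq> c"
      have 1: "own (r - 1, c - 1) = own (r - 1, c)"
        by (intro owner_eqI[OF b(3,2)]) (use o * pos in \<open>linarith+\<close>)
      have 2: "own (r - 1, c - 1) = own (r, c - 1)"
        by (intro owner_eqI[OF b(1,4)]) (use o False pos in \<open>linarith+\<close>)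
      have "own (r, c - 1) = own (r - 1, c)" using 1 2 by simp
      then have "r < fst (snd (own (r - 1, c)))" using o(2) by simp
      then have "own (r, c) = own (r - 1, c)"
        by (intro owner_eqI[OF b(3,2)]) (use o(5-8) pos in \<open>linarith+\<close>)
      then have "fst (fst (own (r - 1, c))) = r" using owner_corner(1)[OF rc] by simp
      then show False using o(5) pos(1) by linarith
    qed
    then show ?thesis using False by simp
  qed
qed

end

lemma owner_transpose:
  assumes "floorplan k l B" "i < k" "j < l"
  shows "owner (map_prod prod.swap prod.swap ` B) (j, i) = map_prod prod.swap prod.swap (owner B (i, j))"
proof (rule owner_eq[OF floorplan_transpose[OF assms(1)]])
  show "map_prod prod.swap prod.swap (owner B (i, j)) \<in> map_prod prod.swap prod.swap ` B"
    using owner_in(1)[OF assms] by (rule imageI)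
  show "(j, i) \<in> cells (map_prod prod.swap prod.swap (owner B (i, j)))"
    using owner_in(2)[OF assms] by (auto simp: cells_def mem_Times_iff)
qed

lemma fst_transpose: "fst ` map_prod prod.swap prod.swap ` B = prod.swap ` fst ` B"
  by (simp add: image_image)

lemma has_above_transpose: "has_left (prod.swap ` P) (c, r) \<longleftrightarrow> has_above P (r, c)"
  by (force simp: has_above_def has_left_def)

text \<open>Locally every corner has one kind of parent. That all rows and columns are hit is a
  count: apart from the root there are \<open>k + l - 2\<close> corners, of which at most
  \<open>k - 1\<close> start a row and at most \<open>l - 1\<close> start a column, so both bounds
  are attained.\<close>

lemma floorplan_points:
  assumes F: "floorplan k l B"
  shows "baxter_points k l (fst ` B)"
proof -
  let ?P = "fst ` B" and ?t = "map_prod prod.swap prod.swap"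
  note F' = floorplan_transpose[OF F]
  have swapI: "(c, r) \<in> fst ` ?t ` B" if "(r, c) \<in> ?P" for r c
    unfolding fst_transpose using that by force
  have xor: "has_above ?P (r, c) \<noteq> has_left ?P (r, c)" if rc: "(r, c) \<in> ?P" "(r, c) \<noteq> (0, 0)" for r c
  proof -
    note b = owner_corner(3,4)[OF F rc(1)]
    have L: "has_left ?P (r, c) \<longleftrightarrow> 0 < c \<and> fst (fst (owner B (r, c - 1))) = r"
      by (rule floorplan_has_left_iff[OF F rc(1)])
    have A: "has_above ?P (r, c) \<longleftrightarrow> 0 < r \<and> snd (fst (owner B (r - 1, c))) = c"
    proof -
      have "has_above ?P (r, c) \<longleftrightarrow> has_left (fst ` ?t ` B) (c, r)"
        by (simp only: fst_transpose has_above_transpose)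
      also have "\<dots> \<longleftrightarrow> 0 < r \<and> fst (fst (owner (?t ` B) (c, r - 1))) = c"
        by (rule floorplan_has_left_iff[OF F' swapI[OF rc(1)]])
      also have "owner (?t ` B) (c, r - 1) = ?t (owner B (r - 1, c))"
        using b by (intro owner_transpose[OF F]) auto
      finally show ?thesis by simp
    qed
    have L0: "has_left ?P (r, c)" if "r = 0" using floorplan_has_left_row0[OF F] rc that by auto
    have A0: "has_above ?P (r, c)" if "c = 0"
      using floorplan_has_left_row0[OF F', of r] swapI[OF rc(1)] rc(2) that
      unfolding fst_transpose has_above_transpose by auto
    consider "r = 0" | "c = 0" | "0 < r" "0 < c" by blast
    then show ?thesis
    proof cases
      case 1
      then show ?thesis using L0 by (simp add: has_above_def)
    next
      case 2
      then show ?thesis using A0 by (simp add: has_left_def)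
    next
      case 3
      then show ?thesis using floorplan_corner_xor[OF F rc(1) 3] A L by blast
    qed
  qed
  have finP: "finite ?P" using floorplanD(10)[OF F] by simp
  have cardP: "card ?P = k + l - 1" using card_image[OF floorplan_corner_inj[OF F]] floorplanD(3)[OF F] by simp
  have root: "(0, 0) \<in> ?P" by (rule floorplan_root[OF F])
  have xor': "has_above ?P p \<noteq> has_left ?P p" if "p \<in> ?P" "p \<noteq> (0, 0)" for p
    using xor[of "fst p" "snd p"] that by simp
  have "fst p < k \<and> snd p < l" if "p \<in> ?P" for p
    using owner_corner(3,4)[OF F, of "fst p" "snd p"] that by simp
  then have sub: "fst ` ?P \<subseteq> {..<k}" "snd ` ?P \<subseteq> {..<l}" by blast+
  let ?A = "{p \<in> ?P. has_above ?P p}" and ?L = "{p \<in> ?P. has_left ?P p}"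
  have R: "inj_on fst ?A" "fst ` ?A \<subseteq> {1..<k}" "fst ` ?A = {1..<k} \<longleftrightarrow> fst ` ?P = {..<k}"
    by (rule card_row_starts[OF sub(1) root finP], erule (1) xor')+
  have C: "inj_on snd ?L" "snd ` ?L \<subseteq> {1..<l}" "snd ` ?L = {1..<l} \<longleftrightarrow> snd ` ?P = {..<l}"
    by (rule card_col_starts[OF sub(2) root finP], erule (1) xor')+
  have cA: "card (fst ` ?A) = card ?A" and cL: "card (snd ` ?L) = card ?L"
    using card_image[OF R(1)] card_image[OF C(1)] .
  have "card ?A \<le> k - 1" "card ?L \<le> l - 1"
    using card_mono[OF _ R(2)] card_mono[OF _ C(2)] cA cL by simp_all
  moreover have "card ?A + card ?L = k + l - 2"
    using card_starts[OF root finP] xor' cardP floorplanD(1,2)[OF F] by simp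
  ultimately have "card ?A = k - 1" "card ?L = l - 1" using floorplanD(1,2)[OF F] by simp_all
  then have "fst ` ?A = {1..<k}" "snd ` ?L = {1..<l}"
    using card_subset_eq[OF _ R(2)] card_subset_eq[OF _ C(2)] cA cL by simp_all
  then have kl: "fst ` ?P = {..<k}" "snd ` ?P = {..<l}" using R(3) C(3) by (simp_all only: simp_thms)
  have H: "(r2, c3) \<notin> ?P" if "r1 < r2" "c1 < c2" "c2 < c3" "(r1, c2) \<in> ?P" "(r2, c1) \<in> ?P" for r1 r2 c1 c2 c3
    by (rule floorplan_no_H[OF F that])
  have V: "(r3, c2) \<notin> ?P" if *: "r1 < r2" "r2 < r3" "c1 < c2" "(r1, c2) \<in> ?P" "(r2, c1) \<in> ?P" for r1 r2 r3 c1 c2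
    using floorplan_no_H[OF F' *(3,1,2) swapI[OF *(5)] swapI[OF *(4)]] swapI by blast
  show ?thesis unfolding baxter_points_def
  proof (intro conjI kl root ballI allI impI)
    fix p assume "p \<in> ?P - {(0, 0)}"
    then show "has_above ?P p \<noteq> has_left ?P p" by (intro xor') simp_all
  qed (rule H V; assumption)+
qed

section \<open>Labelings of a floorplan\<close>

text \<open>Among the tiles of \<open>U\<close> that have no tile of \<open>U\<close> below them, take one whose left edge is rightmost.\<close>

lemma floorplan_sink:
  assumes F: "floorplan k l B" and U: "U \<subseteq> B" "U \<noteq> {}"
  obtains t where "t \<in> U" "\<And>z. z \<in> U \<Longrightarrow> z \<noteq> t \<Longrightarrow> \<not> (fst (fst t) < fst (snd z) \<and> snd (fst t) < snd (snd z))"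
proof -
  have finU: "finite U" using floorplanD(10)[OF F] U(1) by (rule finite_subset[rotated])
  have disj: "fst (snd b) \<le> fst (fst b') \<or> fst (snd b') \<le> fst (fst b) \<or>
      snd (snd b) \<le> snd (fst b') \<or> snd (snd b') \<le> snd (fst b)"
    if bb': "b \<in> U" "b' \<in> U" "b \<noteq> b'" for b b'
  proof (rule ccontr)
    assume *: "\<not> ?thesis"
    have B: "b \<in> B" "b' \<in> B" using bb' U by auto
    let ?x = "(max (fst (fst b)) (fst (fst b')), max (snd (fst b)) (snd (fst b')))"
    have "?x \<in> cells b" "?x \<in> cells b'"
      using * floorplanD(4,5)[OF F B(1)] floorplanD(4,5)[OF F B(2)] by (auto simp: cells_def)
    then show False using floorplanD(8)[OF F B] bb'(3) by blast
  qed
  have pos: "fst (fst b) < fst (snd b)" "snd (fst b) < snd (snd b)" if "b \<in> U" for b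
    using floorplanD(4,5)[OF F, of b] that U by blast+
  \<comment> \<open>The column condition looks at everything right of the left edge of
    \<open>t\<close>, not only at what lies under \<open>t\<close>.\<close>
  define below :: "cell \<times> cell \<Rightarrow> cell \<times> cell \<Rightarrow> bool" where "below t z \<longleftrightarrow> z \<in> U \<and> fst (snd t) \<le> fst (fst z) \<and> snd (fst t) < snd (snd z)" for t z
  define A where "A = {t \<in> U. \<forall>z. \<not> below t z}"
  have finA: "finite A" unfolding A_def using finU by simp
  have argmax: "\<exists>x\<in>S. \<forall>y\<in>S. f y \<le> f x" if "finite S" "S \<noteq> {}" for S and f :: "cell \<times> cell \<Rightarrow> nat"
  proof -
    have "Max (f ` S) \<in> f ` S" using that by (intro Max_in) auto
    then obtain x where "x \<in> S" "f x = Max (f ` S)" by auto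
    then show ?thesis using that(1) by (intro bexI[of _ x]) auto
  qed
  obtain b where b: "b \<in> U" "\<And>y. y \<in> U \<Longrightarrow> fst (snd y) \<le> fst (snd b)"
    using argmax[OF finU U(2), of "\<lambda>b. fst (snd b)"] by blast
  have "b \<in> A"
  proof -
    have "\<not> below b z" for z
      using b(2)[of z] pos(1)[of z] by (auto simp: below_def)
    then show ?thesis using b(1) by (simp add: A_def)
  qed
  then have "A \<noteq> {}" by blast
  then obtain t where t: "t \<in> A" "\<And>y. y \<in> A \<Longrightarrow> snd (fst y) \<le> snd (fst t)"
    using argmax[OF finA, of "\<lambda>b. snd (fst b)"] by blast
  have tU: "t \<in> U" and tb: "\<And>z. \<not> below t z" using t(1) by (auto simp: A_def)
  show ?thesis
  proof (rule that[OF tU], rule notI)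
    fix z assume z: "z \<in> U" "z \<noteq> t" "fst (fst t) < fst (snd z) \<and> snd (fst t) < snd (snd z)"
    \<comment> \<open>A tile \<open>z\<close> reaching into the quadrant of \<open>t\<close> is
      neither above nor left of \<open>t\<close>, and nothing is below \<open>t\<close>, so it lies
      to the right. The lowest tile \<open>w\<close> of this kind has nothing of \<open>U\<close>
      below it and begins further right than \<open>t\<close>, against the choice of
      \<open>t\<close>.\<close>
    define R where "R = {z \<in> U. snd (snd t) \<le> snd (fst z) \<and> fst (fst t) < fst (snd z)}"
    have "z \<in> R"
      using disj[OF tU z(1)] z tb[of z] by (auto simp: R_def below_def)
    moreover have "finite R" unfolding R_def using finU by simp
    ultimately obtain w where w: "w \<in> R" "\<And>y. y \<in> R \<Longrightarrow> fst (snd y) \<le> fst (snd w)"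
      using argmax[of R "\<lambda>b. fst (snd b)"] by blast
    have wU: "w \<in> U" "snd (snd t) \<le> snd (fst w)" "fst (fst t) < fst (snd w)" using w(1) by (auto simp: R_def)
    have "\<not> below w v" for v
    proof
      assume v: "below w v"
      then have vU: "v \<in> U" "fst (snd w) \<le> fst (fst v)" "snd (fst w) < snd (snd v)" by (auto simp: below_def)
      have vt: "v \<noteq> t" using vU wU by auto
      \<comment> \<open>A tile starting left of this bound would lie under \<open>t\<close>, because
        \<open>w\<close> and therefore \<open>v\<close> reach past the right edge of
        \<open>t\<close>.\<close>
      have "snd (snd t) \<le> snd (fst v)"
      proof (rule ccontr)
        assume "\<not> ?thesis"
        then have "fst (snd t) \<le> fst (fst v)"
          using disj[OF tU vU(1)] vt vU wU pos[OF tU] pos[OF wU(1)] pos[OF vU(1)] by auto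
        then show False using tb[of v] vU wU pos(2)[OF tU] by (auto simp: below_def)
      qed
      then have "v \<in> R" using vU wU pos(1)[OF vU(1)] by (auto simp: R_def)
      then show False using w(2)[of v] vU pos(1)[OF vU(1)] by auto
    qed
    then have "w \<in> A" using wU by (simp add: A_def)
    then show False using t(2)[of w] wU pos(2)[OF tU] by simp
  qed
qed

text \<open>The tile found by \<open>floorplan_sink\<close> receives the largest label and is
  removed. In the resulting order the quadrant south-east of the corner of a tile meets no tile with
  a smaller label.\<close>

lemma floorplan_topological_order:
  assumes F: "floorplan k l B" and "U \<subseteq> B"
  shows "\<exists>lab :: cell \<Rightarrow> nat. bij_betw lab (fst ` U) {1..card U} \<and>
    (\<forall>b\<in>U. \<forall>b'\<in>U. lab (fst b') < lab (fst b) \<longrightarrow> \<not> (fst (fst b) < fst (snd b') \<and> snd (fst b) < snd (snd b')))"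
  using assms(2)
proof (induction "card U" arbitrary: U)
  case 0
  then have "U = {}" using floorplanD(10)[OF F] by (metis card_0_eq finite_subset)
  then show ?case by (simp add: bij_betw_def)
next
  case (Suc n)
  have finU: "finite U" using floorplanD(10)[OF F] Suc(3) by (rule finite_subset[rotated])
  have "U \<noteq> {}" using Suc(2) by auto
  then obtain t where t: "t \<in> U" and
    sink: "\<And>z. z \<in> U \<Longrightarrow> z \<noteq> t \<Longrightarrow> \<not> (fst (fst t) < fst (snd z) \<and> snd (fst t) < snd (snd z))"
    using floorplan_sink[OF F Suc(3)] by blast
  have cU: "card (U - {t}) = n" using Suc(2) t finU by simp
  have "U - {t} \<subseteq> B" using Suc(3) by blast
  from Suc(1)[OF cU[symmetric] this] obtain lab where lab: "bij_betw lab (fst ` (U - {t})) {1..card (U - {t})}"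
    and "\<forall>b\<in>U - {t}. \<forall>b'\<in>U - {t}. lab (fst b') < lab (fst b) \<longrightarrow>
       \<not> (fst (fst b) < fst (snd b') \<and> snd (fst b) < snd (snd b'))"
    by (elim exE conjE)
  note ord = this(2)[rule_format] and lab = lab[unfolded cU]
  have inj: "inj_on fst U" using floorplan_corner_inj[OF F] Suc(3) by (rule inj_on_subset)
  have tn: "fst t \<notin> fst ` (U - {t})" using inj t by (auto simp: inj_on_def)
  let ?lab = "lab(fst t := Suc n)"
  have eq: "?lab x = lab x" if "x \<in> fst ` (U - {t})" for x
    using tn that by (metis fun_upd_other)
  have "bij_betw ?lab (fst ` (U - {t})) {1..n}"
    using lab bij_betw_cong[of "fst ` (U - {t})" ?lab lab, OF eq] by blast
  then have "bij_betw ?lab (fst ` (U - {t}) \<union> {fst t}) ({1..n} \<union> {Suc n})"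
    by (intro bij_betw_combine) (auto simp: bij_betw_def)
  moreover have "fst ` (U - {t}) \<union> {fst t} = fst ` U" using t by auto
  moreover have "{1..n} \<union> {Suc n} = {1..card U}" using Suc(2) by auto
  ultimately have "bij_betw ?lab (fst ` U) {1..card U}" by simp
  moreover have "\<not> (fst (fst b) < fst (snd b') \<and> snd (fst b) < snd (snd b'))"
    if b: "b \<in> U" "b' \<in> U" "?lab (fst b') < ?lab (fst b)" for b b'
  proof (cases "b = t")
    case True
    then have "b' \<noteq> t" using b(3) by auto
    then show ?thesis using sink[OF b(2)] True by simp
  next
    case bt: False
    then have bU: "b \<in> U - {t}" using b by simp
    have "fst b \<in> fst ` (U - {t})" using bU by (rule imageI)
    then have "lab (fst b) \<in> {1..n}" "fst b \<noteq> fst t" using tn bij_betwE[OF lab] by metis+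
    then have lb: "?lab (fst b) = lab (fst b)" "lab (fst b) \<le> n" by simp_all
    have "b' \<noteq> t" using b(3) lb by auto
    then have bU': "b' \<in> U - {t}" using b by simp
    have "fst b' \<in> fst ` (U - {t})" using bU' by (rule imageI)
    then have "?lab (fst b') = lab (fst b')" using tn by (metis fun_upd_other)
    then show ?thesis using ord[OF bU bU'] b(3) lb by simp
  qed
  ultimately show ?case by blast
qed

lemma floorplan_labeling:
  assumes F: "floorplan k l B"
  obtains lab where "linext (fst ` B) lab" "tile_box k l (fst ` B) lab ` (fst ` B) = B"
proof -
  let ?P = "fst ` B"
  have P: "baxter_points k l ?P" by (rule floorplan_points[OF F])
  from floorplan_topological_order[OF F order_refl]
  obtain lab where lab: "bij_betw lab ?P {1..card B}"
    and "\<forall>b\<in>B. \<forall>b'\<in>B. lab (fst b') < lab (fst b) \<longrightarrow>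
       \<not> (fst (fst b) < fst (snd b') \<and> snd (fst b) < snd (snd b'))"
    by (elim exE conjE)
  note ord = this(2)[rule_format]
  have cB: "card ?P = card B" by (rule card_image[OF floorplan_corner_inj[OF F]])
  have lin: "linext ?P lab" unfolding linext_def
  proof (intro conjI ballI impI)
    show "bij_betw lab ?P {1..card ?P}" using lab cB by simp
    fix p q assume pq: "p \<in> ?P" "q \<in> ?P" "p \<le> q"
    then obtain b b' where b: "b \<in> B" "fst b = p" "b' \<in> B" "fst b' = q" by auto
    show "lab p \<le> lab q"
    proof (rule ccontr)
      assume "\<not> ?thesis"
      then have "\<not> (fst p < fst (snd b') \<and> snd p < snd (snd b'))" using ord[of b b'] b by auto
      moreover have "fst q < fst (snd b')" "snd q < snd (snd b')" using floorplanD(4,5)[OF F b(3)] b by auto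
      ultimately show False using pq(3) by (auto simp: less_eq_prod_def)
    qed
  qed
  \<comment> \<open>A later corner weakly north-west of a cell of \<open>b\<close> would have
    \<open>b\<close> in its quadrant. This inclusion is enough for equality, because both families
    partition the grid.\<close>
  have sub: "cells b \<subseteq> tile k l ?P lab (fst b)" if b: "b \<in> B" for b
  proof
    fix x assume x: "x \<in> cells b"
    have "\<not> q \<le> x" if q: "q \<in> ?P" "lab (fst b) < lab q" for q
    proof
      assume "q \<le> x"
      obtain b' where b': "b' \<in> B" "fst b' = q" using q(1) by auto
      show False using ord[of b' b] b b' q(2) x \<open>q \<le> x\<close> by (auto simp: cells_def less_eq_prod_def mem_Times_iff)
    qed
    moreover have "x \<in> {..<k} \<times> {..<l}" using cells_bound[OF F b, of "fst x" "snd x"] x by (simp add: mem_Times_iff)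
    ultimately show "x \<in> tile k l ?P lab (fst b)"
      using x by (auto simp: tile_def cells_def less_eq_prod_def mem_Times_iff)
  qed
  have box: "tile_box k l ?P lab (fst b) = b" if b: "b \<in> B" for b
  proof -
    have "cells b = tile k l ?P lab (fst b)"
    proof (rule subset_antisym[OF sub[OF b]], rule subsetI)
      fix x assume x: "x \<in> tile k l ?P lab (fst b)"
      then have "x \<in> {..<k} \<times> {..<l}" by (simp add: tile_def)
      from floorplanD(7)[OF F this] obtain b' where b': "b' \<in> B" "x \<in> cells b'" by (rule bexE)
      then have "fst b = fst b'" using tile_unique[OF P lin _ _ x, of "fst b'"] sub[OF b'(1)] b by blast
      then have "b = b'" using floorplan_corner_inj[OF F] b b'(1) by (auto simp: inj_on_def)
      then show "x \<in> cells b" using b'(2) by simp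
    qed
    then have eq: "cells b = cells (tile_box k l ?P lab (fst b))" using tile_eq_cells[OF P lin] b by simp
    have ne: "fst (fst b) < fst (snd b)" "snd (fst b) < snd (snd b)" using floorplanD(4,5)[OF F b] .
    have "{fst (fst b)..<fst (snd b)} = {fst (fst b)..<tile_bottom k ?P lab (fst b)} \<and>
      {snd (fst b)..<snd (snd b)} = {snd (fst b)..<tile_right l ?P lab (fst b)}"
      using eq ne unfolding cells_def tile_box_def by (auto simp: times_eq_iff)
    then have "fst (snd b) = tile_bottom k ?P lab (fst b)" "snd (snd b) = tile_right l ?P lab (fst b)"
      using ne tile_bottom_gt[OF P lin, of "fst b"] tile_right_gt[OF P lin, of "fst b"] b
      by (simp_all add: atLeastLessThan_eq_iff)
    then show ?thesis unfolding tile_box_def by (simp add: prod_eq_iff)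
  qed
  have "tile_box k l ?P lab ` ?P = B" unfolding image_image using box by simp
  then show ?thesis using that lin by blast
qed

section \<open>Greedy labelings\<close>

text \<open>Among the labelings with given tiles, the greedy ones are those that read the tiles from the
  largest label on by always removing the rightmost removable tile.\<close>

definition greedy :: "cell set \<Rightarrow> (cell \<Rightarrow> nat) \<Rightarrow> bool" where
  "greedy P lab \<longleftrightarrow>
     (\<forall>p\<in>P. \<forall>q\<in>P. \<forall>v\<in>P. lab p = Suc (lab q) \<longrightarrow> lab p < lab v \<longrightarrow> fst q < fst p \<longrightarrow> snd p < snd q \<longrightarrow>
        \<not> (fst q < fst v \<and> fst v \<le> fst p \<and> snd p < snd v \<and> snd v \<le> snd q))"

lemma greedyD:
  assumes "greedy P lab" "p \<in> P" "q \<in> P" "v \<in> P" "lab p = Suc (lab q)" "lab p < lab v"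
    "fst q < fst p" "snd p < snd q" "fst q < fst v" "fst v \<le> fst p" "snd p < snd v" "snd v \<le> snd q"
  shows False
  using assms unfolding greedy_def by blast

text \<open>The two quadrants of \<open>p\<close> and \<open>q\<close> overlap only in cells
  south-east of \<open>v\<close>, and these are cut off from both tiles anyway. So it does not
  matter which of the two points comes later.\<close>

lemma swap_labels:
  assumes lab: "linext P lab" and p: "p \<in> P" and q: "q \<in> P" and v: "v \<in> P"
    and lpq: "lab p = Suc (lab q)" and lv: "lab p < lab v"
    and ne: "fst q < fst p" "snd p < snd q" and box: "fst v \<le> fst p" "snd v \<le> snd q"
  defines "lab' \<equiv> lab(p := lab q, q := lab p)"
  shows "linext P lab'" "tile k l P lab' x = tile k l P lab x \<or> x \<notin> P"
proof -
  have pq: "p \<noteq> q" using ne by auto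
  have lab': "lab' p = lab q" "lab' q = lab p" "\<And>x. x \<noteq> p \<Longrightarrow> x \<noteq> q \<Longrightarrow> lab' x = lab x"
    using pq by (auto simp: lab'_def)
  have other: "lab x < lab q \<or> lab p < lab x" if "x \<in> P" "x \<noteq> p" "x \<noteq> q" for x
    using linext_inj[OF lab that(1) p] linext_inj[OF lab that(1) q] that lpq by fastforce
  have incomp: "\<not> p \<le> q" "\<not> q \<le> p" using ne by (auto simp: less_eq_prod_def)
  define \<sigma> where "\<sigma> x = (if x = p then q else if x = q then p else x)" for x
  have lab\<sigma>: "lab' x = lab (\<sigma> x)" for x using pq by (simp add: lab'_def \<sigma>_def)
  have \<sigma>P: "\<sigma> x \<in> P" if "x \<in> P" for x using that p q by (simp add: \<sigma>_def)
  have \<sigma>\<sigma>: "\<sigma> (\<sigma> x) = x" for x using pq by (simp add: \<sigma>_def)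
  have "inj_on lab' P"
  proof (rule inj_onI)
    fix x y assume xy: "x \<in> P" "y \<in> P" "lab' x = lab' y"
    then have "\<sigma> x = \<sigma> y" using linext_inj[OF lab \<sigma>P[OF xy(1)] \<sigma>P[OF xy(2)]] lab\<sigma> by simp
    then show "x = y" using \<sigma>\<sigma> by metis
  qed
  moreover have "lab' ` P = lab ` P"
  proof -
    have "\<sigma> ` P = P" using \<sigma>P \<sigma>\<sigma> by (metis image_eqI subsetI subset_antisym image_subsetI)
    then show ?thesis unfolding lab\<sigma> by (metis image_image)
  qed
  moreover have "lab' x \<le> lab' y" if xy: "x \<in> P" "y \<in> P" "x \<le> y" for x y
  proof -
    note m = linext_mono[OF lab xy]
    consider "x = y" | "x = p" "y \<noteq> p" "y \<noteq> q" | "x = q" "y \<noteq> p" "y \<noteq> q" | "y = p" "x \<noteq> p" "x \<noteq> q"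
      | "y = q" "x \<noteq> p" "x \<noteq> q" | "x \<noteq> p" "x \<noteq> q" "y \<noteq> p" "y \<noteq> q"
      using incomp xy(3) by blast
    then show ?thesis
    proof cases
      case 3
      then show ?thesis using m lab' other[OF xy(2)] lpq by simp
    next
      case 4
      then show ?thesis using m lab' other[OF xy(1)] lpq by simp
    qed (use m lab' lpq in simp_all)
  qed
  ultimately show "linext P lab'" using lab unfolding linext_def bij_betw_def by simp
  have v': "v \<le> y" if "p \<le> y" "q \<le> y" for y
    using that box by (auto simp: less_eq_prod_def)
  have vpq: "v \<noteq> p" "v \<noteq> q" using lv lpq by auto
  show "tile k l P lab' x = tile k l P lab x \<or> x \<notin> P"
  proof (cases "x \<in> P")
    case x: True
    have key: "(\<forall>z\<in>P. lab' x < lab' z \<longrightarrow> \<not> z \<le> y) \<longleftrightarrow> (\<forall>z\<in>P. lab x < lab z \<longrightarrow> \<not> z \<le> y)" if xy: "x \<le> y" for y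
    proof -
      consider "x = p" | "x = q" | "x \<noteq> p" "x \<noteq> q" by blast
      then show ?thesis
      proof cases
        case 1
        have "lab' x < lab' z \<longleftrightarrow> lab x < lab z \<or> z = q" if "z \<in> P" for z
          using 1 lab' other[OF that] lpq pq by (cases "z = p"; cases "z = q") auto
        moreover have "lab x < lab v" using 1 lv by simp
        ultimately show ?thesis using v'[of y] xy 1 v q by blast
      next
        case 2
        have "lab x < lab z \<longleftrightarrow> lab' x < lab' z \<or> z = p" if "z \<in> P" for z
          using 2 lab' other[OF that] lpq pq by (cases "z = p"; cases "z = q") auto
        moreover have "lab' x < lab' v" using 2 lv lab' vpq by simp
        ultimately show ?thesis using v'[of y] xy 2 v p by blast
      next
        case 3
        have "lab' x = lab x" using 3 by (rule lab'(3))
        moreover have "lab' z = lab q \<and> lab z = lab p \<or> lab' z = lab p \<and> lab z = lab q \<or> lab' z = lab z" for z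
          using lab' by metis
        ultimately have "lab' x < lab' z \<longleftrightarrow> lab x < lab z" for z
          using other[OF x 3] lpq by (smt (verit) less_Suc_eq not_less_eq order_less_trans)
        then show ?thesis by blast
      qed
    qed
    have "tile k l P lab' x = tile k l P lab x"
      unfolding tile_def by (rule Collect_cong, rule conj_cong[OF refl], rule conj_cong[OF refl], erule key)
    then show ?thesis by simp
  qed simp
qed

text \<open>Take a labeling with the given tiles for which the sum of label times column is largest.
  A violation of greediness could be swapped, which moves the larger label to the larger column and
  increases this sum.\<close>

lemma greedy_exists:
  assumes P: "finite P" and lab0: "linext P lab0"
  obtains lab where "linext P lab" "greedy P lab" "\<And>p. p \<in> P \<Longrightarrow> tile k l P lab p = tile k l P lab0 p"
proof -
  define good where "good lab \<longleftrightarrow> linext P lab \<and> (\<forall>p\<in>P. tile k l P lab p = tile k l P lab0 p)" for lab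
  define w where "w lab = (\<Sum>p\<in>P. lab p * snd p)" for lab :: "cell \<Rightarrow> nat"
  have good0: "good lab0" using lab0 by (simp add: good_def)
  have bound: "w lab < Suc (\<Sum>p\<in>P. card P * snd p)" if "good lab" for lab
    unfolding w_def using that linext_range[of P lab] by (auto simp: good_def less_Suc_eq_le intro!: sum_mono)
  obtain lab where lab: "good lab" and wmax: "\<And>lab'. good lab' \<Longrightarrow> w lab' \<le> w lab"
    using ex_has_greatest_nat[of good lab0 w, OF good0] bound by blast
  have lin: "linext P lab" using lab by (simp add: good_def)
  have "greedy P lab" unfolding greedy_def
  proof (intro ballI impI notI)
    fix p q v assume *: "p \<in> P" "q \<in> P" "v \<in> P" "lab p = Suc (lab q)" "lab p < lab v"
      "fst q < fst p" "snd p < snd q" "fst q < fst v \<and> fst v \<le> fst p \<and> snd p < snd v \<and> snd v \<le> snd q"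
    define lab' where "lab' = lab(p := lab q, q := lab p)"
    have "good lab'"
      using swap_labels[OF lin *(1-7) *(8)[THEN conjunct2, THEN conjunct1]
          *(8)[THEN conjunct2, THEN conjunct2, THEN conjunct2], folded lab'_def] lab
      unfolding good_def by metis
    then have "w lab' \<le> w lab" by (rule wmax)
    moreover have pq: "p \<noteq> q" using * by auto
    have split: "w f = f p * snd p + (f q * snd q + (\<Sum>x\<in>P - {p} - {q}. f x * snd x))" for f
      unfolding w_def using P *(1,2) pq by (simp add: sum.remove[of P p] sum.remove[of "P - {p}" q])
    have "(\<Sum>x\<in>P - {p} - {q}. lab' x * snd x) = (\<Sum>x\<in>P - {p} - {q}. lab x * snd x)"
      by (intro sum.cong) (auto simp: lab'_def)
    then have "w lab < w lab'"
      unfolding split using *(4,7) pq by (simp add: lab'_def)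
    ultimately show False by simp
  qed
  then show ?thesis using that lin lab by (simp add: good_def)
qed

text \<open>Here \<open>m\<close> is the largest label at which two labelings with equal tiles
  differ. The first one gives it to \<open>p1\<close> although \<open>p2\<close>, further right, is
  removable at that moment, as the second labeling shows. The violation of greediness need not occur
  at \<open>p1\<close> and \<open>p2\<close> themselves but at consecutive labels between
  them.\<close>

lemma greedy_unique_aux:
  assumes l1: "linext P lab1" and g1: "greedy P lab1"
    and p1: "p1 \<in> P" "lab1 p1 = m" and p2: "p2 \<in> P" "lab1 p2 < m" "lab2 p2 = m"
    and same: "\<And>p. p \<in> P \<Longrightarrow> m < lab1 p \<longleftrightarrow> m < lab2 p"
    and tiles: "tile k l P lab1 p2 = tile k l P lab2 p2"
    and sub: "P \<subseteq> {..<k} \<times> {..<l}" and col: "snd p1 < snd p2"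
  shows False
proof -
  \<comment> \<open>Labels from just after \<open>p2\<close> up to that of \<open>p1\<close>,
    restricted to points left of \<open>p2\<close>. The first of them belongs to \<open>c\<close>,
    so the point \<open>d\<close> with the preceding label is not left of \<open>p2\<close>.\<close>
  let ?A = "{lab1 c | c. c \<in> P \<and> lab1 p2 < lab1 c \<and> lab1 c \<le> m \<and> snd c < snd p2}"
  have "m \<in> ?A" using p1 p2 col by (intro CollectI exI[of _ p1]) simp
  define j where "j = (LEAST j. j \<in> ?A)"
  have "j \<in> ?A" unfolding j_def using \<open>m \<in> ?A\<close> by (rule LeastI)
  then obtain c where c: "c \<in> P" "lab1 p2 < lab1 c" "lab1 c \<le> m" "snd c < snd p2" "j = lab1 c" by blast
  have jmin: "j \<le> i" if "i \<in> ?A" for i unfolding j_def using that by (rule Least_le)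
  have "1 \<le> lab1 c - 1" "lab1 c - 1 \<le> card P"
    using c linext_range[OF l1 c(1)] linext_range[OF l1 p2(1)] by auto
  then obtain d where d: "d \<in> P" "lab1 d = lab1 c - 1" by (rule linext_obtain[OF l1])
  have lcd: "lab1 c = Suc (lab1 d)" using d c by simp
  have dcol: "snd p2 \<le> snd d"
  proof (cases "lab1 d = lab1 p2")
    case True
    then show ?thesis using linext_inj[OF l1 d(1) p2(1)] by simp
  next
    case False
    show ?thesis
    proof (rule ccontr)
      assume "\<not> ?thesis"
      moreover have "lab1 p2 < lab1 d" "lab1 d \<le> m" using c(2,3) False lcd by linarith+
      ultimately have "lab1 d \<in> ?A" using d(1) not_le by blast
      then show False using jmin[of "lab1 d"] c(5) lcd by simp
    qed
  qed
  have crow: "fst p2 < fst c"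
  proof (rule ccontr)
    assume "\<not> ?thesis"
    then have "c \<le> p2" using c(4) by (simp add: less_eq_prod_def)
    then show False using linext_mono[OF l1 c(1) p2(1)] c(2) by simp
  qed
  have drow: "fst d < fst c"
  proof (rule ccontr)
    assume "\<not> ?thesis"
    then have "c \<le> d" using c(4) dcol by (simp add: less_eq_prod_def)
    then show False using linext_mono[OF l1 c(1) d(1)] lcd by simp
  qed
  \<comment> \<open>This cell is below \<open>p2\<close> and right of \<open>c\<close>, so
    \<open>c\<close> cuts it off from the tile of \<open>p2\<close> in the first labeling. As the
    tiles agree, some \<open>v\<close> with label above \<open>m\<close> cuts it off in the second,
    and above \<open>m\<close> the labelings name the same points. This \<open>v\<close> lies in the
    box spanned by \<open>c\<close> and \<open>d\<close>.\<close>
  let ?x = "(fst c, snd p2)"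
  have "?x \<notin> tile k l P lab1 p2"
  proof -
    have "c \<le> ?x" using c(4) by (simp add: less_eq_prod_def)
    then show ?thesis using c(1,2) by (auto simp: tile_def)
  qed
  then have "?x \<notin> tile k l P lab2 p2" using tiles by simp
  moreover have "?x \<in> {..<k} \<times> {..<l}" using sub c(1) p2(1) by auto
  moreover have "p2 \<le> ?x" using crow by (simp add: less_eq_prod_def)
  ultimately obtain v where v: "v \<in> P" "m < lab2 v" "v \<le> ?x" using p2(3) unfolding tile_def by blast
  then have lv: "m < lab1 v" using same by blast
  have vb: "fst v \<le> fst c" "snd v \<le> snd p2" using v(3) by (auto simp: less_eq_prod_def)
  have "snd c < snd v"
  proof (rule ccontr)
    assume "\<not> ?thesis"
    then have "v \<le> c" using vb by (simp add: less_eq_prod_def)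
    then show False using linext_mono[OF l1 v(1) c(1)] lv c(3) by simp
  qed
  moreover have "fst d < fst v"
  proof (rule ccontr)
    assume "\<not> ?thesis"
    then have "v \<le> d" using vb dcol by (simp add: less_eq_prod_def)
    then show False using linext_mono[OF l1 v(1) d(1)] lv c(3) lcd by simp
  qed
  ultimately show False
    using greedyD[OF g1 c(1) d(1) v(1) lcd _ drow] lv c(3,4) dcol vb by simp
qed

lemma greedy_unique:
  assumes l1: "linext P lab1" and g1: "greedy P lab1" and l2: "linext P lab2" and g2: "greedy P lab2"
    and tiles: "\<And>p. p \<in> P \<Longrightarrow> tile k l P lab1 p = tile k l P lab2 p"
    and sub: "P \<subseteq> {..<k} \<times> {..<l}" and "p \<in> P"
  shows "lab1 p = lab2 p"
proof (rule ccontr)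
  assume ne: "lab1 p \<noteq> lab2 p"
  let ?D = "{lab1 p | p. p \<in> P \<and> lab1 p \<noteq> lab2 p}"
  have "finite P" using sub by (rule finite_subset) simp
  then have finD: "finite ?D" by (intro finite_subset[of ?D "lab1 ` P"]) blast+
  have "lab1 p \<in> ?D" using ne \<open>p \<in> P\<close> by blast
  define m where "m = Max ?D"
  have "m \<in> ?D" unfolding m_def using finD \<open>lab1 p \<in> ?D\<close> by (intro Max_in) auto
  then obtain p1 where p1: "p1 \<in> P" "lab1 p1 = m" "lab2 p1 \<noteq> m" by auto
  have eq: "lab2 x = lab1 x" if "x \<in> P" "m < lab1 x" for x
  proof (rule ccontr)
    assume "lab2 x \<noteq> lab1 x"
    then have "lab1 x \<in> ?D" using that by (intro CollectI exI[of _ x]) simp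
    then have "lab1 x \<le> m" unfolding m_def using finD by (intro Max_ge)
    then show False using that by simp
  qed
  have eq': "lab1 x = lab2 x" if x: "x \<in> P" "m < lab2 x" for x
  proof -
    obtain y where y: "y \<in> P" "lab1 y = lab2 x" using linext_obtain[OF l1] linext_range[OF l2 x(1)] by blast
    then have "lab2 y = lab2 x" using eq[OF y(1)] x(2) by simp
    then show ?thesis using linext_inj[OF l2 y(1) x(1)] y(2) by simp
  qed
  have same: "m < lab1 x \<longleftrightarrow> m < lab2 x" if "x \<in> P" for x
    using eq[OF that] eq'[OF that] by auto
  obtain p2 where p2: "p2 \<in> P" "lab2 p2 = m"
    using linext_obtain[OF l2] linext_range[OF l1 p1(1)] p1(2) by blast
  have "p1 \<noteq> p2" using p1 p2 by auto
  then have l12: "lab1 p2 < m" using linext_inj[OF l1 p1(1) p2(1)] same[OF p2(1)] p1 p2 by force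
  have l21: "lab2 p1 < m" using same[OF p1(1)] p1 by force
  have "snd p1 < snd p2 \<or> snd p2 < snd p1"
  proof (rule ccontr)
    assume "\<not> ?thesis"
    then have "p1 \<le> p2 \<or> p2 \<le> p1" by (auto simp: less_eq_prod_def)
    then show False
      using linext_mono[OF l1 p1(1) p2(1)] linext_mono[OF l2 p2(1) p1(1)] p1 p2 l12 l21 by auto
  qed
  then show False
    using greedy_unique_aux[OF l1 g1 p1(1,2) p2(1) l12 p2(2) same tiles[OF p2(1)] sub]
      greedy_unique_aux[OF l2 g2 p2 p1(1) l21 p1(2) same[symmetric] tiles[OF p1(1), symmetric] sub] by blast
qed

section \<open>Deleting a maximal point\<close>

lemma has_aboveI: "(i, snd p) \<in> P \<Longrightarrow> i < fst p \<Longrightarrow> has_above P p"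
  unfolding has_above_def by blast

lemma has_leftI: "(fst p, j) \<in> P \<Longrightarrow> j < snd p \<Longrightarrow> has_left P p"
  unfolding has_left_def by blast

definition gap :: "nat \<Rightarrow> nat \<Rightarrow> nat" where
  "gap a x = (if x < a then x else Suc x)"

definition row_open :: "cell set \<Rightarrow> cell \<Rightarrow> nat \<Rightarrow> nat" where
  "row_open P s = (if has_above P s then gap (fst s) else id)"

definition col_open :: "cell set \<Rightarrow> cell \<Rightarrow> nat \<Rightarrow> nat" where
  "col_open P s = (if has_above P s then id else gap (snd s))"

text \<open>Reinserting the deleted line is an order embedding of the smaller grid, whereas
  \<open>close_gap\<close> identifies the deleted line with a neighbouring one. The argument
  therefore pulls everything back along this map and meets \<open>close_gap\<close> only as its left
  inverse.\<close>

definition reopen :: "cell set \<Rightarrow> cell \<Rightarrow> cell \<Rightarrow> cell" where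
  "reopen P s c = (row_open P s (fst c), col_open P s (snd c))"

lemma strict_mono_gap: "strict_mono (gap a)"
  by (auto simp: strict_mono_def gap_def)

lemma strict_mono_row_open: "strict_mono (row_open P s)"
  using strict_mono_gap by (auto simp: row_open_def strict_mono_def)

lemma strict_mono_col_open: "strict_mono (col_open P s)"
  using strict_mono_gap by (auto simp: col_open_def strict_mono_def)

lemma reopen_sel [simp]:
  "fst (reopen P s c) = row_open P s (fst c)" "snd (reopen P s c) = col_open P s (snd c)"
  by (simp_all add: reopen_def)

lemma open_simps [simp]:
  "row_open P s x < row_open P s y \<longleftrightarrow> x < y" "row_open P s x \<le> row_open P s y \<longleftrightarrow> x \<le> y"
  "row_open P s x = row_open P s y \<longleftrightarrow> x = y"
  "col_open P s x < col_open P s y \<longleftrightarrow> x < y" "col_open P s x \<le> col_open P s y \<longleftrightarrow> x \<le> y"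
  "col_open P s x = col_open P s y \<longleftrightarrow> x = y"
  using strict_mono_row_open[of P s] strict_mono_col_open[of P s]
  by (simp_all add: strict_mono_less strict_mono_less_eq strict_mono_eq)

lemma reopen_le [simp]: "reopen P s c \<le> reopen P s d \<longleftrightarrow> c \<le> d"
  by (simp add: less_eq_prod_def)

lemma reopen_eq [simp]: "reopen P s c = reopen P s d \<longleftrightarrow> c = d"
  by (simp add: prod_eq_iff)

lemma gap_range: "x \<in> range (gap a) \<longleftrightarrow> x \<noteq> a"
proof
  assume "x \<noteq> a"
  then have "gap a (if x < a then x else x - 1) = x" by (auto simp: gap_def)
  then show "x \<in> range (gap a)" by (metis rangeI)
qed (auto simp: gap_def split: if_splits)

lemma reopen_range:
  "c \<in> range (reopen P s) \<longleftrightarrow> (if has_above P s then fst c \<noteq> fst s else snd c \<noteq> snd s)"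
proof -
  have "c \<in> range (reopen P s) \<longleftrightarrow> fst c \<in> range (row_open P s) \<and> snd c \<in> range (col_open P s)"
    by (force simp: reopen_def image_iff prod_eq_iff)
  then show ?thesis using gap_range by (auto simp: row_open_def col_open_def)
qed

lemma reopen_self: "s \<notin> range (reopen P s)"
  by (simp add: reopen_range)

lemma not_reopen_comparable: "c \<notin> range (reopen P s) \<Longrightarrow> c \<le> s \<or> s \<le> c"
  by (auto simp: reopen_range less_eq_prod_def split: if_splits)

lemma row_open_Suc: "row_open P s (Suc x) = Suc (row_open P s x) \<or> has_above P s \<and> Suc (row_open P s x) = fst s"
  by (auto simp: row_open_def gap_def)

locale maximal_point =
  fixes k l :: nat and P :: "cell set" and s :: cell
  assumes points: "baxter_points k l P"
    and s_in: "s \<in> P" and s_not_root: "s \<noteq> (0, 0)"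
    and s_max: "q \<in> P \<Longrightarrow> s \<le> q \<Longrightarrow> q = s"
begin

abbreviation "f \<equiv> row_open P s"
abbreviation "g \<equiv> col_open P s"
abbreviation "opn \<equiv> reopen P s"

definition P' :: "cell set" where "P' = opn -` P"

lemma s_xor: "has_above P s \<noteq> has_left P s"
  using baxter_pointsD(4)[OF points s_in s_not_root] .

text \<open>By maximality another point on the deleted line would come before \<open>s\<close> on
  it, to the left in a deleted row and above in a deleted column, against the direction in which
  \<open>s\<close> has its parent.\<close>

lemma other_in_range:
  assumes "q \<in> P" "q \<noteq> s" shows "q \<in> range opn"
proof (rule ccontr)
  assume *: "q \<notin> range opn"
  show False
  proof (cases "has_above P s")
    case True
    then have row: "fst q = fst s" using * by (simp add: reopen_range)
    have "\<not> s \<le> q" using s_max assms by blast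
    then have "snd q < snd s" using row by (simp add: less_eq_prod_def)
    moreover have "(fst s, snd q) \<in> P" using assms(1) row by (metis prod.collapse)
    ultimately have "has_left P s" by (auto simp: has_left_def)
    then show False using s_xor True by simp
  next
    case False
    then have col: "snd q = snd s" using * by (simp add: reopen_range)
    have "\<not> s \<le> q" using s_max assms by blast
    then have "fst q < fst s" using col by (simp add: less_eq_prod_def)
    moreover have "(fst q, snd s) \<in> P" using assms(1) col by (metis prod.collapse)
    ultimately have "has_above P s" by (auto simp: has_above_def)
    then show False using False by simp
  qed
qed

lemma other_obtain:
  assumes "q \<in> P" "q \<noteq> s" obtains q' where "q' \<in> P'" "q = opn q'"
  using other_in_range[OF assms] assms(1) by (auto simp: P'_def)

lemma P'_iff: "c \<in> P' \<longleftrightarrow> opn c \<in> P"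
  by (simp add: P'_def)

lemma opn_P': "opn ` P' = P - {s}"
proof
  show "opn ` P' \<subseteq> P - {s}" using reopen_self by (auto simp: P'_def)
  show "P - {s} \<subseteq> opn ` P'" using other_obtain by blast
qed

lemma finite_P: "finite P" by (rule baxter_points_finite[OF points])

lemma card_P': "card P = Suc (card P')"
proof -
  have "card P' = card (opn ` P')" by (rule card_image[symmetric]) (simp add: inj_on_def)
  then show ?thesis using opn_P' card.remove[OF finite_P s_in] by simp
qed

lemma has_above_opn: assumes "c \<in> P'" shows "has_above P (opn c) \<longleftrightarrow> has_above P' c"
proof
  assume "has_above P (opn c)"
  then obtain i where i: "i < f (fst c)" "(i, g (snd c)) \<in> P" by (auto simp: has_above_def)
  have "(i, g (snd c)) \<noteq> s"
  proof
    assume "(i, g (snd c)) = s"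
    then have "s \<le> opn c" using i(1) by (metis fst_conv snd_conv less_eq_prod_def less_imp_le order_refl reopen_sel)
    then have "opn c = s" using s_max assms by (simp add: P'_def)
    then show False using reopen_self by (metis rangeI)
  qed
  then obtain q where "q \<in> P'" "(i, g (snd c)) = opn q" by (rule other_obtain[OF i(2)])
  then have "fst q < fst c" "(fst q, snd c) \<in> P'" using i(1) by (auto simp: reopen_def)
  then show "has_above P' c" by (auto simp: has_above_def)
next
  assume "has_above P' c"
  then obtain i where "i < fst c" "(i, snd c) \<in> P'" by (auto simp: has_above_def)
  then have "f i < f (fst c)" "(f i, g (snd c)) \<in> P" by (auto simp: P'_def reopen_def)
  then show "has_above P (opn c)" by (intro has_aboveI[of "f i"]) simp_all
qed

lemma has_left_opn: assumes "c \<in> P'" shows "has_left P (opn c) \<longleftrightarrow> has_left P' c"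
proof
  assume "has_left P (opn c)"
  then obtain j where j: "j < g (snd c)" "(f (fst c), j) \<in> P" by (auto simp: has_left_def)
  have "(f (fst c), j) \<noteq> s"
  proof
    assume "(f (fst c), j) = s"
    then have "s \<le> opn c" using j(1) by (metis fst_conv snd_conv less_eq_prod_def less_imp_le order_refl reopen_sel)
    then have "opn c = s" using s_max assms by (simp add: P'_def)
    then show False using reopen_self by (metis rangeI)
  qed
  then obtain q where "q \<in> P'" "(f (fst c), j) = opn q" by (rule other_obtain[OF j(2)])
  then have "snd q < snd c" "(fst c, snd q) \<in> P'" using j(1) by (auto simp: reopen_def)
  then show "has_left P' c" by (auto simp: has_left_def)
next
  assume "has_left P' c"
  then obtain j where "j < snd c" "(fst c, j) \<in> P'" by (auto simp: has_left_def)
  then have "g j < g (snd c)" "(f (fst c), g j) \<in> P" by (auto simp: P'_def reopen_def)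
  then show "has_left P (opn c)" by (intro has_leftI[of _ "g j"]) simp_all
qed

definition k' :: nat where "k' = (if has_above P s then k - 1 else k)"
definition l' :: nat where "l' = (if has_above P s then l else l - 1)"

lemma s_bounds: "fst s < k" "snd s < l"
  using baxter_points_bounded[OF points, of "fst s" "snd s"] s_in by simp_all

lemma f_bound: "f x < k \<longleftrightarrow> x < k'"
  using s_bounds by (auto simp: row_open_def gap_def k'_def)

lemma g_bound: "g y < l \<longleftrightarrow> y < l'"
  using s_bounds by (auto simp: col_open_def gap_def l'_def)

lemma f_avoids: "has_above P s \<Longrightarrow> f x \<noteq> fst s"
  by (auto simp: row_open_def gap_def)

lemma g_avoids: "\<not> has_above P s \<Longrightarrow> g y \<noteq> snd s"
  by (auto simp: col_open_def gap_def)

lemma row_other: assumes "x < k'" obtains q where "q \<in> P'" "fst q = x"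
proof -
  have "f x < k" using assms f_bound by simp
  then obtain c where c: "(f x, c) \<in> P" by (rule baxter_points_row[OF points])
  \<comment> \<open>If the only known point of the row is \<open>s\<close>, its row survived, so
    \<open>s\<close> has a point to its left that can replace it.\<close>
  have "\<exists>c'. (f x, c') \<in> P \<and> (f x, c') \<noteq> s"
  proof (cases "(f x, c) = s")
    case True
    then have row: "fst s = f x" by (metis fst_conv)
    then have "\<not> has_above P s" using f_avoids[of x] by auto
    then have "has_left P s" using s_xor by simp
    then obtain j where "j < snd s" "(fst s, j) \<in> P" by (auto simp: has_left_def)
    then show ?thesis using row True by (metis less_irrefl snd_conv)
  qed (use c in blast)
  then obtain c' where c': "(f x, c') \<in> P" "(f x, c') \<noteq> s" by blast
  then obtain q where "q \<in> P'" "(f x, c') = opn q" by (rule other_obtain)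
  then show ?thesis using that by (auto simp: reopen_def)
qed

lemma col_other: assumes "y < l'" obtains q where "q \<in> P'" "snd q = y"
proof -
  have "g y < l" using assms g_bound by simp
  then obtain r where r: "(r, g y) \<in> P" by (rule baxter_points_col[OF points])
  have "\<exists>r'. (r', g y) \<in> P \<and> (r', g y) \<noteq> s"
  proof (cases "(r, g y) = s")
    case True
    then have col: "snd s = g y" by (metis snd_conv)
    then have "has_above P s" using g_avoids[of y] by auto
    then obtain i where "i < fst s" "(i, snd s) \<in> P" by (auto simp: has_above_def)
    then show ?thesis using col True by (metis less_irrefl fst_conv)
  qed (use r in blast)
  then obtain r' where r': "(r', g y) \<in> P" "(r', g y) \<noteq> s" by blast
  then obtain q where "q \<in> P'" "(r', g y) = opn q" by (rule other_obtain)
  then show ?thesis using that by (auto simp: reopen_def)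
qed

lemma opn_zero: "opn (0, 0) = (0, 0)"
  using s_xor by (auto simp: reopen_def row_open_def col_open_def gap_def has_above_def has_left_def)

lemma points': "baxter_points k' l' P'"
  unfolding baxter_points_def
proof (intro conjI ballI allI impI)
  show "fst ` P' = {..<k'}"
  proof
    show "fst ` P' \<subseteq> {..<k'}"
    proof
      fix x assume "x \<in> fst ` P'"
      then obtain y where "(f x, g y) \<in> P" by (auto simp: P'_def reopen_def)
      then show "x \<in> {..<k'}" using baxter_points_bounded(1)[OF points] f_bound by blast
    qed
    show "{..<k'} \<subseteq> fst ` P'" by (metis row_other image_eqI lessThan_iff subsetI)
  qed
  show "snd ` P' = {..<l'}"
  proof
    show "snd ` P' \<subseteq> {..<l'}"
    proof
      fix y assume "y \<in> snd ` P'"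
      then obtain x where "(f x, g y) \<in> P" by (auto simp: P'_def reopen_def)
      then show "y \<in> {..<l'}" using baxter_points_bounded(2)[OF points] g_bound by blast
    qed
    show "{..<l'} \<subseteq> snd ` P'" by (metis col_other image_eqI lessThan_iff subsetI)
  qed
  show "(0, 0) \<in> P'" using opn_zero baxter_pointsD(3)[OF points] by (simp add: P'_def)
  fix p assume p: "p \<in> P' - {(0, 0)}"
  then have "opn p \<noteq> (0, 0)" using opn_zero by (metis DiffE reopen_eq singletonI)
  then show "has_above P' p \<noteq> has_left P' p"
    using has_above_opn[of p] has_left_opn[of p] p baxter_pointsD(4)[OF points, of "opn p"] by (simp add: P'_def)
next
  fix r1 r2 c1 c2 c3 assume "r1 < r2" "c1 < c2" "c2 < c3" "(r1, c2) \<in> P'" "(r2, c1) \<in> P'"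
  then show "(r2, c3) \<notin> P'"
    using baxter_pointsD(5)[OF points, of "f r1" "f r2" "g c1" "g c2" "g c3"] by (simp add: P'_def reopen_def)
next
  fix r1 r2 r3 c1 c2 assume "r1 < r2" "r2 < r3" "c1 < c2" "(r1, c2) \<in> P'" "(r2, c1) \<in> P'"
  then show "(r3, c2) \<notin> P'"
    using baxter_pointsD(6)[OF points, of "f r1" "f r2" "f r3" "g c1" "g c2"] by (simp add: P'_def reopen_def)
qed

text \<open>When \<open>s\<close> itself witnesses the crossing, it does so along the line through
  \<open>s\<close> that is kept. On that line \<open>s\<close> has a parent before it, which
  replaces \<open>s\<close> as a witness.\<close>

lemma crossing_opn:
  assumes "crossing P (opn c)"
  shows "crossing P' c"
proof -
  obtain i j where i: "i < f (fst c)" "(i, g (snd c)) \<in> P" and j: "j < g (snd c)" "(f (fst c), j) \<in> P"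
    using assms by (auto simp: crossing_def has_above_def has_left_def)
  have "\<exists>i. i < f (fst c) \<and> (i, g (snd c)) \<in> P \<and> (i, g (snd c)) \<noteq> s"
  proof (cases "(i, g (snd c)) = s")
    case True
    then have col: "snd s = g (snd c)" and row: "fst s = i" by (metis snd_conv, metis fst_conv)
    then have "has_above P s" using g_avoids[of "snd c"] by auto
    then obtain i2 where "i2 < i" "(i2, g (snd c)) \<in> P" using col row by (auto simp: has_above_def)
    then show ?thesis using row i(1) by (metis fst_conv less_irrefl order.strict_trans)
  qed (use i in blast)
  then obtain i' where i': "i' < f (fst c)" "(i', g (snd c)) \<in> P" "(i', g (snd c)) \<noteq> s" by blast
  have "\<exists>j. j < g (snd c) \<and> (f (fst c), j) \<in> P \<and> (f (fst c), j) \<noteq> s"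
  proof (cases "(f (fst c), j) = s")
    case True
    then have col: "snd s = j" and row: "fst s = f (fst c)" by (metis snd_conv, metis fst_conv)
    then have "\<not> has_above P s" using f_avoids[of "fst c"] by auto
    then have "has_left P s" using s_xor by simp
    then obtain j2 where "j2 < j" "(f (fst c), j2) \<in> P" using col row by (auto simp: has_left_def)
    then show ?thesis using col j(1) by (metis snd_conv less_irrefl order.strict_trans)
  qed (use j in blast)
  then obtain j' where j': "j' < g (snd c)" "(f (fst c), j') \<in> P" "(f (fst c), j') \<noteq> s" by blast
  obtain a where a: "a \<in> P'" "(i', g (snd c)) = opn a" by (rule other_obtain[OF i'(2,3)])
  obtain b where b: "b \<in> P'" "(f (fst c), j') = opn b" by (rule other_obtain[OF j'(2,3)])
  have "(fst a, snd c) \<in> P'" "fst a < fst c" "(fst c, snd b) \<in> P'" "snd b < snd c"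
    using a b i'(1) j'(1) by (auto simp: reopen_def)
  then show ?thesis by (auto simp: crossing_def has_above_def has_left_def)
qed

lemma crossing_opnI: assumes "crossing P' c" shows "crossing P (opn c)"
proof -
  obtain i j where i: "i < fst c" "(i, snd c) \<in> P'" and j: "j < snd c" "(fst c, j) \<in> P'"
    using assms by (auto simp: crossing_def has_above_def has_left_def)
  have "(f i, g (snd c)) \<in> P" "(f (fst c), g j) \<in> P" using i j by (auto simp: P'_def reopen_def)
  moreover have "f i < f (fst c)" "g j < g (snd c)" using i j by simp_all
  ultimately show ?thesis unfolding crossing_def
    by (intro conjI has_aboveI[of "f i"] has_leftI[of _ "g j"]) simp_all
qed

lemma linext_opn:
  assumes "linext P lab" "lab s = card P"
  shows "linext P' (lab \<circ> opn)"
  unfolding linext_def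
proof (intro conjI ballI impI)
  have "bij_betw lab P {1..card P}" using assms(1) by (simp add: linext_def)
  then have "bij_betw lab (P - {s}) ({1..card P} - {lab s})"
    by (rule bij_betw_DiffI) (use s_in linext_range[OF assms(1) s_in] in \<open>auto simp: bij_betw_def\<close>)
  moreover have "{1..card P} - {lab s} = {1..card P'}" using assms(2) card_P' by auto
  moreover have "bij_betw opn P' (P - {s})" unfolding bij_betw_def using opn_P' by (simp add: inj_on_def)
  ultimately show "bij_betw (lab \<circ> opn) P' {1..card P'}" by (metis bij_betw_trans)
  fix p q assume "p \<in> P'" "q \<in> P'" "p \<le> q"
  then show "(lab \<circ> opn) p \<le> (lab \<circ> opn) q" using linext_mono[OF assms(1)] by (simp add: P'_def)
qed

lemma linext_opnI:
  assumes "linext P' lab'" "lab s = card P" "\<And>c. c \<in> P' \<Longrightarrow> lab (opn c) = lab' c"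
  shows "linext P lab"
  unfolding linext_def
proof (intro conjI ballI impI)
  have "bij_betw lab' P' {1..card P'}" using assms(1) by (simp add: linext_def)
  then have b: "bij_betw (lab \<circ> opn) P' {1..card P'}"
    using bij_betw_cong[of P' "lab \<circ> opn" lab'] assms(3) by simp
  have "bij_betw opn P' (P - {s})" unfolding bij_betw_def using opn_P' by (simp add: inj_on_def)
  then have "bij_betw lab (P - {s}) {1..card P'}" using b bij_betw_comp_iff by blast
  then have "bij_betw lab (P - {s} \<union> {s}) ({1..card P'} \<union> {card P})"
    by (rule bij_betw_combine) (use assms(2) card_P' in \<open>auto simp: bij_betw_def\<close>)
  moreover have "P - {s} \<union> {s} = P" "{1..card P'} \<union> {card P} = {1..card P}" using s_in card_P' by auto
  ultimately show "bij_betw lab P {1..card P}" by simp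
  fix p q assume pq: "p \<in> P" "q \<in> P" "p \<le> q"
  have le: "lab x \<le> card P" if xP: "x \<in> P" for x
  proof (cases "x = s")
    case False
    then obtain x' where x: "x' \<in> P'" "x = opn x'" by (rule other_obtain[OF xP])
    then show ?thesis using linext_range[OF assms(1) x(1)] assms(3)[OF x(1)] card_P' by simp
  qed (use assms(2) in simp)
  show "lab p \<le> lab q"
  proof (cases "q = s")
    case True
    then show ?thesis using le[OF pq(1)] assms(2) by simp
  next
    case False
    then have "p \<noteq> s" using s_max pq by blast
    obtain p' q' where "p' \<in> P'" "p = opn p'" "q' \<in> P'" "q = opn q'"
      using other_obtain[OF pq(1) \<open>p \<noteq> s\<close>] other_obtain[OF pq(2) False] by metis
    then show ?thesis using linext_mono[OF assms(1)] assms(3) pq(3) by simp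
  qed
qed

lemma greedy_opn: assumes "greedy P lab" shows "greedy P' (lab \<circ> opn)"
  unfolding greedy_def
proof (intro ballI impI notI)
  fix p q v assume *: "p \<in> P'" "q \<in> P'" "v \<in> P'" "(lab \<circ> opn) p = Suc ((lab \<circ> opn) q)"
    "(lab \<circ> opn) p < (lab \<circ> opn) v" "fst q < fst p" "snd p < snd q"
    "fst q < fst v \<and> fst v \<le> fst p \<and> snd p < snd v \<and> snd v \<le> snd q"
  show False
    by (rule greedyD[OF assms, of "opn p" "opn q" "opn v"]) (use * in \<open>simp_all add: P'_def\<close>)
qed

end

section \<open>Diagrams as down-sets\<close>

lemma down_closed_nat:
  fixes S :: "nat set"
  assumes "finite S" "\<And>i j. i \<le> j \<Longrightarrow> j \<in> S \<Longrightarrow> i \<in> S"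
  shows "S = {..<card S}"
proof (cases "S = {}")
  case False
  have "S = {..Max S}"
  proof
    show "S \<subseteq> {..Max S}" using assms(1) by auto
    show "{..Max S} \<subseteq> S" using assms(2) Max_in[OF assms(1) False] by auto
  qed
  then have "S = {..<Suc (Max S)}" by (simp add: lessThan_Suc_atMost)
  then show ?thesis by (metis card_lessThan)
qed simp

definition down_closed :: "cell set \<Rightarrow> bool" where
  "down_closed D \<longleftrightarrow> (\<forall>p q. p \<le> q \<longrightarrow> q \<in> D \<longrightarrow> p \<in> D)"

lemma down_closedD: "down_closed D \<Longrightarrow> q \<in> D \<Longrightarrow> p \<le> q \<Longrightarrow> p \<in> D"
  unfolding down_closed_def by blast

lemma ferrers_diagramD:
  assumes "ferrers_diagram D" shows "finite D" "down_closed D"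
proof -
  obtain ls where ls: "sorted_wrt (\<ge>) ls" and D: "D = {(i, j). i < length ls \<and> j < ls ! i}"
    using assms unfolding ferrers_diagram_def by blast
  have "D = (SIGMA i:{..<length ls}. {..<ls ! i})" unfolding D by auto
  then show "finite D" by simp
  show "down_closed D" unfolding down_closed_def
  proof (intro allI impI)
    fix p q :: cell assume pq: "p \<le> q" "q \<in> D"
    then have q: "fst q < length ls" "snd q < ls ! fst q" and le: "fst p \<le> fst q" "snd p \<le> snd q"
      by (auto simp: D less_eq_prod_def)
    have "ls ! fst q \<le> ls ! fst p"
      using sorted_wrt_nth_less[OF ls, of "fst p" "fst q"] q(1) le(1) by (cases "fst p = fst q") auto
    then have "fst p < length ls" "snd p < ls ! fst p" using q le by linarith+
    then show "p \<in> D" by (simp add: D case_prod_beta)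
  qed
qed

lemma ferrers_diagramI:
  assumes fin: "finite D" and down: "down_closed D" and "(0, 0) \<in> D"
  shows "ferrers_diagram D"
proof -
  define I where "I = {i. (i, 0) \<in> D}"
  define R where "R i = {j. (i, j) \<in> D}" for i
  have "I \<subseteq> fst ` D" "R i \<subseteq> snd ` D" for i by (force simp: I_def R_def)+
  then have finI: "finite I" and finR: "finite (R i)" for i using fin by (meson finite_imageI finite_subset)+
  have I: "I = {..<card I}"
    by (rule down_closed_nat[OF finI]) (auto simp: I_def intro: down_closedD[OF down])
  have R: "R i = {..<card (R i)}" for i
    by (rule down_closed_nat[OF finR]) (auto simp: R_def intro: down_closedD[OF down])
  have RD: "j < card (R i) \<longleftrightarrow> (i, j) \<in> D" for i j using R[of i] unfolding R_def by auto
  have ID: "i < card I \<longleftrightarrow> (i, 0) \<in> D" for i using I unfolding I_def by auto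
  let ?ls = "map (\<lambda>i. card (R i)) [0..<card I]"
  have "card I \<noteq> 0" using ID[of 0] assms(3) by auto
  moreover have "\<forall>x\<in>set ?ls. 0 < x" using RD[of 0] ID by auto
  moreover have "sorted_wrt (\<ge>) ?ls"
  proof -
    have "card (R j) \<le> card (R i)" if "i \<le> j" for i j
      by (intro card_mono[OF finR]) (auto simp: R_def that intro: down_closedD[OF down])
    then show ?thesis unfolding sorted_wrt_map by (intro sorted_wrt_mono_rel[OF _ sorted_wrt_upt]) auto
  qed
  moreover have "D = {(i, j). i < length ?ls \<and> j < ?ls ! i}"
  proof (intro set_eqI)
    fix c :: cell
    obtain i j where c: "c = (i, j)" by (cases c)
    have "(i, j) \<in> D \<Longrightarrow> (i, 0) \<in> D" by (rule down_closedD[OF down]) auto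
    then show "c \<in> D \<longleftrightarrow> c \<in> {(i, j). i < length ?ls \<and> j < ?ls ! i}"
      using ID[of i] RD[of j i] by (auto simp: c)
  qed
  ultimately show ?thesis unfolding ferrers_diagram_def by (intro exI[of _ ?ls]) simp
qed

definition shape :: "nat \<Rightarrow> nat \<Rightarrow> cell set \<Rightarrow> cell set \<Rightarrow> bool" where
  "shape k l P D \<longleftrightarrow> baxter_points k l P \<and> P \<subseteq> D \<and> D \<subseteq> {..<k} \<times> {..<l} \<and> down_closed D"

lemma shapeD:
  assumes "shape k l P D"
  shows "baxter_points k l P" "P \<subseteq> D" "D \<subseteq> {..<k} \<times> {..<l}" "down_closed D" "finite D"
  using assms unfolding shape_def by (blast, blast, blast, blast, meson finite_SigmaI finite_lessThan finite_subset)

lemma point_above_iff: "point_above (Tableau D P) c \<longleftrightarrow> has_above P c"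
  by (simp add: point_above_def has_above_def)

lemma point_left_iff: "point_left (Tableau D P) c \<longleftrightarrow> has_left P c"
  by (simp add: point_left_def has_left_def)

lemma baxter_tlt_shape:
  assumes "T \<in> baxter_tlts n"
  shows "shape (num_rows T) (num_cols T) (points T) (diagram T)" "card (points T) = n"
proof -
  let ?P = "points T" and ?D = "diagram T"
  have T: "T = Tableau ?D ?P" by simp
  have tlt: "tree_like_tableau T" and H: "\<not> contains_H T" and V: "\<not> contains_V T" and n: "tableau_size T = n"
    using assms by (simp_all add: baxter_tlts_def)
  show "card ?P = n" using n by (simp add: tableau_size_def)
  have fd: "ferrers_diagram ?D" and PD: "?P \<subseteq> ?D" and root: "(0, 0) \<in> ?P"
    and xor: "\<And>c. c \<in> ?P - {(0, 0)} \<Longrightarrow> has_above ?P c \<noteq> has_left ?P c"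
    and rows: "\<And>i. i \<in> fst ` ?D \<Longrightarrow> \<exists>j. (i, j) \<in> ?P" and cols: "\<And>j. j \<in> snd ` ?D \<Longrightarrow> \<exists>i. (i, j) \<in> ?P"
    using tlt unfolding tree_like_tableau_def
    by (simp, simp, simp, metis T point_above_iff point_left_iff, blast, blast)
  note fin = ferrers_diagramD(1)[OF fd] and down = ferrers_diagramD(2)[OF fd]
  have fstD: "fst ` ?D = {..<num_rows T}" unfolding num_rows_def
  proof (rule down_closed_nat)
    fix i j assume "i \<le> j" "j \<in> fst ` ?D"
    then obtain c where "(j, c) \<in> ?D" by auto
    then have "(i, c) \<in> ?D" by (rule down_closedD[OF down]) (use \<open>i \<le> j\<close> in auto)
    then show "i \<in> fst ` ?D" by force
  qed (use fin in simp)
  have sndD: "snd ` ?D = {..<num_cols T}" unfolding num_cols_def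
  proof (rule down_closed_nat)
    fix i j assume "i \<le> j" "j \<in> snd ` ?D"
    then obtain r where "(r, j) \<in> ?D" by auto
    then have "(r, i) \<in> ?D" by (rule down_closedD[OF down]) (use \<open>i \<le> j\<close> in auto)
    then show "i \<in> snd ` ?D" by force
  qed (use fin in simp)
  have "fst ` ?P = fst ` ?D" "snd ` ?P = snd ` ?D" using rows cols PD by (force, force)
  then have fP: "fst ` ?P = {..<num_rows T}" and sP: "snd ` ?P = {..<num_cols T}" using fstD sndD by simp_all
  \<comment> \<open>The two cells that a pattern requires to be empty are treated here: pointing one
    of them would give some point a point above and a point to its left.\<close>
  have noboth: False if "(r, c) \<in> ?P" "(r', c) \<in> ?P" "(r, c') \<in> ?P" "r' < r" "c' < c" for r c r' c'
    using xor[of "(r, c)"] that has_aboveI[of r' "(r, c)"] has_leftI[of "(r, c)" c'] by auto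
  have sub: "?D \<subseteq> {..<num_rows T} \<times> {..<num_cols T}" using fstD sndD by force
  have le: "{..r} \<times> {..c} \<subseteq> ?D" if "(r, c) \<in> ?P" for r c
    using down_closedD[OF down, of "(r, c)"] that PD by auto
  have "baxter_points (num_rows T) (num_cols T) ?P" unfolding baxter_points_def
  proof (intro conjI ballI allI impI fP sP root)
    fix r1 r2 c1 c2 c3 :: nat assume *: "r1 < r2" "c1 < c2" "c2 < c3" "(r1, c2) \<in> ?P" "(r2, c1) \<in> ?P"
    show "(r2, c3) \<notin> ?P"
    proof
      assume P3: "(r2, c3) \<in> ?P"
      have "(r1, c3) \<notin> ?P" "(r2, c2) \<notin> ?P"
        using noboth[of r2 c3 r1 c1] noboth[of r2 c2 r1 c1] P3 * by auto
      moreover have "{r1, r2} \<times> {c1, c2, c3} \<subseteq> ?D" using le[OF P3] * by auto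
      ultimately show False using H * P3 unfolding contains_H_def by blast
    qed
  next
    fix r1 r2 r3 c1 c2 :: nat assume *: "r1 < r2" "r2 < r3" "c1 < c2" "(r1, c2) \<in> ?P" "(r2, c1) \<in> ?P"
    show "(r3, c2) \<notin> ?P"
    proof
      assume P3: "(r3, c2) \<in> ?P"
      have "(r3, c1) \<notin> ?P" "(r2, c2) \<notin> ?P"
        using noboth[of r3 c2 r1 c1] noboth[of r2 c2 r1 c1] P3 * by auto
      moreover have "{r1, r2, r3} \<times> {c1, c2} \<subseteq> ?D" using le[OF P3] * by auto
      ultimately show False using V * P3 unfolding contains_V_def by blast
    qed
  qed (use xor in blast)
  then show "shape (num_rows T) (num_cols T) ?P ?D" using PD sub down by (simp add: shape_def)
qed

lemma shape_baxter_tlt: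
  assumes "shape k l P D"
  shows "Tableau D P \<in> baxter_tlts (card P)" "num_rows (Tableau D P) = k" "num_cols (Tableau D P) = l"
proof -
  note S = shapeD[OF assms] and B = baxter_pointsD[OF shapeD(1)[OF assms]]
  have "fst ` P \<subseteq> fst ` D" "fst ` D \<subseteq> {..<k}" "snd ` P \<subseteq> snd ` D" "snd ` D \<subseteq> {..<l}" using S(2,3) by auto
  then have fD: "fst ` D = {..<k}" and sD: "snd ` D = {..<l}" using B(1,2) by auto
  show "num_rows (Tableau D P) = k" "num_cols (Tableau D P) = l"
    by (simp_all add: num_rows_def num_cols_def fD sD)
  have "\<not> contains_H (Tableau D P)"
  proof
    assume "contains_H (Tableau D P)"
    then obtain r1 r2 c1 c2 c3 where "r1 < r2" "c1 < c2" "c2 < c3" "(r1, c2) \<in> P" "(r2, c1) \<in> P" "(r2, c3) \<in> P"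
      unfolding contains_H_def by auto
    then show False using B(5) by blast
  qed
  moreover have "\<not> contains_V (Tableau D P)"
  proof
    assume "contains_V (Tableau D P)"
    then obtain r1 r2 r3 c1 c2 where "r1 < r2" "r2 < r3" "c1 < c2" "(r1, c2) \<in> P" "(r2, c1) \<in> P" "(r3, c2) \<in> P"
      unfolding contains_V_def by auto
    then show False using B(6) by blast
  qed
  moreover have "tree_like_tableau (Tableau D P)"
    unfolding tree_like_tableau_def point_above_iff point_left_iff tableau.sel
  proof (intro conjI ballI)
    have "(0, 0) \<in> D" using S(2) B(3) by blast
    then show "ferrers_diagram D" by (rule ferrers_diagramI[OF S(5,4)])
    show "P \<subseteq> D" "(0, 0) \<in> P" using S(2) B(3) .
    show "\<exists>j. (i, j) \<in> P" if "i \<in> fst ` D" for i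
      using baxter_points_row[OF S(1)] that fD by (metis lessThan_iff)
    show "\<exists>i. (i, j) \<in> P" if "j \<in> snd ` D" for j
      using baxter_points_col[OF S(1)] that sD by (metis lessThan_iff)
  qed (use B(4) in blast)
  ultimately show "Tableau D P \<in> baxter_tlts (card P)" by (simp add: baxter_tlts_def tableau_size_def)
qed

section \<open>Special points and ribbons\<close>

text \<open>In a down-closed diagram a cell is lowest in its column as soon as its lower neighbour
  is missing, so a single cell is tested.\<close>

definition is_special :: "cell set \<Rightarrow> cell set \<Rightarrow> cell \<Rightarrow> bool" where
  "is_special P D s \<longleftrightarrow> s \<in> P \<and> (Suc (fst s), snd s) \<notin> D \<and>
     (\<forall>i j. (i, j) \<in> P \<longrightarrow> (Suc i, j) \<notin> D \<longrightarrow> j \<le> snd s)"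

lemma is_specialD:
  assumes "is_special P D s"
  shows "s \<in> P" "(Suc (fst s), snd s) \<notin> D" "(i, j) \<in> P \<Longrightarrow> (Suc i, j) \<notin> D \<Longrightarrow> j \<le> snd s"
  using assms unfolding is_special_def by blast+

lemma bottom_points_shape:
  assumes "shape k l P D"
  shows "bottom_points (Tableau D P) = {(i, j). (i, j) \<in> P \<and> (Suc i, j) \<notin> D}"
proof -
  have "(i', j) \<notin> D" if "(Suc i, j) \<notin> D" "i < i'" for i i' j
    using down_closedD[OF shapeD(4)[OF assms], of "(i', j)" "(Suc i, j)"] that by auto
  then show ?thesis unfolding bottom_points_def by auto
qed

lemma is_special_unique:
  assumes sh: "shape k l P D" and s: "is_special P D s" and s': "is_special P D s'"
  shows "s = s'"
proof -
  have col: "snd s = snd s'"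
    using is_specialD(3)[OF s, of "fst s'" "snd s'"] is_specialD(3)[OF s', of "fst s" "snd s"]
      is_specialD(1,2)[OF s] is_specialD(1,2)[OF s'] by simp
  have False if s: "is_special P D s" and s': "is_special P D s'" and "fst s < fst s'" "snd s = snd s'" for s s'
  proof -
    have "s' \<in> D" using is_specialD(1)[OF s'] shapeD(2)[OF sh] by blast
    then have "(Suc (fst s), snd s) \<in> D"
      by (rule down_closedD[OF shapeD(4)[OF sh]]) (use that(3,4) in \<open>simp add: less_eq_prod_def\<close>)
    then show False using is_specialD(2)[OF s] by simp
  qed
  from this[OF s s' _ col] this[OF s' s _ col[symmetric]] have "fst s = fst s'" by (meson nat_neq_iff)
  then show ?thesis using col by (simp add: prod_eq_iff)
qed

lemma is_special_exists:
  assumes sh: "shape k l P D"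
  obtains s where "is_special P D s"
proof -
  note S = shapeD[OF sh]
  let ?A = "{(i, j). (i, j) \<in> P \<and> (Suc i, j) \<notin> D}"
  have finA: "finite ?A" by (rule finite_subset[OF _ baxter_points_finite[OF S(1)]]) auto
  have "k - 1 < k" using baxter_points_card(2)[OF S(1)] by simp
  then obtain c where "(k - 1, c) \<in> P" by (rule baxter_points_row[OF S(1)])
  moreover have "(Suc (k - 1), c) \<notin> D" using S(3) by auto
  ultimately have "(k - 1, c) \<in> ?A" by simp
  then have "Max (snd ` ?A) \<in> snd ` ?A" using finA by (intro Max_in) auto
  then obtain s where s: "s \<in> ?A" "snd s = Max (snd ` ?A)" by auto
  have "j \<le> snd s" if "(i, j) \<in> P" "(Suc i, j) \<notin> D" for i j
    unfolding s(2) using finA that by (intro Max_ge finite_imageI) force+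
  then have "is_special P D s" using s(1) by (auto simp: is_special_def)
  then show ?thesis by (rule that)
qed

lemma special_point_eq:
  assumes sh: "shape k l P D" and s: "is_special P D s"
  shows "special_point (Tableau D P) = s"
  unfolding special_point_def
proof (rule the_equality)
  show "s \<in> bottom_points (Tableau D P) \<and> (\<forall>c\<in>bottom_points (Tableau D P). snd c \<le> snd s)"
    using s by (auto simp: bottom_points_shape[OF sh] is_special_def case_prod_beta)
next
  fix s' assume "s' \<in> bottom_points (Tableau D P) \<and> (\<forall>c\<in>bottom_points (Tableau D P). snd c \<le> snd s')"
  then have "is_special P D s'"
    by (auto simp: bottom_points_shape[OF sh] is_special_def case_prod_beta)
  then show "s' = s" by (rule is_special_unique[OF sh _ s])
qed

text \<open>A point weakly south-east of \<open>s\<close> in a lower row would bring the cell below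
  \<open>s\<close> into the diagram. In the row of \<open>s\<close> it is again lowest in its
  column, so it cannot be further right.\<close>

lemma is_special_max:
  assumes sh: "shape k l P D" and s: "is_special P D s" and q: "q \<in> P" "s \<le> q"
  shows "q = s"
proof -
  note S = shapeD[OF sh]
  have le: "fst s \<le> fst q" "snd s \<le> snd q" using q(2) by (auto simp: less_eq_prod_def)
  have qD: "q \<in> D" using q(1) S(2) by blast
  have row: "fst q = fst s"
  proof (rule ccontr)
    assume "fst q \<noteq> fst s"
    then have "(Suc (fst s), snd s) \<in> D"
      by (intro down_closedD[OF S(4) qD]) (use le in \<open>simp add: less_eq_prod_def\<close>)
    then show False using is_specialD(2)[OF s] by simp
  qed
  have "(Suc (fst q), snd q) \<notin> D"
  proof
    assume "(Suc (fst q), snd q) \<in> D"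
    then have "(Suc (fst s), snd s) \<in> D"
      by (rule down_closedD[OF S(4)]) (use le row in \<open>simp add: less_eq_prod_def\<close>)
    then show False using is_specialD(2)[OF s] by simp
  qed
  then have "snd q \<le> snd s" using is_specialD(3)[OF s, of "fst q" "snd q"] q(1) by simp
  then show ?thesis using row le by (simp add: prod_eq_iff)
qed

text \<open>The point \<open>t\<close> at which the ribbon of \<open>s\<close> stops.\<close>

definition ribbon_end :: "cell set \<Rightarrow> cell set \<Rightarrow> cell \<Rightarrow> cell \<Rightarrow> bool" where
  "ribbon_end P D s t \<longleftrightarrow>
     t \<in> P \<and> fst t < fst s \<and> snd s < snd t \<and> (Suc (fst t), snd t) \<in> D \<and> (Suc (fst t), Suc (snd t)) \<notin> D \<and>
     (\<forall>x y. (x, y) \<in> P \<longrightarrow> fst t < x \<longrightarrow> snd s < y \<longrightarrow> (Suc x, Suc y) \<in> D)"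

lemma ribbon_endD:
  assumes "ribbon_end P D s t"
  shows "t \<in> P" "fst t < fst s" "snd s < snd t" "(Suc (fst t), snd t) \<in> D" "(Suc (fst t), Suc (snd t)) \<notin> D"
    "(x, y) \<in> P \<Longrightarrow> fst t < x \<Longrightarrow> snd s < y \<Longrightarrow> (Suc x, Suc y) \<in> D"
  using assms unfolding ribbon_end_def by blast+

definition rim_part :: "cell set \<Rightarrow> cell \<Rightarrow> cell \<Rightarrow> cell set" where
  "rim_part D s t = {(x, y). (x, y) \<in> rim D \<and> fst t < x \<and> snd s < y}"

lemma ribbon_end_exists:
  assumes sh: "shape k l P D" and s: "is_special P D s" and right: "(fst s, Suc (snd s)) \<in> D"
  obtains t where "ribbon_end P D s t"
proof -
  note S = shapeD[OF sh] and sp = is_specialD[OF s]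
  \<comment> \<open>The pointed rim cells to the right of \<open>s\<close>; a point of the last
    column is always one. The path from \<open>s\<close> climbs, so the first one met is the one in
    the lowest row.\<close>
  let ?Q = "{(x, y). (x, y) \<in> P \<and> (Suc x, Suc y) \<notin> D \<and> snd s < y}"
  have finQ: "finite ?Q" by (rule finite_subset[OF _ baxter_points_finite[OF S(1)]]) auto
  have sl: "Suc (snd s) < l" using right S(3) by auto
  then have "l - 1 < l" by simp
  then obtain r where r: "(r, l - 1) \<in> P" by (rule baxter_points_col[OF S(1)])
  have "(r, l - 1) \<in> ?Q" using r sl S(3) by auto
  then have "Max (fst ` ?Q) \<in> fst ` ?Q" using finQ by (intro Max_in) auto
  then obtain t where t: "t \<in> ?Q" "fst t = Max (fst ` ?Q)" by auto
  then have tP: "t \<in> P" "(Suc (fst t), Suc (snd t)) \<notin> D" "snd s < snd t" by auto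
  \<comment> \<open>Otherwise \<open>t\<close> would be lowest in its column and further right than
    the special point. Hence the ribbon reaches \<open>t\<close> from below.\<close>
  have tD: "(Suc (fst t), snd t) \<in> D" using sp(3)[of "fst t" "snd t"] tP by force
  have lt: "fst t < fst s"
  proof (rule ccontr)
    assume "\<not> ?thesis"
    then have "(Suc (fst s), snd s) \<in> D"
      by (intro down_closedD[OF S(4) tD]) (use tP in \<open>simp add: less_eq_prod_def\<close>)
    then show False using sp(2) by simp
  qed
  have "(Suc x, Suc y) \<in> D" if xy: "(x, y) \<in> P" "fst t < x" "snd s < y" for x y
  proof (rule ccontr)
    assume "(Suc x, Suc y) \<notin> D"
    then have "(x, y) \<in> ?Q" using xy by simp
    then have "x \<le> fst t" unfolding t(2) using finQ by (intro Max_ge finite_imageI) force+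
    then show False using xy by simp
  qed
  then have "ribbon_end P D s t" unfolding ribbon_end_def using tP tD lt by blast
  then show ?thesis by (rule that)
qed

lemma ribbon_empty:
  assumes sh: "shape k l P D" and s: "is_special P D s" and right: "(fst s, Suc (snd s)) \<notin> D"
  shows "ribbon (Tableau D P) = {}"
proof -
  have "False" if "(i, j) \<in> ribbon (Tableau D P)" for i j
    using that
    by (induction rule: ribbon.induct) (use right special_point_eq[OF sh s] in auto)
  then show ?thesis by auto
qed

lemma rim_part_unpointed:
  assumes "ribbon_end P D s t" "c \<in> rim_part D s t" shows "c \<notin> P"
  using assms ribbon_endD(6)[OF assms(1), of "fst c" "snd c"] by (auto simp: rim_part_def rim_def)

lemma ribbon_eq:
  assumes sh: "shape k l P D" and s: "is_special P D s" and right: "(fst s, Suc (snd s)) \<in> D"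
    and t: "ribbon_end P D s t"
  shows "ribbon (Tableau D P) = rim_part D s t"
proof
  note S = shapeD[OF sh] and sp = is_specialD[OF s] and te = ribbon_endD[OF t]
  note sps = special_point_eq[OF sh s]
  have unp: "c \<notin> P" if "c \<in> rim_part D s t" for c using rim_part_unpointed[OF t that] .
  have start: "(fst s, Suc (snd s)) \<in> rim_part D s t"
  proof -
    have "(Suc (fst s), Suc (Suc (snd s))) \<notin> D"
    proof
      assume "(Suc (fst s), Suc (Suc (snd s))) \<in> D"
      then have "(Suc (fst s), snd s) \<in> D" by (rule down_closedD[OF S(4)]) simp
      then show False using sp(2) by simp
    qed
    then show ?thesis using right te(2) by (simp add: rim_part_def rim_def)
  qed
  show "ribbon (Tableau D P) \<subseteq> rim_part D s t"
  proof (rule subrelI)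
    fix x y assume "(x, y) \<in> ribbon (Tableau D P)"
    then show "(x, y) \<in> rim_part D s t"
    proof (induction rule: ribbon.induct)
      case (start i j)
      then show ?case using \<open>(fst s, Suc (snd s)) \<in> rim_part D s t\<close> sps by simp
    next
      case (step_right i j)
      then show ?case by (simp add: rim_part_def)
    next
      case (step_up i j)
      then have ij: "(Suc i, j) \<in> D" "fst t \<le> i" "snd s < j" "(i, j) \<in> D" "(Suc i, Suc j) \<notin> D" "(i, j) \<notin> P"
        by (auto simp: rim_part_def rim_def)
      \<comment> \<open>The step up into the row of \<open>t\<close> can only land on
        \<open>t\<close>, the one cell there whose lower neighbour is in the diagram and whose
        diagonal neighbour is not. Since \<open>t\<close> is pointed, the walk stops before.\<close>
      have "i \<noteq> fst t"
      proof
        assume i: "i = fst t"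
        have "\<not> j < snd t" using down_closedD[OF S(4) te(4), of "(Suc i, Suc j)"] ij(5) i by auto
        moreover have "\<not> snd t < j" using down_closedD[OF S(4) ij(1), of "(Suc (fst t), Suc (snd t))"] te(5) i by auto
        ultimately have "(i, j) = t" using i by (simp add: prod_eq_iff)
        then show False using te(1) ij(6) by simp
      qed
      then show ?case using ij by (simp add: rim_part_def rim_def)
    qed
  qed
  have "(x, y) \<in> ribbon (Tableau D P)" if "(x, y) \<in> rim_part D s t" for x y
    using that
  \<comment> \<open>The path is followed backwards: the predecessor of a rim cell is the cell below
    it if that is in the diagram, and the cell to its left otherwise. The measure is the distance to
    \<open>s\<close>.\<close>
  proof (induction "(fst s - x) + (y - snd s)" arbitrary: x y rule: less_induct)
    case less
    have xy: "(x, y) \<in> D" "(Suc x, Suc y) \<notin> D" "fst t < x" "snd s < y"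
      using less(2) by (auto simp: rim_part_def rim_def)
    have un: "(x, y) \<notin> P" by (rule unp[OF less(2)])
    have xs: "x \<le> fst s"
    proof (rule ccontr)
      assume "\<not> ?thesis"
      then have "(Suc (fst s), snd s) \<in> D" using xy by (intro down_closedD[OF S(4) xy(1)]) simp
      then show False using sp(2) by simp
    qed
    show ?case
    proof (cases "(Suc x, y) \<in> D")
      case True
      have "Suc x \<le> fst s"
      proof (rule ccontr)
        assume "\<not> ?thesis"
        then have "(Suc (fst s), snd s) \<in> D" using xy xs by (intro down_closedD[OF S(4) True]) simp
        then show False using sp(2) by simp
      qed
      moreover have "(Suc (Suc x), Suc y) \<notin> D"
        using down_closedD[OF S(4), of "(Suc (Suc x), Suc y)" "(Suc x, Suc y)"] xy(2) by auto
      ultimately have "(Suc x, y) \<in> ribbon (Tableau D P)"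
        using less(1)[of "Suc x" y] True xy by (simp add: rim_part_def rim_def)
      then show ?thesis by (rule ribbon.step_up) (use xy un in \<open>simp_all add: rim_def\<close>)
    next
      case False
      show ?thesis
      proof (cases "y = Suc (snd s)")
        case True
        have "x = fst s"
        proof (rule ccontr)
          assume "x \<noteq> fst s"
          then have "(Suc x, y) \<in> D" using xs True by (intro down_closedD[OF S(4) right]) simp
          then show False using False by simp
        qed
        then show ?thesis using ribbon.start[of "Tableau D P" "fst s" "snd s"] sps right un True by simp
      next
        case y: False
        then obtain y0 where y0: "y = Suc y0" "snd s < y0" using xy(4) by (cases y) auto
        have "(x, y0) \<in> D" using y0 by (intro down_closedD[OF S(4) xy(1)]) simp
        then have "(x, y0) \<in> rim_part D s t" using False xy y0 by (simp add: rim_part_def rim_def)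
        then have "(x, y0) \<in> ribbon (Tableau D P)" using less(1)[of x y0] y0 by simp
        then show ?thesis unfolding y0(1)
          by (rule ribbon.step_right) (use xy un y0 in \<open>simp_all add: rim_def\<close>)
      qed
    qed
  qed
  then show "rim_part D s t \<subseteq> ribbon (Tableau D P)" by auto
qed

section \<open>Removing the special point\<close>

locale tableau_step =
  fixes k l :: nat and P D :: "cell set" and s :: cell
  assumes sh: "shape k l P D" and special: "is_special P D s" and large: "card P \<noteq> 1"
begin

lemmas S = shapeD[OF sh]
lemmas sp = is_specialD[OF special]

lemma s_not_root: "s \<noteq> (0, 0)"
proof
  assume s: "s = (0, 0)"
  have "q = s" if "q \<in> P" for q
    by (rule is_special_max[OF sh special that]) (simp add: s less_eq_prod_def)
  then have "P = {s}" using sp(1) by blast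
  then show False using large by simp
qed

sublocale maximal_point k l P s
  by unfold_locales (use S(1) sp(1) s_not_root is_special_max[OF sh special] in \<open>blast+\<close>)

definition rib :: "cell set" where "rib = ribbon (Tableau D P)"
definition E :: "cell set" where "E = D - rib"
definition D' :: "cell set" where "D' = opn -` E"

lemma rib_cases:
  obtains "(fst s, Suc (snd s)) \<notin> D" "rib = {}"
  | t where "(fst s, Suc (snd s)) \<in> D" "ribbon_end P D s t" "rib = rim_part D s t"
  unfolding rib_def using ribbon_empty[OF sh special] ribbon_end_exists[OF sh special] ribbon_eq[OF sh special] by metis

lemma rib_unpointed: "c \<in> rib \<Longrightarrow> c \<notin> P"
  using rim_part_unpointed by (cases rule: rib_cases) auto

text \<open>Within the diagram, every cell weakly south-east of a ribbon cell is again a rim cell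
  below \<open>t\<close> and right of \<open>s\<close>, so the ribbon is closed towards the
  south-east.\<close>

lemma E_down: "down_closed E"
  unfolding down_closed_def
proof (intro allI impI)
  fix p q assume pq: "p \<le> q" "q \<in> E"
  have pD: "p \<in> D" using pq S(4) by (auto simp: E_def intro: down_closedD)
  have "p \<notin> rib"
  proof
    assume p: "p \<in> rib"
    show False
    proof (cases rule: rib_cases)
      case (2 t)
      have le: "fst p \<le> fst q" "snd p \<le> snd q" using pq(1) by (auto simp: less_eq_prod_def)
      have pr: "(Suc (fst p), Suc (snd p)) \<notin> D" "fst t < fst p" "snd s < snd p"
        using p 2(3) by (auto simp: rim_part_def rim_def)
      have "(Suc (fst q), Suc (snd q)) \<notin> D"
        using down_closedD[OF S(4), of "(Suc (fst q), Suc (snd q))" "(Suc (fst p), Suc (snd p))"] pr(1) le by auto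
      moreover have "q \<in> D" using pq(2) by (simp add: E_def)
      ultimately have "q \<in> rib" using pr le unfolding 2(3) by (cases q) (simp add: rim_part_def rim_def)
      then show False using pq(2) by (simp add: E_def)
    qed (use p in simp)
  qed
  then show "p \<in> E" using pD by (simp add: E_def)
qed

lemma PE: "P \<subseteq> E"
  using S(2) rib_unpointed by (auto simp: E_def)

lemma below_s: "c \<le> s \<Longrightarrow> c \<in> E"
  using PE sp(1) by (blast intro: down_closedD[OF E_down])

text \<open>Below \<open>s\<close> there is nothing, and the rest of its row to the right consists
  of ribbon cells. So after removal of the ribbon the deleted line ends at \<open>s\<close>, and it
  can be restored from \<open>s\<close> alone.\<close>

lemma E_line: assumes "c \<in> E" "c \<notin> range opn" shows "c \<le> s"
proof (rule ccontr)
  assume "\<not> c \<le> s"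
  then have sc: "s \<le> c" "\<not> c \<le> s" using not_reopen_comparable[OF assms(2)] by auto
  then have le: "fst s \<le> fst c" "snd s \<le> snd c" by (auto simp: less_eq_prod_def)
  have cD: "c \<in> D" using assms(1) by (simp add: E_def)
  have row: "fst c = fst s"
  proof (rule ccontr)
    assume "fst c \<noteq> fst s"
    then have "(Suc (fst s), snd s) \<in> D"
      by (intro down_closedD[OF S(4) cD]) (use le in \<open>simp add: less_eq_prod_def\<close>)
    then show False using sp(2) by simp
  qed
  then have col: "snd s < snd c" using sc by (auto simp: less_eq_prod_def)
  have right: "(fst s, Suc (snd s)) \<in> D"
    by (intro down_closedD[OF S(4) cD]) (use row col in \<open>simp add: less_eq_prod_def\<close>)
  have "(Suc (fst s), Suc (snd c)) \<notin> D"
    using down_closedD[OF S(4), of "(Suc (fst s), Suc (snd c))" "(Suc (fst s), snd s)"] sp(2) col by auto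
  then have "c \<in> rib"
    using right cD row col by (cases rule: rib_cases; cases c) (auto simp: rim_part_def rim_def dest: ribbon_endD(2))
  then show False using assms(1) by (simp add: E_def)
qed

lemma E_eq: "E = reopen P s ` D' \<union> {..s}"
proof
  show "E \<subseteq> opn ` D' \<union> {..s}"
  proof
    fix c assume c: "c \<in> E"
    show "c \<in> opn ` D' \<union> {..s}"
    proof (cases "c \<in> range opn")
      case True
      then show ?thesis using c by (auto simp: D'_def)
    next
      case False
      then show ?thesis using E_line[OF c] by simp
    qed
  qed
  show "opn ` D' \<union> {..s} \<subseteq> E" using below_s by (auto simp: D'_def)
qed

lemma P'D': "P' \<subseteq> D'"
  using PE by (auto simp: P'_def D'_def)

lemma shape': "shape k' l' P' D'"
  unfolding shape_def
proof (intro conjI)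
  show "baxter_points k' l' P'" by (rule points')
  show "P' \<subseteq> D'" by (rule P'D')
  show "D' \<subseteq> {..<k'} \<times> {..<l'}"
  proof
    fix c assume "c \<in> D'"
    then have "opn c \<in> {..<k} \<times> {..<l}" using S(3) by (auto simp: D'_def E_def)
    then show "c \<in> {..<k'} \<times> {..<l'}" using f_bound g_bound by (auto simp: mem_Times_iff)
  qed
  show "down_closed D'" unfolding down_closed_def D'_def
    using down_closedD[OF E_down] by (metis vimageI2 vimageE reopen_le vimage_eq)
qed

lemma deleted_line_eq: "deleted_line (Tableau D P) = {c \<in> D. c \<notin> range opn}"
  unfolding deleted_line_def Let_def special_point_eq[OF sh special] point_above_iff
  by (auto simp: reopen_range)

lemma close_gap_opn: "close_gap (Tableau D P) (opn c) = c"
  unfolding close_gap_def Let_def special_point_eq[OF sh special] point_above_iff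
  by (cases c) (auto simp: reopen_def row_open_def col_open_def gap_def)

lemma close_gap_image: "close_gap (Tableau D P) ` (A \<inter> range opn) = opn -` A"
proof
  show "close_gap (Tableau D P) ` (A \<inter> range opn) \<subseteq> opn -` A" using close_gap_opn by auto
  show "opn -` A \<subseteq> close_gap (Tableau D P) ` (A \<inter> range opn)"
  proof
    fix c assume "c \<in> opn -` A"
    then have "close_gap (Tableau D P) (opn c) \<in> close_gap (Tableau D P) ` (A \<inter> range opn)" by (intro imageI) auto
    then show "c \<in> close_gap (Tableau D P) ` (A \<inter> range opn)" by (simp add: close_gap_opn)
  qed
qed

lemma remove_special_eq: "remove_special (Tableau D P) = Tableau D' P'"
proof -
  have 1: "D - deleted_line (Tableau D P) - ribbon (Tableau D P) = E \<inter> range opn"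
    unfolding deleted_line_eq E_def rib_def by blast
  have 2: "P \<inter> (E \<inter> range opn) = P \<inter> range opn" using PE by blast
  show ?thesis unfolding remove_special_def Let_def tableau.sel 1 2 close_gap_image D'_def P'_def ..
qed

lemma card_P'_pos: "0 < card P'"
  using card_P' large by simp

lemma insertion_label_special: "insertion_label (Tableau D P) s = card P"
proof -
  obtain n where "card P' = Suc n" using card_P'_pos by (metis gr0_implies_Suc)
  then show ?thesis unfolding insertion_label_def tableau_size_def tableau.sel card_P'
    by (simp add: special_point_eq[OF sh special])
qed

lemma insertion_label_opn: "insertion_label (Tableau D P) (opn c) = insertion_label (Tableau D' P') c"
proof -
  obtain n where "card P' = Suc n" using card_P'_pos by (metis gr0_implies_Suc)
  moreover have "opn c \<noteq> s" using reopen_self by (metis rangeI)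
  ultimately show ?thesis unfolding insertion_label_def tableau_size_def tableau.sel card_P'
    by (simp add: special_point_eq[OF sh special] remove_special_eq close_gap_opn)
qed

text \<open>The last ribbon cell is the one below \<open>t\<close>, so its removal leaves
  \<open>t\<close> lowest in its column. In columns right of \<open>t\<close> the diagram has no
  cell below the row of \<open>t\<close>, hence no ribbon; a point lowest there afterwards was
  lowest before and would lie right of \<open>s\<close>.\<close>

lemma ribbon_end_special:
  assumes t: "ribbon_end P D s t" and right: "(fst s, Suc (snd s)) \<in> D"
  obtains s' where "is_special P' D' s'" "opn s' = t"
proof -
  note te = ribbon_endD[OF t]
  have rib: "rib = rim_part D s t" unfolding rib_def by (rule ribbon_eq[OF sh special right t])
  have "t \<noteq> s" using te(2) by auto
  then obtain s' where s': "s' \<in> P'" "t = opn s'" by (rule other_obtain[OF te(1)])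
  have tE: "(Suc (fst t), snd t) \<notin> E"
    using te(3-5) down_closedD[OF S(4), of "(Suc (Suc (fst t)), Suc (snd t))" "(Suc (fst t), Suc (snd t))"]
    by (auto simp: E_def rib rim_part_def rim_def)
  have "is_special P' D' s'" unfolding is_special_def
  proof (intro conjI allI impI)
    show "s' \<in> P'" by (rule s')
    show "(Suc (fst s'), snd s') \<notin> D'"
    proof
      assume "(Suc (fst s'), snd s') \<in> D'"
      then have "opn (Suc (fst s'), snd s') \<in> E" by (simp add: D'_def)
      moreover have "(Suc (fst t), snd t) \<le> opn (Suc (fst s'), snd s')"
        using s'(2) by (simp add: less_eq_prod_def Suc_le_eq)
      ultimately show False using tE down_closedD[OF E_down] by blast
    qed
    fix i j assume ij: "(i, j) \<in> P'" "(Suc i, j) \<notin> D'"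
    show "j \<le> snd s'"
    proof (rule ccontr)
      assume "\<not> j \<le> snd s'"
      then have gj: "snd t < g j" using s'(2) by simp
      have q: "(f i, g j) \<in> P" using ij(1) by (simp add: P'_def reopen_def)
      have corner: False if "(Suc (fst t), g j) \<in> D"
        using down_closedD[OF S(4) that, of "(Suc (fst t), Suc (snd t))"] te(5) gj by auto
      have "(Suc (f i), g j) \<notin> D"
      proof
        assume D: "(Suc (f i), g j) \<in> D"
        \<comment> \<open>The cell below may be the one in the deleted row of \<open>s\<close>; it
          is then absent for another reason, since that row is below \<open>t\<close>.\<close>
        consider "f (Suc i) = Suc (f i)" | "Suc (f i) = fst s" using row_open_Suc by blast
        then show False
        proof cases
          case 1
          then have "(Suc (f i), g j) \<notin> E" using ij(2) by (simp add: D'_def reopen_def)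
          then have "fst t < Suc (f i)" using D by (auto simp: E_def rib rim_part_def)
          then show False using corner down_closedD[OF S(4) D] by auto
        next
          case 2
          then show False using corner down_closedD[OF S(4) D] te(2) by auto
        qed
      qed
      then show False using sp(3)[OF q] gj te(3) by simp
    qed
  qed
  then show ?thesis using that s'(2) by blast
qed

text \<open>The counterpart of \<open>ribbon_end_special\<close>: together they show that the
  horizontal position of the next special point relative to \<open>s\<close> tells whether there was
  a ribbon.\<close>

lemma no_ribbon_special:
  assumes right: "(fst s, Suc (snd s)) \<notin> D" and s': "is_special P' D' s'"
  shows "snd (opn s') \<le> snd s"
proof (rule ccontr)
  assume "\<not> ?thesis"
  then have gj: "snd s < g (snd s')" by simp
  have ED: "E = D" using right unfolding E_def by (cases rule: rib_cases) auto
  have q: "(f (fst s'), g (snd s')) \<in> P" using is_specialD(1)[OF s'] by (simp add: P'_def reopen_def)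
  have "(Suc (f (fst s')), g (snd s')) \<notin> D"
  proof
    assume D: "(Suc (f (fst s')), g (snd s')) \<in> D"
    consider "f (Suc (fst s')) = Suc (f (fst s'))" | "Suc (f (fst s')) = fst s" using row_open_Suc by blast
    then show False
    proof cases
      case 1
      then show False using is_specialD(2)[OF s'] D by (simp add: D'_def reopen_def ED)
    next
      case 2
      then show False using right down_closedD[OF S(4) D, of "(fst s, Suc (snd s))"] gj by auto
    qed
  qed
  then show False using sp(3)[OF q] gj by simp
qed

text \<open>A ribbon pushes the border one diagonal step outwards between \<open>t\<close> and
  \<open>s\<close>. The set may also contain cells of \<open>E\<close>, which is harmless in a
  union, and it is empty when \<open>t\<close> is not to the right of \<open>s\<close>.\<close>

definition added_ribbon :: "cell \<Rightarrow> cell set" where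
  "added_ribbon t = {(x, y). fst t < x \<and> x \<le> fst s \<and> snd s < y \<and> y \<le> snd t \<and> (x - 1, y - 1) \<in> E}"

lemma D_eq:
  assumes s': "is_special P' D' s'"
  shows "D = E \<union> added_ribbon (opn s')"
proof (cases rule: rib_cases)
  case 1
  then show ?thesis using no_ribbon_special[OF 1(1) s'] by (auto simp: E_def added_ribbon_def)
next
  case (2 t)
  note te = ribbon_endD[OF 2(2)]
  obtain s2 where s2: "is_special P' D' s2" "opn s2 = t" by (rule ribbon_end_special[OF 2(2,1)])
  then have ts: "opn s' = t" using is_special_unique[OF shape' s' s2(1)] by simp
  show ?thesis unfolding ts
  proof
    show "D \<subseteq> E \<union> added_ribbon t"
    proof
      fix c assume c: "c \<in> D"
      obtain x y where xy: "c = (x, y)" by (cases c)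
      show "c \<in> E \<union> added_ribbon t"
      proof (cases "c \<in> rib")
        case True
        then have r: "(Suc x, Suc y) \<notin> D" "fst t < x" "snd s < y" by (auto simp: 2(3) xy rim_part_def rim_def)
        have "x \<le> fst s"
        proof (rule ccontr)
          assume "\<not> ?thesis"
          then have "(Suc (fst s), snd s) \<in> D" using r by (intro down_closedD[OF S(4) c]) (simp add: xy)
          then show False using sp(2) by simp
        qed
        moreover have "y \<le> snd t"
        proof (rule ccontr)
          assume "\<not> ?thesis"
          then have "(Suc (fst t), Suc (snd t)) \<in> D" using r by (intro down_closedD[OF S(4) c]) (simp add: xy)
          then show False using te(5) by simp
        qed
        moreover have "(x - 1, y - 1) \<in> E"
        proof -
          have "(x - 1, y - 1) \<in> D" by (intro down_closedD[OF S(4) c]) (simp add: xy)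
          moreover have "(x - 1, y - 1) \<notin> rib" using r c by (simp add: 2(3) xy rim_part_def rim_def)
          ultimately show ?thesis by (simp add: E_def)
        qed
        ultimately show ?thesis using r by (simp add: added_ribbon_def xy)
      qed (use c in \<open>simp add: E_def\<close>)
    qed
    show "E \<union> added_ribbon t \<subseteq> D"
    proof
      fix c assume "c \<in> E \<union> added_ribbon t"
      then show "c \<in> D"
      proof
        assume "c \<in> added_ribbon t"
        then obtain x y where xy: "c = (x, y)" and b: "fst t < x" "x \<le> fst s" "snd s < y" "y \<le> snd t" "(x - 1, y - 1) \<in> E"
          by (auto simp: added_ribbon_def)
        obtain x0 y0 where x0: "x = Suc x0" "y = Suc y0" using b by (metis less_nat_zero_code not0_implies_Suc)
        \<comment> \<open>In the first row below \<open>t\<close> and the first column right of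
          \<open>s\<close> the cell is dominated by an end of the ribbon. Elsewhere its north-west
          neighbour survived the removal, so that neighbour was not a rim cell.\<close>
        consider "x0 = fst t" | "y0 = snd s" | "fst t < x0" "snd s < y0" using b x0 by linarith
        then show "c \<in> D"
        proof cases
          case 1
          then show ?thesis using b x0 by (intro down_closedD[OF S(4) te(4)]) (simp add: xy)
        next
          case 2
          then show ?thesis using b x0 by (intro down_closedD[OF S(4) \<open>(fst s, Suc (snd s)) \<in> D\<close>]) (simp add: xy)
        next
          case 3
          have "(x0, y0) \<in> E" using b(5) x0 by simp
          then show ?thesis using 3 x0 by (simp add: E_def 2 xy rim_part_def rim_def)
        qed
      qed (simp add: E_def)
    qed
  qed
qed

end

section \<open>The insertion labeling\<close>

text \<open>Both conditions concern consecutive labels whose points \<open>p\<close>, \<open>q\<close> lie strictly south-west and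
  north-east of each other: \<open>q\<close> then stops the ribbon of \<open>p\<close>, whose cells are crossings. A crossing
  cell bars its row and its column from further insertions.\<close>

definition blocked_pair :: "cell set \<Rightarrow> cell set \<Rightarrow> cell \<Rightarrow> cell \<Rightarrow> bool" where
  "blocked_pair P D p q \<longleftrightarrow>
     (\<forall>i y. (i, y) \<in> P \<longrightarrow> i \<le> fst p \<longrightarrow> snd p < y \<longrightarrow> y \<le> snd q \<longrightarrow>
        (\<exists>x. fst q < x \<and> x \<le> fst p \<and> (x, y) \<in> D \<and> crossing P (x, y))) \<and>
     (\<forall>x j. (x, j) \<in> P \<longrightarrow> j \<le> snd q \<longrightarrow> fst q < x \<longrightarrow> x \<le> fst p \<longrightarrow>
        (\<exists>y. snd p < y \<and> y \<le> snd q \<and> (x, y) \<in> D \<and> crossing P (x, y)))"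

definition blocked :: "cell set \<Rightarrow> cell set \<Rightarrow> (cell \<Rightarrow> nat) \<Rightarrow> bool" where
  "blocked P D lab \<longleftrightarrow>
     (\<forall>p\<in>P. \<forall>q\<in>P. lab p = Suc (lab q) \<longrightarrow> fst q < fst p \<longrightarrow> snd p < snd q \<longrightarrow> blocked_pair P D p q)"

definition covered :: "cell set \<Rightarrow> cell set \<Rightarrow> (cell \<Rightarrow> nat) \<Rightarrow> bool" where
  "covered P D lab \<longleftrightarrow>
     (\<forall>x y. (x, y) \<in> D \<longrightarrow> crossing P (x, y) \<longrightarrow>
        (\<exists>p\<in>P. \<exists>q\<in>P. lab p = Suc (lab q) \<and> fst q < x \<and> x \<le> fst p \<and> snd p < y \<and> y \<le> snd q))"

lemma blockedD:
  assumes "blocked P D lab" "p \<in> P" "q \<in> P" "lab p = Suc (lab q)" "fst q < fst p" "snd p < snd q"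
  shows "(i, y) \<in> P \<Longrightarrow> i \<le> fst p \<Longrightarrow> snd p < y \<Longrightarrow> y \<le> snd q \<Longrightarrow>
      \<exists>x. fst q < x \<and> x \<le> fst p \<and> (x, y) \<in> D \<and> crossing P (x, y)"
    and "(x, j) \<in> P \<Longrightarrow> j \<le> snd q \<Longrightarrow> fst q < x \<Longrightarrow> x \<le> fst p \<Longrightarrow>
      \<exists>y. snd p < y \<and> y \<le> snd q \<and> (x, y) \<in> D \<and> crossing P (x, y)"
  using assms(1)[unfolded blocked_def, rule_format, OF assms(2-6)] unfolding blocked_pair_def by blast+

lemma coveredD:
  assumes "covered P D lab" "(x, y) \<in> D" "crossing P (x, y)"
  obtains p q where "p \<in> P" "q \<in> P" "lab p = Suc (lab q)" "fst q < x" "x \<le> fst p" "snd p < y" "y \<le> snd q"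
  using assms unfolding covered_def by blast

section \<open>Invariants of one insertion step\<close>

context tableau_step
begin

abbreviation "lab \<equiv> insertion_label (Tableau D P)"
abbreviation "lab' \<equiv> insertion_label (Tableau D' P')"

lemma linext_step: "linext P' lab' \<Longrightarrow> linext P lab"
  by (rule linext_opnI[OF _ insertion_label_special insertion_label_opn])

text \<open>Row and column of the cell each contain a point. If it lay beyond the ribbon cell, it
  would be below \<open>t\<close> and right of \<open>s\<close> and hence not a rim cell, so its
  south-east neighbour would be in the diagram and the ribbon cell would not lie on the rim.\<close>

lemma ribbon_cell_crossing:
  assumes t: "ribbon_end P D s t" "rib = rim_part D s t" and c: "(x, y) \<in> rib"
  shows "crossing P (x, y)"
proof -
  note te = ribbon_endD[OF t(1)]
  have r: "(x, y) \<in> D" "(Suc x, Suc y) \<notin> D" "fst t < x" "snd s < y"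
    using c by (auto simp: t(2) rim_part_def rim_def)
  have xy: "(x, y) \<notin> P" by (rule rib_unpointed[OF c])
  have bd: "x < k" "y < l" using r(1) S(3) by auto
  obtain j where j: "(x, j) \<in> P" by (rule baxter_points_row[OF S(1) bd(1)])
  obtain i where i: "(i, y) \<in> P" by (rule baxter_points_col[OF S(1) bd(2)])
  have "j < y"
  proof (rule ccontr)
    assume "\<not> j < y"
    then have "y < j" using j xy by (metis nat_neq_iff)
    then have "(Suc x, Suc y) \<in> D"
      using te(6)[OF j r(3)] r(4) by (auto intro: down_closedD[OF S(4)])
    then show False using r(2) by simp
  qed
  moreover have "i < x"
  proof (rule ccontr)
    assume "\<not> i < x"
    then have "x < i" using i xy by (metis nat_neq_iff)
    then have "(Suc x, Suc y) \<in> D"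
      using te(6)[OF i _ r(4)] r(3) by (auto intro: down_closedD[OF S(4)])
    then show False using r(2) by simp
  qed
  ultimately show ?thesis unfolding crossing_def
    using i j by (intro conjI has_aboveI[of i] has_leftI[of _ j]) simp_all
qed

lemma second_special:
  assumes lin: "linext P' lab'" and q: "q \<in> P" "lab s = Suc (lab q)"
  obtains q' where "q' \<in> P'" "q = opn q'" "lab' q' = card P'"
proof -
  have "q \<noteq> s" using q(2) by auto
  then obtain q' where q': "q' \<in> P'" "q = opn q'" by (rule other_obtain[OF q(1)])
  then have "lab' q' = card P'" using q(2) insertion_label_special insertion_label_opn card_P' by simp
  then show ?thesis using that q' by blast
qed

lemma row_above_s: "(x, y) \<in> E \<Longrightarrow> x = fst s \<Longrightarrow> y \<le> snd s"
proof -
  assume E: "(x, y) \<in> E" "x = fst s"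
  show ?thesis
  proof (cases rule: rib_cases)
    case 1
    then show ?thesis using E down_closedD[OF S(4), of "(x, y)" "(fst s, Suc (snd s))"]
      by (metis (no_types, lifting) DiffD1 E_def Pair_le S(4) down_closedD not_less_eq_eq order_refl)
  next
    case (2 t)
    show ?thesis
    proof (rule ccontr)
      assume "\<not> ?thesis"
      moreover have "(Suc x, Suc y) \<notin> D"
        using down_closedD[OF S(4), of "(Suc x, Suc y)" "(Suc (fst s), snd s)"] sp(2) E calculation by auto
      ultimately have "(x, y) \<in> rib"
        using E ribbon_endD(2)[OF 2(2)] by (auto simp: 2(3) rim_part_def rim_def E_def)
      then show False using E by (simp add: E_def)
    qed
  qed
qed

lemma col_left_s: "(x, y) \<in> E \<Longrightarrow> y = snd s \<Longrightarrow> x \<le> fst s"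
  using down_closedD[OF S(4), of "(x, y)" "(Suc (fst s), snd s)"] sp(2)
  by (metis DiffD1 E_def Pair_le not_less_eq_eq order_refl)

text \<open>A crossing in the ribbon lies between \<open>s\<close> and the point \<open>t\<close>
  where the ribbon ends, and \<open>t\<close> carries the preceding label. Any other crossing comes
  from the smaller tableau.\<close>

lemma covered_step:
  assumes lin: "linext P' lab'" and IH: "covered P' D' lab'"
    and IHs: "\<And>s'. is_special P' D' s' \<Longrightarrow> lab' s' = card P'"
  shows "covered P D lab"
  unfolding covered_def
proof (intro allI impI)
  fix x y assume xy: "(x, y) \<in> D" "crossing P (x, y)"
  show "\<exists>p\<in>P. \<exists>q\<in>P. lab p = Suc (lab q) \<and> fst q < x \<and> x \<le> fst p \<and> snd p < y \<and> y \<le> snd q"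
  proof (cases "(x, y) \<in> rib")
    case True
    then show ?thesis
    proof (cases rule: rib_cases)
      case (2 t)
      note te = ribbon_endD[OF 2(2)]
      obtain s' where s': "is_special P' D' s'" "opn s' = t" by (rule ribbon_end_special[OF 2(2,1)])
      have "lab s = Suc (lab t)"
        using IHs[OF s'(1)] s'(2) insertion_label_special insertion_label_opn[of s'] card_P' by simp
      moreover have "fst t < x" "snd s < y" using True by (auto simp: 2(3) rim_part_def)
      moreover have "x \<le> fst s" "y \<le> snd t"
      proof -
        show "x \<le> fst s"
        proof (rule ccontr)
          assume "\<not> ?thesis"
          then have "(Suc (fst s), snd s) \<in> D" using \<open>snd s < y\<close> by (intro down_closedD[OF S(4) xy(1)]) simp
          then show False using sp(2) by simp
        qed
        show "y \<le> snd t"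
        proof (rule ccontr)
          assume "\<not> ?thesis"
          then have "(Suc (fst t), Suc (snd t)) \<in> D" using \<open>fst t < x\<close> by (intro down_closedD[OF S(4) xy(1)]) simp
          then show False using te(5) by simp
        qed
      qed
      ultimately show ?thesis using sp(1) te(1) by blast
    qed (use True in simp)
  next
    case False
    then have xyE: "(x, y) \<in> E" using xy(1) by (simp add: E_def)
    \<comment> \<open>On the deleted line remaining cells come before \<open>s\<close>, but a
      crossing has no point at or after it in its row or column.\<close>
    have "(x, y) \<in> range opn"
    proof (rule ccontr)
      assume "(x, y) \<notin> range opn"
      then have le: "x \<le> fst s" "y \<le> snd s" and
        r: "has_above P s \<Longrightarrow> x = fst s" "\<not> has_above P s \<Longrightarrow> y = snd s"
        using E_line[OF xyE] by (auto simp: less_eq_prod_def reopen_range split: if_splits)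
      show False
      proof (cases "has_above P s")
        case True
        then have "(x, snd s) \<in> P" using r(1) sp(1) by simp
        then show False using crossing_row[OF S(1) xy(2)] le by fastforce
      next
        case False
        then have "(fst s, y) \<in> P" using r(2) sp(1) by simp
        then show False using crossing_col[OF S(1) xy(2)] le by fastforce
      qed
    qed
    then obtain c where c: "(x, y) = opn c" by blast
    have "c \<in> D'" using xyE c by (simp add: D'_def)
    moreover have "crossing P' c" using crossing_opn xy(2) c by simp
    ultimately obtain p q where pq: "p \<in> P'" "q \<in> P'" "lab' p = Suc (lab' q)" "fst q < fst c" "fst c \<le> fst p"
      "snd p < snd c" "snd c \<le> snd q"
      by (metis coveredD[OF IH] prod.collapse)
    have "x = f (fst c)" "y = g (snd c)" using c by (auto simp: reopen_def)
    then show ?thesis using pq insertion_label_opn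
      by (intro bexI[of _ "opn p"] bexI[of _ "opn q"]) (simp_all add: P'_def)
  qed
qed

text \<open>For the pair ending in \<open>s\<close> the crossings are the cells of the new ribbon.
  Older pairs keep their crossings, and the only new danger is that \<open>s\<close> itself enters
  one of the rows or columns concerned.\<close>

lemma blocked_step:
  assumes lin: "linext P' lab'" and IH: "blocked P' D' lab'"
    and IHs: "\<And>s'. is_special P' D' s' \<Longrightarrow> lab' s' = card P'"
  shows "blocked P D lab"
proof -
  have new: "blocked_pair P D s q"
    if q: "q \<in> P" "lab s = Suc (lab q)" "fst q < fst s" "snd s < snd q" for q
  proof -
    obtain q' where q': "q' \<in> P'" "q = opn q'" "lab' q' = card P'" by (rule second_special[OF lin q(1,2)])
    obtain s' where s': "is_special P' D' s'" by (rule is_special_exists[OF shape'])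
    have "s' = q'" using linext_inj[OF lin is_specialD(1)[OF s'] q'(1)] IHs[OF s'] q'(3) by simp
    then have sq: "is_special P' D' q'" using s' by simp
    \<comment> \<open>The point \<open>q\<close> is the special point of the smaller tableau and
      lies right of \<open>s\<close>, which excludes an empty ribbon. The ribbon then ends at
      \<open>q\<close>.\<close>
    have right: "(fst s, Suc (snd s)) \<in> D"
      using no_ribbon_special[OF _ sq] q'(2) q(4) by fastforce
    obtain t where t: "ribbon_end P D s t" "rib = rim_part D s t"
      using right by (cases rule: rib_cases) blast+
    obtain s2 where "is_special P' D' s2" "opn s2 = t" by (rule ribbon_end_special[OF t(1) right])
    then have tq: "t = q" using is_special_unique[OF shape' sq] q'(2) by blast
    note te = ribbon_endD[OF t(1), unfolded tq]
    have ribI: "(x, y) \<in> rib" if "(x, y) \<in> D" "(Suc x, Suc y) \<notin> D" "fst q < x" "snd s < y" for x y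
      using that by (simp add: t(2) tq rim_part_def rim_def)
    have fin: "finite {x. (x, y) \<in> D}" "finite {y. (x, y) \<in> D}" for x y
      using finite_subset[of "{x. (x, y) \<in> D}" "fst ` D"] finite_subset[of "{y. (x, y) \<in> D}" "snd ` D"] S(5)
      by force+
    have c1: "\<exists>x. fst q < x \<and> x \<le> fst s \<and> (x, y) \<in> D \<and> crossing P (x, y)" if y: "snd s < y" "y \<le> snd q" for y
    proof -
      \<comment> \<open>The lowest cell of the column is a rim cell below the row of
        \<open>q\<close>, hence in the ribbon and a crossing; for rows the last cell is taken in the
        same way.\<close>
      define x where "x = Max {x. (x, y) \<in> D}"
      have q1: "(Suc (fst q), y) \<in> D" by (rule down_closedD[OF S(4) te(4)]) (use y in simp)
      then have xD: "(x, y) \<in> D" using Max_in[OF fin(1), of y] unfolding x_def by blast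
      have "Suc (fst q) \<le> x" unfolding x_def using q1 by (intro Max_ge[OF fin(1)]) simp
      moreover have "(Suc x, y) \<notin> D" using Max_ge[OF fin(1), of "Suc x" y] unfolding x_def by auto
      then have "(Suc x, Suc y) \<notin> D" using down_closedD[OF S(4), of "(Suc x, Suc y)" "(Suc x, y)"] by auto
      ultimately have "(x, y) \<in> rib" using ribI xD y(1) by simp
      moreover have "x \<le> fst s"
      proof (rule ccontr)
        assume "\<not> ?thesis"
        then have "(Suc (fst s), snd s) \<in> D" using y by (intro down_closedD[OF S(4) xD]) simp
        then show False using sp(2) by simp
      qed
      ultimately have "fst q < x \<and> x \<le> fst s \<and> (x, y) \<in> D \<and> crossing P (x, y)"
        using ribbon_cell_crossing[OF t, of x y] xD \<open>Suc (fst q) \<le> x\<close> by simp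
      then show ?thesis by blast
    qed
    have c2: "\<exists>y. snd s < y \<and> y \<le> snd q \<and> (x, y) \<in> D \<and> crossing P (x, y)" if x: "fst q < x" "x \<le> fst s" for x
    proof -
      define y where "y = Max {y. (x, y) \<in> D}"
      have s1: "(x, Suc (snd s)) \<in> D" by (rule down_closedD[OF S(4) right]) (use x in simp)
      then have yD: "(x, y) \<in> D" using Max_in[OF fin(2), of x] unfolding y_def by blast
      have sy: "Suc (snd s) \<le> y" unfolding y_def using s1 by (intro Max_ge[OF fin(2)]) simp
      have "(x, Suc y) \<notin> D" using Max_ge[OF fin(2), of "Suc y" x] unfolding y_def by auto
      then have "(Suc x, Suc y) \<notin> D" using down_closedD[OF S(4), of "(Suc x, Suc y)" "(x, Suc y)"] by auto
      then have "(x, y) \<in> rib" using ribI yD x(1) sy by simp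
      moreover have "y \<le> snd q"
      proof (rule ccontr)
        assume "\<not> ?thesis"
        then have "(Suc (fst q), Suc (snd q)) \<in> D" using x by (intro down_closedD[OF S(4) yD]) simp
        then show False using te(5) by simp
      qed
      ultimately have "snd s < y \<and> y \<le> snd q \<and> (x, y) \<in> D \<and> crossing P (x, y)"
        using ribbon_cell_crossing[OF t, of x y] yD sy by simp
      then show ?thesis by blast
    qed
    show ?thesis unfolding blocked_pair_def using c1 c2 by blast
  qed
  have old: "blocked_pair P D p q"
    if p: "p = opn p'" "p' \<in> P'" and q: "q = opn q'" "q' \<in> P'"
      and pq: "lab p = Suc (lab q)" "fst q < fst p" "snd p < snd q" for p q p' q'
  proof -
    note B = blockedD[OF IH p(2) q(2)]
    have pq': "lab' p' = Suc (lab' q')" "fst q' < fst p'" "snd p' < snd q'"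
      using pq insertion_label_opn by (simp_all add: p(1) q(1))
    have pP: "p \<in> P" "q \<in> P" using p q by (auto simp: P'_def)
    have nle: "\<not> s \<le> p" "\<not> s \<le> q"
      using is_special_max[OF sh special] pP p(1) q(1) reopen_self by (metis rangeI)+
    have lift: "(x, y) \<in> D' \<Longrightarrow> crossing P' (x, y) \<Longrightarrow> (f x, g y) \<in> E \<and> (f x, g y) \<in> D \<and> crossing P (f x, g y)" for x y
      using crossing_opnI[of "(x, y)"] by (simp add: D'_def reopen_def E_def)
    have c1: "\<exists>x. fst q < x \<and> x \<le> fst p \<and> (x, y) \<in> D \<and> crossing P (x, y)"
      if iy: "(i, y) \<in> P" "i \<le> fst p" "snd p < y" "y \<le> snd q" for i y
    proof -
      \<comment> \<open>The condition for the smaller tableau needs a point other than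
        \<open>s\<close>. If \<open>s\<close> has a point above it, that point serves. Otherwise
        \<open>s\<close> has a point to its left, and the condition on rows gives a crossing in the
        row of \<open>s\<close>; it would have to lie right of \<open>s\<close>, where
        \<open>E\<close> has no cell.\<close>
      have "\<exists>i. (i, y) \<in> P \<and> i \<le> fst p \<and> (i, y) \<noteq> s"
      proof (cases "(i, y) = s")
        case True
        then have s: "fst s = i" "snd s = y" by (metis fst_conv, metis snd_conv)
        have "fst q < i" using nle(2) iy(4) s by (auto simp: less_eq_prod_def)
        show ?thesis
        proof (cases "has_above P s")
          case True
          then obtain i2 where "i2 < i" "(i2, y) \<in> P" using s by (auto simp: has_above_def)
          then show ?thesis using iy(2) s by (metis fst_conv less_irrefl less_imp_le order.trans)
        next
          case False
          then have "has_left P s" using s_xor by simp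
          then obtain j where j: "j < y" "(i, j) \<in> P" using s by (auto simp: has_left_def)
          have "(i, j) \<noteq> s" using j(1) s(2) by (metis snd_conv less_irrefl)
          then obtain a where a: "a \<in> P'" "(i, j) = opn a" by (rule other_obtain[OF j(2)])
          then have a': "(fst a, snd a) \<in> P'" "i = f (fst a)" "j = g (snd a)" by (auto simp: reopen_def)
          have "\<exists>y. snd p' < y \<and> y \<le> snd q' \<and> (fst a, y) \<in> D' \<and> crossing P' (fst a, y)"
          proof (rule B(2)[OF pq' a'(1)])
            have "j \<le> snd q" using j(1) iy(4) by simp
            then show "snd a \<le> snd q'" using a'(3) q(1) by simp
            show "fst q' < fst a" "fst a \<le> fst p'" using \<open>fst q < i\<close> iy(2) a'(2) by (simp_all add: p(1) q(1))
          qed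
          then obtain y2 where y2: "(fst a, y2) \<in> D'" "crossing P' (fst a, y2)" by blast
          have L: "(i, g y2) \<in> E" "crossing P (i, g y2)" using lift[OF y2] unfolding a'(2) by blast+
          have "g y2 \<le> snd s" by (rule row_above_s[OF L(1) s(1)[symmetric]])
          moreover have "y < g y2" by (rule crossing_row[OF S(1) L(2) iy(1)])
          ultimately show ?thesis using s(2) by linarith
        qed
      qed (use iy in blast)
      then obtain i0 where i0: "(i0, y) \<in> P" "i0 \<le> fst p" "(i0, y) \<noteq> s" by blast
      obtain a where a: "a \<in> P'" "(i0, y) = opn a" by (rule other_obtain[OF i0(1,3)])
      then have a': "(fst a, snd a) \<in> P'" "i0 = f (fst a)" "y = g (snd a)" by (auto simp: reopen_def)
      have "\<exists>x. fst q' < x \<and> x \<le> fst p' \<and> (x, snd a) \<in> D' \<and> crossing P' (x, snd a)"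
        by (rule B(1)[OF pq' a'(1)]) (use i0(2) iy(3,4) a'(2,3) in \<open>simp_all add: p(1) q(1)\<close>)
      then obtain x where "fst q' < x" "x \<le> fst p'" "(x, snd a) \<in> D'" "crossing P' (x, snd a)" by blast
      then show ?thesis using lift[of x "snd a"] a'(3) by (intro exI[of _ "f x"]) (simp add: p(1) q(1))
    qed
    have c2: "\<exists>y. snd p < y \<and> y \<le> snd q \<and> (x, y) \<in> D \<and> crossing P (x, y)"
      if xj: "(x, j) \<in> P" "j \<le> snd q" "fst q < x" "x \<le> fst p" for x j
    proof -
      have "\<exists>j. (x, j) \<in> P \<and> j \<le> snd q \<and> (x, j) \<noteq> s"
      proof (cases "(x, j) = s")
        case True
        then have s: "fst s = x" "snd s = j" by (metis fst_conv, metis snd_conv)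
        have "snd p < j" using nle(1) xj(4) s by (auto simp: less_eq_prod_def)
        show ?thesis
        proof (cases "has_above P s")
          case False
          then have "has_left P s" using s_xor by simp
          then obtain j2 where "j2 < j" "(x, j2) \<in> P" using s by (auto simp: has_left_def)
          then show ?thesis using xj(2) s by (metis snd_conv less_irrefl less_imp_le order.trans)
        next
          case True
          then obtain i where i: "i < x" "(i, j) \<in> P" using s by (auto simp: has_above_def)
          have "(i, j) \<noteq> s" using i(1) s(1) by (metis fst_conv less_irrefl)
          then obtain a where a: "a \<in> P'" "(i, j) = opn a" by (rule other_obtain[OF i(2)])
          then have a': "(fst a, snd a) \<in> P'" "i = f (fst a)" "j = g (snd a)" by (auto simp: reopen_def)
          have "\<exists>x. fst q' < x \<and> x \<le> fst p' \<and> (x, snd a) \<in> D' \<and> crossing P' (x, snd a)"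
          proof (rule B(1)[OF pq' a'(1)])
            have "i \<le> fst p" using i(1) xj(4) by simp
            then show "fst a \<le> fst p'" using a'(2) p(1) by simp
            show "snd p' < snd a" "snd a \<le> snd q'" using \<open>snd p < j\<close> xj(2) a'(3) by (simp_all add: p(1) q(1))
          qed
          then obtain x2 where x2: "(x2, snd a) \<in> D'" "crossing P' (x2, snd a)" by blast
          have L: "(f x2, j) \<in> E" "crossing P (f x2, j)" using lift[OF x2] unfolding a'(3) by blast+
          have "f x2 \<le> fst s" by (rule col_left_s[OF L(1) s(2)[symmetric]])
          moreover have "x < f x2" by (rule crossing_col[OF S(1) L(2) xj(1)])
          ultimately show ?thesis using s(1) by linarith
        qed
      qed (use xj in blast)
      then obtain j0 where j0: "(x, j0) \<in> P" "j0 \<le> snd q" "(x, j0) \<noteq> s" by blast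
      obtain a where a: "a \<in> P'" "(x, j0) = opn a" by (rule other_obtain[OF j0(1,3)])
      then have a': "(fst a, snd a) \<in> P'" "x = f (fst a)" "j0 = g (snd a)" by (auto simp: reopen_def)
      have "\<exists>y. snd p' < y \<and> y \<le> snd q' \<and> (fst a, y) \<in> D' \<and> crossing P' (fst a, y)"
        by (rule B(2)[OF pq' a'(1)]) (use j0(2) xj(3,4) a'(2,3) in \<open>simp_all add: p(1) q(1)\<close>)
      then obtain y where "snd p' < y" "y \<le> snd q'" "(fst a, y) \<in> D'" "crossing P' (fst a, y)" by blast
      then show ?thesis using lift[of "fst a" y] a'(2) by (intro exI[of _ "g y"]) (simp add: p(1) q(1))
    qed
    show ?thesis unfolding blocked_pair_def using c1 c2 by blast
  qed
  show ?thesis unfolding blocked_def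
  proof (rule ballI, rule ballI, rule impI, rule impI, rule impI)
    fix p q assume pq: "p \<in> P" "q \<in> P" "lab p = Suc (lab q)" "fst q < fst p" "snd p < snd q"
    have "q \<noteq> s"
      using pq(3) linext_range[OF linext_step[OF lin] pq(1)] insertion_label_special by auto
    then obtain q' where q': "q' \<in> P'" "q = opn q'" by (rule other_obtain[OF pq(2)])
    show "blocked_pair P D p q"
    proof (cases "p = s")
      case True
      then show ?thesis using new[OF pq(2)] pq(3-5) by simp
    next
      case False
      then obtain p' where p': "p' \<in> P'" "p = opn p'" by (rule other_obtain[OF pq(1)])
      show ?thesis by (rule old[OF p'(2,1) q'(2,1) pq(3-5)])
    qed
  qed
qed

text \<open>The points \<open>p\<close> and \<open>q\<close> are older than \<open>s\<close>, so the
  only new violation has \<open>v = s\<close>. Then \<open>blocked\<close> gives a crossing in the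
  column of \<open>s\<close>; crossings come after all points of their column, but \<open>s\<close>
  is lowest there.\<close>

lemma greedy_step:
  assumes lin: "linext P' lab'" and IH: "greedy P' lab'" and bl: "blocked P D lab"
  shows "greedy P lab"
  unfolding greedy_def
proof (intro ballI impI notI)
  fix p q v assume *: "p \<in> P" "q \<in> P" "v \<in> P" "lab p = Suc (lab q)" "lab p < lab v" "fst q < fst p" "snd p < snd q"
    "fst q < fst v \<and> fst v \<le> fst p \<and> snd p < snd v \<and> snd v \<le> snd q"
  note linP = linext_step[OF lin]
  have max: "lab x \<le> lab s" if "x \<in> P" for x using linext_range[OF linP that] insertion_label_special by simp
  have "p \<noteq> s" "q \<noteq> s" using max[OF *(3)] *(4,5) by auto
  then obtain p' q' where p': "p' \<in> P'" "p = opn p'" and q': "q' \<in> P'" "q = opn q'"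
    using other_obtain[OF *(1)] other_obtain[OF *(2)] by metis
  show False
  proof (cases "v = s")
    case True
    then obtain x where x: "(x, snd s) \<in> D" "crossing P (x, snd s)"
      using blockedD(1)[OF bl *(1,2,4,6,7), of "fst s" "snd s"] *(8) sp(1) by auto
    have "fst s < x" using crossing_col[OF S(1) x(2), of "fst s"] sp(1) by simp
    then have "(Suc (fst s), snd s) \<in> D" by (intro down_closedD[OF S(4) x(1)]) simp
    then show False using sp(2) by simp
  next
    case False
    then obtain v' where v': "v' \<in> P'" "v = opn v'" by (rule other_obtain[OF *(3)])
    show False
      by (rule greedyD[OF IH p'(1) q'(1) v'(1)]) (use * insertion_label_opn in \<open>simp_all add: p' q' v'\<close>)
  qed
qed

end

lemma single_point:
  assumes "baxter_points k l P" "card P = 1"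
  shows "P = {(0, 0)}" "k = 1" "l = 1"
proof -
  obtain p where "P = {p}" using assms(2) by (rule card_1_singletonE)
  then show P: "P = {(0, 0)}" using baxter_pointsD(3)[OF assms(1)] by simp
  show "k = 1" "l = 1" using baxter_points_card[OF assms(1)] assms(2) by simp_all
qed

lemma insertion_label_single: "card P = 1 \<Longrightarrow> insertion_label (Tableau D P) c = 1"
  by (simp add: insertion_label_def tableau_size_def)

lemma insertion_labeling:
  assumes "shape k l P D"
  shows "linext P (insertion_label (Tableau D P))" "greedy P (insertion_label (Tableau D P))"
    "covered P D (insertion_label (Tableau D P))"
proof -
  \<comment> \<open>The statement is strengthened by \<open>blocked\<close> and by the value at the
    special point. The latter identifies the end of the new ribbon as the point with the second
    largest label.\<close>
  have "linext P (insertion_label (Tableau D P)) \<and> greedy P (insertion_label (Tableau D P)) \<and>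
    blocked P D (insertion_label (Tableau D P)) \<and> covered P D (insertion_label (Tableau D P)) \<and>
    (\<forall>s. is_special P D s \<longrightarrow> insertion_label (Tableau D P) s = card P)"
    using assms
  proof (induction "card P" arbitrary: k l P D rule: less_induct)
    case less
    show ?case
    proof (cases "card P = 1")
      case True
      note single = single_point[OF shapeD(1)[OF less(2)] True]
      have "\<not> crossing P c" for c unfolding single(1) by (auto simp: crossing_def has_above_def has_left_def)
      then show ?thesis unfolding linext_def greedy_def blocked_def covered_def insertion_label_single[OF True]
        by (simp add: single(1) bij_betw_def)
    next
      case False
      obtain s where s: "is_special P D s" by (rule is_special_exists[OF less(2)])
      interpret tableau_step k l P D s using less(2) s False by unfold_locales
      have IH: "linext P' lab' \<and> greedy P' lab' \<and> blocked P' D' lab' \<and> covered P' D' lab' \<and>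
        (\<forall>s. is_special P' D' s \<longrightarrow> lab' s = card P')"
        by (rule less(1)[OF _ shape']) (simp add: card_P')
      have sp: "lab s2 = card P" if "is_special P D s2" for s2
        using is_special_unique[OF sh special that] insertion_label_special by simp
      show ?thesis
        using linext_step covered_step blocked_step greedy_step IH sp by blast
    qed
  qed
  then show "linext P (insertion_label (Tableau D P))" "greedy P (insertion_label (Tableau D P))"
    "covered P D (insertion_label (Tableau D P))" by blast+
qed

text \<open>The largest label locates the special point, and induction gives the smaller diagram.
  \<open>E_eq\<close> restores the deleted line, and \<open>D_eq\<close> restores the ribbon from
  the special point of the smaller diagram.\<close>

lemma insertion_label_determines_diagram:
  assumes "shape k l P D1" "shape k l P D2"
    and "\<And>p. p \<in> P \<Longrightarrow> insertion_label (Tableau D1 P) p = insertion_label (Tableau D2 P) p"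
  shows "D1 = D2"
  using assms
proof (induction "card P" arbitrary: k l P D1 D2 rule: less_induct)
  case less
  show ?case
  proof (cases "card P = 1")
    case True
    note single = single_point[OF shapeD(1)[OF less(2)] True]
    have "D = {(0, 0)}" if "shape k l P D" for D
      using shapeD(2,3)[OF that] single by auto
    from this[OF less(2)] this[OF less(3)] show ?thesis by simp
  next
    case False
    obtain s where s: "is_special P D1 s" by (rule is_special_exists[OF less(2)])
    obtain s2 where s2: "is_special P D2 s2" by (rule is_special_exists[OF less(3)])
    interpret A: tableau_step k l P D1 s using less(2) s False by unfold_locales
    interpret B2: tableau_step k l P D2 s2 using less(3) s2 False by unfold_locales
    have "s2 = s"
      using linext_inj[OF insertion_labeling(1)[OF less(2)] B2.sp(1) A.sp(1)]
        less(4)[OF B2.sp(1)] A.insertion_label_special B2.insertion_label_special by simp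
    then interpret B: tableau_step k l P D2 s using B2.tableau_step_axioms by simp
    have eq: "A.D' = B.D'"
    proof (rule less(1)[OF _ A.shape' B.shape'])
      show "card A.P' < card P" by (simp add: A.card_P')
      show "insertion_label (Tableau A.D' A.P') p = insertion_label (Tableau B.D' A.P') p" if "p \<in> A.P'" for p
        using less(4)[of "reopen P s p"] that A.insertion_label_opn B.insertion_label_opn by (simp add: A.P'_def)
    qed
    then have E: "A.E = B.E" using A.E_eq B.E_eq by simp
    obtain t where t: "is_special A.P' A.D' t" by (rule is_special_exists[OF A.shape'])
    then have "is_special A.P' B.D' t" using eq by simp
    then show ?thesis using A.D_eq[OF t] B.D_eq E by (simp add: A.added_ribbon_def B.added_ribbon_def)
  qed
qed

section \<open>Inserting a maximal point\<close>

locale insertion_step = maximal_point k l P s for k l P s +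
  fixes D' :: "cell set" and lab :: "cell \<Rightarrow> nat" and s' :: cell
  assumes sh': "shape k' l' P' D'" and lin: "linext P lab" and gr: "greedy P lab" and lab_s: "lab s = card P"
    and cov: "covered P' D' (lab \<circ> opn)" and special': "is_special P' D' s'"
begin

lemmas S' = shapeD[OF sh']

definition t :: cell where "t = opn s'"

text \<open>By \<open>E_eq\<close> and \<open>D_eq\<close> this set and the next are the only
  candidates for the diagram before and after adding the ribbon. What has to be checked is that they
  form a tableau whose removal step leads back.\<close>

definition E :: "cell set" where "E = opn ` D' \<union> {..s}"

definition D :: "cell set" where
  "D = E \<union> {(x, y). fst t < x \<and> x \<le> fst s \<and> snd s < y \<and> y \<le> snd t \<and> (x - 1, y - 1) \<in> E}"

lemma DI: "fst t < x \<Longrightarrow> x \<le> fst s \<Longrightarrow> snd s < y \<Longrightarrow> y \<le> snd t \<Longrightarrow> (x - 1, y - 1) \<in> E \<Longrightarrow> (x, y) \<in> D"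
  by (simp add: D_def)

lemma ED: "E \<subseteq> D" by (simp add: D_def)

lemma not_above: "q \<in> P \<Longrightarrow> q \<noteq> s \<Longrightarrow> \<not> s \<le> q"
  using s_max by blast

lemma opn_not_above: "c \<in> P' \<Longrightarrow> \<not> s \<le> opn c"
  using not_above[of "opn c"] reopen_self by (metis P'_iff rangeI)

text \<open>The cell of \<open>D'\<close> with the coordinates of \<open>s\<close> would end up
  directly below or directly right of \<open>s\<close>. If it were a crossing,
  \<open>covered\<close> would place it between points with consecutive labels; then
  \<open>s\<close>, which has the largest label, lies in the box spanned by them, against
  greediness.\<close>

lemma crossing_absurd:
  assumes "(x, y) \<in> D'" "crossing P' (x, y)" and s: "f x = Suc (fst s) \<and> x = fst s \<and> g y = snd s \<or> f x = fst s \<and> g y = Suc (snd s) \<and> y = snd s"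
  shows False
proof -
  obtain p q where pq: "p \<in> P'" "q \<in> P'" "(lab \<circ> opn) p = Suc ((lab \<circ> opn) q)" "fst q < x" "x \<le> fst p" "snd p < y" "y \<le> snd q"
    by (rule coveredD[OF cov assms(1,2)])
  have P: "opn p \<in> P" "opn q \<in> P" using pq(1,2) by (simp_all add: P'_def)
  have "opn p \<noteq> s" using reopen_self by (metis rangeI)
  then have lp: "lab (opn p) < lab s"
    using linext_range[OF lin P(1)] linext_inj[OF lin P(1) s_in] lab_s by fastforce
  have b: "f (fst q) < f x" "f x \<le> f (fst p)" "g (snd p) < g y" "g y \<le> g (snd q)" using pq(4-7) by simp_all
  have r: "f (fst q) < fst s" "snd s \<le> g (snd q)" "fst s \<le> f (fst p)" "g (snd p) < snd s"
  proof -
    have "(fst q < fst s \<and> f (fst q) \<noteq> fst s) \<or> f (fst q) < fst s"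
      using s b(1) pq(4) by (auto simp: row_open_def gap_def split: if_splits)
    then show "f (fst q) < fst s" by (auto simp: row_open_def gap_def split: if_splits)
    have "snd s \<le> g y" "fst s \<le> f x" using s by auto
    then show "snd s \<le> g (snd q)" "fst s \<le> f (fst p)" using b(2,4) by (meson order.trans)+
    show "g (snd p) < snd s"
      using s b(3) pq(6) by (auto simp: col_open_def gap_def split: if_splits)
  qed
  have c: "fst (opn q) < fst (opn p)" "snd (opn p) < snd (opn q)" using pq(4-7) by simp_all
  show False
    by (rule greedyD[OF gr P(1,2) s_in _ lp c]) (use pq(3) r in simp_all)
qed

text \<open>Above and to the left of \<open>s\<close> all cells are present because \<open>P\<close> avoids V and H; there is no cell
  below or to the right of \<open>s\<close> because such a cell would be a crossing, and the labeling is greedy.\<close>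

lemma below_s_in: assumes "opn c \<le> s" shows "c \<in> D'"
proof (cases "has_above P s")
  case True
  then obtain i where i: "i < fst s" "(i, snd s) \<in> P" by (auto simp: has_above_def)
  have fx: "f x = x" if "x < fst s" for x using True that by (simp add: row_open_def gap_def)
  have gx: "g y = y" for y using True by (simp add: col_open_def)
  have iP: "(i, snd s) \<in> P'" using i fx gx by (simp add: P'_iff reopen_def)
  have "fst c < fst s"
    using assms True f_avoids[of "fst c"] by (auto simp: less_eq_prod_def row_open_def gap_def split: if_splits)
  moreover have "snd c \<le> snd s" using assms gx by (simp add: less_eq_prod_def)
  \<comment> \<open>This is the largest of the cells to be found. If it were missing, a point of its
    row would lie left of it and complete V with \<open>s\<close> and the point
    \<open>(i, snd s)\<close> above.\<close>
  moreover have "(fst s - 1, snd s) \<in> D'"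
  proof (rule ccontr)
    assume nD: "(fst s - 1, snd s) \<notin> D'"
    have "i \<noteq> fst s - 1" using nD iP S'(2) by blast
    then have i1: "i < fst s - 1" using i(1) by simp
    have "fst s - 1 < k'" using s_bounds(1) True i(1) by (simp add: k'_def)
    then obtain q where q: "q \<in> P'" "fst q = fst s - 1" by (rule row_other)
    have "snd q < snd s"
    proof (rule ccontr)
      assume n: "\<not> snd q < snd s"
      have "q \<in> D'" using q(1) S'(2) by blast
      then have "(fst s - 1, snd s) \<in> D'"
        by (rule down_closedD[OF S'(4)]) (use n q(2) in \<open>simp add: less_eq_prod_def\<close>)
      then show False using nD by simp
    qed
    moreover have "(fst s - 1, snd q) \<in> P"
      using q fx[of "fst s - 1"] gx i(1) by (simp add: P'_iff reopen_def)
    ultimately show False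
      using baxter_pointsD(6)[OF points i1 _ _ i(2), of "fst s" "snd q"] s_in i(1) by simp
  qed
  ultimately have "(fst s - 1, snd s) \<in> D'" "c \<le> (fst s - 1, snd s)" by (auto simp: less_eq_prod_def)
  then show ?thesis by (rule down_closedD[OF S'(4)])
next
  case False
  then have "has_left P s" using s_xor by simp
  then obtain j where j: "j < snd s" "(fst s, j) \<in> P" by (auto simp: has_left_def)
  have gx: "g y = y" if "y < snd s" for y using False that by (simp add: col_open_def gap_def)
  have fx: "f x = x" for x using False by (simp add: row_open_def)
  have jP: "(fst s, j) \<in> P'" using j fx gx by (simp add: P'_iff reopen_def)
  have "snd c < snd s"
    using assms False g_avoids[of "snd c"] by (auto simp: less_eq_prod_def col_open_def gap_def split: if_splits)
  moreover have "fst c \<le> fst s" using assms fx by (simp add: less_eq_prod_def)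
  moreover have "(fst s, snd s - 1) \<in> D'"
  proof (rule ccontr)
    assume nD: "(fst s, snd s - 1) \<notin> D'"
    have "j \<noteq> snd s - 1" using nD jP S'(2) by blast
    then have j1: "j < snd s - 1" using j(1) by simp
    have "snd s - 1 < l'" using s_bounds(2) False j(1) by (simp add: l'_def)
    then obtain q where q: "q \<in> P'" "snd q = snd s - 1" by (rule col_other)
    have "fst q < fst s"
    proof (rule ccontr)
      assume n: "\<not> fst q < fst s"
      have "q \<in> D'" using q(1) S'(2) by blast
      then have "(fst s, snd s - 1) \<in> D'"
        by (rule down_closedD[OF S'(4)]) (use n q(2) in \<open>simp add: less_eq_prod_def\<close>)
      then show False using nD by simp
    qed
    moreover have "(fst q, snd s - 1) \<in> P"
      using q gx[of "snd s - 1"] fx j(1) by (simp add: P'_iff reopen_def)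
    ultimately show False
      using baxter_pointsD(5)[OF points _ j1 _ _ j(2), of "fst q" "snd s"] s_in j(1) by simp
  qed
  ultimately have "(fst s, snd s - 1) \<in> D'" "c \<le> (fst s, snd s - 1)" by (auto simp: less_eq_prod_def)
  then show ?thesis by (rule down_closedD[OF S'(4)])
qed

lemma above_s_out: assumes "s \<le> opn c" shows "c \<notin> D'"
proof
  assume c: "c \<in> D'"
  have cs: "s \<le> c"
    using assms f_avoids[of "fst c"] g_avoids[of "snd c"]
    by (auto simp: less_eq_prod_def row_open_def col_open_def gap_def split: if_splits)
  have sD: "s \<in> D'" using cs by (rule down_closedD[OF S'(4) c])
  then have bd: "fst s < k'" "snd s < l'" using S'(3) by auto
  obtain a where a: "a \<in> P'" "fst a = fst s" by (rule row_other[OF bd(1)])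
  obtain b where b: "b \<in> P'" "snd b = snd s" by (rule col_other[OF bd(2)])
  \<comment> \<open>The row and the column with the coordinates of \<open>s\<close> contain points
    of \<open>P'\<close>. As these avoid the quadrant of \<open>s\<close> after reopening, one lies
    to the left and one above, and the cell is a crossing of \<open>P'\<close>.\<close>
  have na: "\<not> s \<le> opn a" "\<not> s \<le> opn b" using opn_not_above a(1) b(1) by auto
  have "fst b < fst s"
    using na(2) b(2) by (auto simp: less_eq_prod_def row_open_def col_open_def gap_def split: if_splits)
  moreover have "snd a < snd s"
    using na(1) a(2) by (auto simp: less_eq_prod_def row_open_def col_open_def gap_def split: if_splits)
  moreover have "(fst b, snd s) \<in> P'" "(fst s, snd a) \<in> P'" using a b by (metis prod.collapse)+
  ultimately have "crossing P' s" unfolding crossing_def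
    by (intro conjI has_aboveI[of "fst b"] has_leftI[of _ "snd a"]) simp_all
  then show False using crossing_absurd[of "fst s" "snd s"] sD
    by (cases "has_above P s") (simp_all add: row_open_def col_open_def gap_def)
qed

section \<open>The enlarged diagram and its ribbon\<close>

lemma opn_E: "opn c \<in> E \<longleftrightarrow> c \<in> D'"
proof -
  have "opn c \<in> E \<longleftrightarrow> c \<in> D' \<or> opn c \<le> s" by (simp add: E_def image_iff)
  then show ?thesis using below_s_in[of c] by blast
qed

lemma E_above_s: "c \<in> E \<Longrightarrow> s \<le> c \<Longrightarrow> c = s"
  using above_s_out by (auto simp: E_def)

lemma E_down: "down_closed E"
  unfolding down_closed_def
proof (intro allI impI)
  fix p q assume pq: "p \<le> q" "q \<in> E"
  show "p \<in> E"
  proof (cases "p \<in> range opn")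
    case True
    then obtain p' where p': "p = opn p'" by blast
    show ?thesis
    proof (cases "q \<le> s")
      case True
      then have "p \<le> s" by (rule order.trans[OF pq(1)])
      then show ?thesis by (simp add: E_def)
    next
      case False
      then obtain q' where "q = opn q'" "q' \<in> D'" using pq(2) by (auto simp: E_def)
      then have "p' \<in> D'" using down_closedD[OF S'(4), of q' p'] pq(1) p' by simp
      then show ?thesis by (simp add: p' E_def)
    qed
  next
    case False
    then have "p \<le> s \<or> s \<le> p" by (rule not_reopen_comparable)
    then have "p \<le> s"
    proof
      assume "s \<le> p"
      then have "q = s" using pq E_above_s by (meson order.trans)
      then show ?thesis using pq(1) by simp
    qed
    then show ?thesis by (simp add: E_def)
  qed
qed

lemma PE: "P \<subseteq> E"
proof
  fix q assume q: "q \<in> P"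
  show "q \<in> E"
  proof (cases "q = s")
    case False
    then obtain q' where "q' \<in> P'" "q = opn q'" by (rule other_obtain[OF q])
    then show ?thesis using S'(2) opn_E by blast
  qed (simp add: E_def)
qed

lemma t_in: "t \<in> P" "t \<noteq> s" "t \<in> E"
proof -
  show "t \<in> P" using is_specialD(1)[OF special'] by (simp add: t_def P'_iff)
  then show "t \<in> E" using PE by blast
  show "t \<noteq> s" using reopen_self by (metis rangeI t_def)
qed

lemma E_bounded: "E \<subseteq> {..<k} \<times> {..<l}"
proof
  fix c assume "c \<in> E"
  then consider d where "d \<in> D'" "c = opn d" | "c \<le> s" unfolding E_def by blast
  then show "c \<in> {..<k} \<times> {..<l}"
  proof cases
    case 1
    have "d \<in> {..<k'} \<times> {..<l'}" using 1(1) S'(3) by blast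
    then show ?thesis unfolding 1(2) using f_bound[of "fst d"] g_bound[of "snd d"] by (simp add: mem_Times_iff)
  next
    case 2
    then show ?thesis using s_bounds by (simp add: less_eq_prod_def mem_Times_iff)
  qed
qed

lemma t_bottom: assumes "snd s < snd t" shows "(Suc (fst t), snd t) \<notin> E"
proof
  assume "(Suc (fst t), snd t) \<in> E"
  moreover have "\<not> (Suc (fst t), snd t) \<le> s" using assms by (simp add: less_eq_prod_def)
  ultimately obtain c where c: "(Suc (fst t), snd t) = opn c" "c \<in> D'" unfolding E_def by blast
  then have "Suc (f (fst s')) = f (fst c)" "g (snd s') = g (snd c)" by (simp_all add: t_def reopen_def)
  then have "f (fst s') < f (fst c)" "snd s' = snd c" by (metis lessI, simp)
  then have "(Suc (fst s'), snd s') \<in> D'"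
    by (intro down_closedD[OF S'(4) c(2)]) (simp add: less_eq_prod_def)
  then show False using is_specialD(2)[OF special'] by simp
qed

lemma D_down: "down_closed D"
  unfolding down_closed_def
proof (intro allI impI)
  fix p q assume pq: "p \<le> q" "q \<in> D"
  obtain a b where p: "p = (a, b)" by (cases p)
  obtain x y where q: "q = (x, y)" by (cases q)
  have le: "a \<le> x" "b \<le> y" using pq(1) by (simp_all add: p q)
  show "p \<in> D"
  proof (cases "q \<in> E")
    case True
    then have "p \<in> E" by (rule down_closedD[OF E_down _ pq(1)])
    then show ?thesis using ED by blast
  next
    case False
    then have b: "fst t < x" "x \<le> fst s" "snd s < y" "y \<le> snd t" "(x - 1, y - 1) \<in> E"
      using pq(2) by (auto simp: D_def q)
    \<comment> \<open>A cell that leaves the region of the ribbon to the left is dominated by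
      \<open>s\<close>, one that leaves it upwards is dominated by \<open>t\<close>.\<close>
    consider "b \<le> snd s" | "a \<le> fst t" | "fst t < a" "snd s < b" by linarith
    then show ?thesis
    proof cases
      case 1
      then have "p \<le> s" using le b by (simp add: p less_eq_prod_def)
      then show ?thesis using ED by (auto simp: E_def)
    next
      case 2
      then have "p \<le> t" using le b by (simp add: p less_eq_prod_def)
      then show ?thesis using ED down_closedD[OF E_down t_in(3)] by blast
    next
      case 3
      have "(a - 1, b - 1) \<in> E" using le by (intro down_closedD[OF E_down b(5)]) (simp add: diff_le_mono)
      then show ?thesis using 3 le b unfolding p by (intro DI) simp_all
    qed
  qed
qed

lemma shape_D: "shape k l P D"
  unfolding shape_def
proof (intro conjI)
  show "baxter_points k l P" by (rule points)
  show "P \<subseteq> D" using PE ED by blast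
  show "D \<subseteq> {..<k} \<times> {..<l}"
    using E_bounded s_bounds baxter_points_bounded[OF points, of "fst t" "snd t"] t_in(1) by (auto simp: D_def)
  show "down_closed D" by (rule D_down)
qed

lemma below_s_out: "(Suc (fst s), snd s) \<notin> D"
proof -
  have "(Suc (fst s), snd s) \<noteq> s" by (metis fst_conv n_not_Suc_n)
  then show ?thesis using E_above_s[of "(Suc (fst s), snd s)"] by (auto simp: D_def less_eq_prod_def)
qed

lemma right_s_out: "(fst s, Suc (snd s)) \<notin> E"
proof -
  have "(fst s, Suc (snd s)) \<noteq> s" by (metis snd_conv n_not_Suc_n)
  then show ?thesis using E_above_s[of "(fst s, Suc (snd s))"] by (auto simp: less_eq_prod_def)
qed

text \<open>A point right of \<open>s\<close> that were lowest in its column would be lowest in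
  \<open>D'\<close> too, so it would not be right of \<open>t\<close>. But then a cell below it is
  supplied, by the added ribbon from the row of \<open>t\<close> on and by the cells dominated by
  \<open>t\<close> above that row.\<close>

lemma special_D: "is_special P D s"
  unfolding is_special_def
proof (intro conjI allI impI)
  show "s \<in> P" by (rule s_in)
  show "(Suc (fst s), snd s) \<notin> D" by (rule below_s_out)
  fix i j assume ij: "(i, j) \<in> P" "(Suc i, j) \<notin> D"
  show "j \<le> snd s"
  proof (rule ccontr)
    assume j: "\<not> j \<le> snd s"
    then have ne: "(i, j) \<noteq> s" by auto
    then obtain q where q: "q \<in> P'" "(i, j) = opn q" by (rule other_obtain[OF ij(1)])
    have fg: "i = f (fst q)" "j = g (snd q)" using q(2) by (simp_all add: reopen_def)
    have "(Suc (fst q), snd q) \<notin> D'"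
    proof
      assume "(Suc (fst q), snd q) \<in> D'"
      then have "opn (Suc (fst q), snd q) \<in> E" using opn_E by simp
      moreover have "(Suc i, j) \<le> opn (Suc (fst q), snd q)" using fg by (simp add: less_eq_prod_def Suc_le_eq)
      ultimately have "(Suc i, j) \<in> E" by (rule down_closedD[OF E_down])
      then show False using ij(2) ED by blast
    qed
    then have "snd q \<le> snd s'" using is_specialD(3)[OF special', of "fst q" "snd q"] q(1) by simp
    then have jt: "j \<le> snd t" using fg by (simp add: t_def)
    have "i < fst s" using not_above[OF ij(1) ne] j by (auto simp: less_eq_prod_def)
    show False
    proof (cases "fst t \<le> i")
      case True
      have "(i, j) \<in> E" using ij(1) PE by blast
      then have "(i, j - 1) \<in> E" by (rule down_closedD[OF E_down]) simp
      then have "(Suc i, j) \<in> D" using True \<open>i < fst s\<close> j jt by (intro DI) simp_all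
      then show False using ij(2) by simp
    next
      case False
      then have "(Suc i, j) \<in> E" using jt by (intro down_closedD[OF E_down t_in(3)]) (simp add: less_eq_prod_def)
      then show False using ij(2) ED by blast
    qed
  qed
qed

lemma card_P_ne_1: "card P \<noteq> 1"
  using s_in s_not_root single_point(1)[OF points] by auto

sublocale step: tableau_step k l P D s
  by unfold_locales (rule shape_D special_D card_P_ne_1)+

lemma step_E: "step.E = E"
proof (cases "snd s < snd t")
  case False
  \<comment> \<open>When \<open>t\<close> is not right of \<open>s\<close> nothing is added, and the
    cell right of \<open>s\<close> is missing, so the removal step finds an empty ribbon.\<close>
  then have "D = E" by (auto simp: D_def)
  then have "(fst s, Suc (snd s)) \<notin> D" using right_s_out by simp
  then have "step.rib = {}" by (cases rule: step.rib_cases) blast+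
  then show ?thesis unfolding step.E_def using \<open>D = E\<close> by (metis Diff_empty)
next
  case True
  have ts: "fst t < fst s" using not_above[OF t_in(1,2)] True by (auto simp: less_eq_prod_def)
  note tb = t_bottom[OF True]
  have tb': "(Suc (fst t), y) \<notin> E" if "snd t \<le> y" for y
    using tb down_closedD[OF E_down, of "(Suc (fst t), y)" "(Suc (fst t), snd t)"] that by auto
  have right: "(fst s, Suc (snd s)) \<in> D"
  proof (rule DI)
    show "(fst s - 1, Suc (snd s) - 1) \<in> E" by (simp add: E_def less_eq_prod_def)
  qed (use ts True in simp_all)
  have "ribbon_end P D s t" unfolding ribbon_end_def
  proof (intro conjI allI impI t_in ts True)
    have "(fst t, snd t - 1) \<in> E" by (rule down_closedD[OF E_down t_in(3)]) (simp add: less_eq_prod_def)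
    then show "(Suc (fst t), snd t) \<in> D" using ts True by (intro DI) simp_all
    show "(Suc (fst t), Suc (snd t)) \<notin> D" using tb'[of "Suc (snd t)"] by (simp add: D_def)
    fix x y assume xy: "(x, y) \<in> P" "fst t < x" "snd s < y"
    have "(x, y) \<noteq> s" using xy by auto
    then have "x < fst s" using not_above[OF xy(1)] xy(3) by (auto simp: less_eq_prod_def)
    moreover have "y < snd t"
    proof (rule ccontr)
      assume "\<not> ?thesis"
      moreover have "(x, y) \<in> E" using xy(1) PE by blast
      then have "(Suc (fst t), y) \<in> E" by (rule down_closedD[OF E_down]) (use xy in simp)
      ultimately show False using tb'[of y] by simp
    qed
    moreover have "(x, y) \<in> E" using xy(1) PE by blast
    ultimately show "(Suc x, Suc y) \<in> D" using xy by (intro DI) simp_all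
  qed
  then have rib: "step.rib = rim_part D s t" unfolding step.rib_def by (rule ribbon_eq[OF shape_D special_D right])
  show ?thesis
  proof
    show "step.E \<subseteq> E"
    proof
      fix c assume c: "c \<in> step.E"
      obtain x y where xy: "c = (x, y)" by (cases c)
      have cD: "(x, y) \<in> D" "(x, y) \<notin> rim_part D s t" using c by (auto simp: step.E_def rib xy)
      show "c \<in> E"
      proof (rule ccontr)
        assume nE: "c \<notin> E"
        then have b: "fst t < x" "x \<le> fst s" "snd s < y" "y \<le> snd t" using cD(1) by (auto simp: D_def xy)
        \<comment> \<open>An added cell that is not removed is not a rim cell of \<open>D\<close>.
          Its diagonal neighbour was then put into \<open>D\<close> only because of the cell itself,
          or dominates it inside \<open>E\<close>.\<close>
        then have "(Suc x, Suc y) \<in> D" using cD by (auto simp: rim_part_def rim_def)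
        then have "(Suc x, Suc y) \<in> E \<or> (x, y) \<in> E" by (auto simp: D_def)
        then have "(x, y) \<in> E" using down_closedD[OF E_down, of "(Suc x, Suc y)" "(x, y)"] by auto
        then show False using nE by (simp add: xy)
      qed
    qed
    show "E \<subseteq> step.E"
    proof
      fix c assume c: "c \<in> E"
      obtain x y where xy: "c = (x, y)" by (cases c)
      have "(x, y) \<notin> rim_part D s t"
      proof
        assume "(x, y) \<in> rim_part D s t"
        then have r: "(Suc x, Suc y) \<notin> D" "fst t < x" "snd s < y" by (auto simp: rim_part_def rim_def)
        have "y < snd t"
        proof (rule ccontr)
          assume "\<not> ?thesis"
          moreover have "(Suc (fst t), y) \<in> E" using r by (intro down_closedD[OF E_down c]) (simp add: xy)
          ultimately show False using tb'[of y] by simp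
        qed
        moreover have "x < fst s"
        proof (rule ccontr)
          assume "\<not> ?thesis"
          then have "(fst s, Suc (snd s)) \<in> E" using r by (intro down_closedD[OF E_down c]) (simp add: xy)
          then show False using right_s_out by simp
        qed
        moreover have "(x, y) \<in> E" using c by (simp add: xy)
        ultimately have "(Suc x, Suc y) \<in> D" using r by (intro DI) simp_all
        then show False using r(1) by simp
      qed
      then show "c \<in> step.E" using c ED by (auto simp: step.E_def rib xy)
    qed
  qed
qed

lemma step_D': "step.D' = D'"
  unfolding step.D'_def step_E by (simp add: set_eq_iff opn_E del: split_paired_All)

end

lemma greedy_labeling_realized:
  assumes "baxter_points k l P" "linext P lab" "greedy P lab"
  shows "\<exists>D. shape k l P D \<and> (\<forall>p\<in>P. insertion_label (Tableau D P) p = lab p)"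
  using assms
proof (induction "card P" arbitrary: k l P lab rule: less_induct)
  case less
  show ?case
  proof (cases "card P = 1")
    case True
    note single = single_point[OF less(2) True]
    have "shape k l P {(0, 0)}" unfolding shape_def
      using less(2) by (auto simp: single down_closed_def less_eq_prod_def)
    moreover have "lab p = 1" if "p \<in> P" for p using linext_range[OF less(3) that] True by simp
    ultimately show ?thesis using insertion_label_single[OF True] by auto
  next
    case False
    have "card P \<noteq> 0" using baxter_points_finite[OF less(2)] baxter_pointsD(3)[OF less(2)] by auto
    then have "1 \<le> card P" by simp
    then obtain s where s: "s \<in> P" "lab s = card P" by (rule linext_obtain[OF less(3) _ order_refl])
    have smax: "q = s" if "q \<in> P" "s \<le> q" for q
      using linext_mono[OF less(3) s(1) that] linext_range[OF less(3) that(1)] linext_inj[OF less(3) that(1) s(1)] s(2) by simp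
    have "s \<noteq> (0, 0)"
    proof
      assume s0: "s = (0, 0)"
      have "q = s" if "q \<in> P" for q by (rule smax[OF that]) (simp add: s0 less_eq_prod_def)
      then have "P = {s}" using s(1) by blast
      then show False using False by simp
    qed
    then interpret M: maximal_point k l P s using less(2) s(1) smax by unfold_locales
    let ?lab = "lab \<circ> reopen P s"
    have "\<exists>D'. shape M.k' M.l' M.P' D' \<and> (\<forall>p\<in>M.P'. insertion_label (Tableau D' M.P') p = ?lab p)"
      by (rule less(1)[OF _ M.points' M.linext_opn[OF less(3) s(2)] M.greedy_opn[OF less(4)]]) (simp add: M.card_P')
    then obtain D' where D': "shape M.k' M.l' M.P' D'" "\<And>p. p \<in> M.P' \<Longrightarrow> insertion_label (Tableau D' M.P') p = ?lab p"
      by blast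
    obtain s' where s': "is_special M.P' D' s'" by (rule is_special_exists[OF D'(1)])
    \<comment> \<open>The insertion labeling of \<open>D'\<close> and the given labeling agree on
      the points, and only those values occur.\<close>
    have "covered M.P' D' ?lab" unfolding covered_def
    proof (intro allI impI)
      fix x y assume "(x, y) \<in> D'" "crossing M.P' (x, y)"
      then obtain p q where "p \<in> M.P'" "q \<in> M.P'" "insertion_label (Tableau D' M.P') p = Suc (insertion_label (Tableau D' M.P') q)"
        "fst q < x" "x \<le> fst p" "snd p < y" "y \<le> snd q"
        by (rule coveredD[OF insertion_labeling(3)[OF D'(1)]])
      then show "\<exists>p\<in>M.P'. \<exists>q\<in>M.P'. ?lab p = Suc (?lab q) \<and> fst q < x \<and> x \<le> fst p \<and> snd p < y \<and> y \<le> snd q"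
        using D'(2) by (intro bexI[of _ p] bexI[of _ q]) simp_all
    qed
    then interpret I: insertion_step k l P s D' lab s'
      using D'(1) less(3,4) s(2) s' by unfold_locales
    have "insertion_label (Tableau I.D P) p = lab p" if p: "p \<in> P" for p
    proof (cases "p = s")
      case True
      then show ?thesis using I.step.insertion_label_special s(2) by simp
    next
      case False
      then obtain p' where p': "p' \<in> M.P'" "p = reopen P s p'" by (rule M.other_obtain[OF p])
      then show ?thesis using I.step.insertion_label_opn[of p'] I.step_D' D'(2) by simp
    qed
    then show ?thesis using I.shape_D by blast
  qed
qed

section \<open>Real boxes\<close>

text \<open>Rows are counted downwards and the y-axis points up, so row coordinates are reflected at
  height \<open>k\<close> and top and bottom exchange places.\<close>

definition real_box :: "nat \<Rightarrow> cell \<times> cell \<Rightarrow> (real \<times> real) set" where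
  "real_box k b = cbox (real (snd (fst b)), real k - real (fst (snd b))) (real (snd (snd b)), real k - real (fst (fst b)))"

lemma mem_box_pair: "(x, y) \<in> box (a, c) (b, d) \<longleftrightarrow> a < x \<and> x < b \<and> c < y \<and> y < (d :: real)" for x :: real
  by (auto simp: box_prod)

lemma mem_cbox_pair: "(x, y) \<in> cbox (a, c) (b, d) \<longleftrightarrow> a \<le> x \<and> x \<le> b \<and> c \<le> y \<and> y \<le> (d :: real)" for x :: real
  by auto

lemma mem_real_box: "(x, y) \<in> real_box k b \<longleftrightarrow>
    real (snd (fst b)) \<le> x \<and> x \<le> real (snd (snd b)) \<and> real k - real (fst (snd b)) \<le> y \<and> y \<le> real k - real (fst (fst b))"
  by (simp add: real_box_def mem_cbox_pair)

lemma mem_rectangle: "(x, y) \<in> rectangle k l \<longleftrightarrow> 0 \<le> x \<and> x \<le> real l \<and> 0 \<le> y \<and> y \<le> real k"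
  by (simp add: rectangle_def mem_cbox_pair)

lemma mem_frame: "(x, y) \<in> frontier (rectangle k l) \<longleftrightarrow>
    (x, y) \<in> rectangle k l \<and> (x = 0 \<or> x = real l \<or> y = 0 \<or> y = real k)"
  unfolding rectangle_def frontier_cbox by (auto simp: mem_box_pair mem_cbox_pair)

lemma real_box_eq_iff:
  assumes "fst (fst b) < fst (snd b)" "snd (fst b) < snd (snd b)" "fst (snd b) \<le> k"
    and "fst (fst b') < fst (snd b')" "snd (fst b') < snd (snd b')" "fst (snd b') \<le> k"
  shows "real_box k b = real_box k b' \<longleftrightarrow> b = b'"
proof
  assume eq: "real_box k b = real_box k b'"
  have "(real (snd (fst b)), real k - real (fst (snd b))) \<in> real_box k b" using assms by (simp add: mem_real_box)
  then have "real_box k b \<noteq> {}" by blast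
  then have "(real (snd (fst b)), real k - real (fst (snd b))) = (real (snd (fst b')), real k - real (fst (snd b'))) \<and>
    (real (snd (snd b)), real k - real (fst (fst b))) = (real (snd (snd b')), real k - real (fst (fst b')))"
    using eq unfolding real_box_def eq_cbox by blast
  then show "b = b'" by (simp add: prod_eq_iff)
qed simp

text \<open>At the far end \<open>z = real n\<close> the last cell \<open>n - 1\<close> is chosen;
  everywhere else the right inequality is strict.\<close>

lemma grid_cell:
  assumes "0 \<le> z" "z \<le> real n" "0 < n"
  obtains j where "j < n" "real j \<le> z" "z \<le> real (Suc j)" "z < real n \<Longrightarrow> z < real (Suc j)"
proof (cases "z < real n")
  case True
  define j where "j = nat \<lfloor>z\<rfloor>"
  have "real j \<le> z" "z < real (Suc j)" unfolding j_def using assms(1) by linarith+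
  then show ?thesis using that[of j] True by linarith
next
  case False
  then show ?thesis using that[of "n - 1"] assms by (simp add: of_nat_diff)
qed

section \<open>Drawing the segments\<close>

lemma extended_segment_east:
  fixes x y :: real
  defines "A S \<equiv> {t. 0 < t \<and> (x + t, y) \<in> S}"
  assumes "A S \<noteq> {}"
  shows "extended_segment S (x, y) (1, 0) = {x..x + Inf (A S)} \<times> {y}" "0 \<le> Inf (A S)"
proof -
  show I: "0 \<le> Inf (A S)" using assms(2) by (rule cInf_greatest) (simp add: A_def)
  have "{t. 0 < t \<and> (x, y) + t *\<^sub>R (1, 0) \<in> S} = A S" by (simp add: A_def)
  then show "extended_segment S (x, y) (1, 0) = {x..x + Inf (A S)} \<times> {y}"
    unfolding extended_segment_def using I by (simp add: closed_segment_same_snd closed_segment_eq_real_ivl1)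
qed

lemma extended_segment_south:
  fixes x y :: real
  defines "A S \<equiv> {t. 0 < t \<and> (x, y - t) \<in> S}"
  assumes "A S \<noteq> {}"
  shows "extended_segment S (x, y) (0, -1) = {x} \<times> {y - Inf (A S)..y}" "0 \<le> Inf (A S)"
proof -
  show I: "0 \<le> Inf (A S)" using assms(2) by (rule cInf_greatest) (simp add: A_def)
  have "{t. 0 < t \<and> (x, y) + t *\<^sub>R (0, -1) \<in> S} = A S" by (simp add: A_def)
  then show "extended_segment S (x, y) (0, -1) = {x} \<times> {y - Inf (A S)..y}"
    unfolding extended_segment_def using I
    by (simp add: closed_segment_same_fst closed_segment_commute[of y] closed_segment_eq_real_ivl1)
qed

locale labeled_points =
  fixes k l :: nat and P :: "cell set" and lab :: "cell \<Rightarrow> nat"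
  assumes points: "baxter_points k l P" and lin: "linext P lab"
begin

abbreviation "btm \<equiv> tile_bottom k P lab"
abbreviation "rgt \<equiv> tile_right l P lab"

lemmas tile_bounds = tile_bottom_gt[OF points lin] tile_right_gt[OF points lin]
  tile_bottom_le(1)[OF points lin] tile_right_le(1)[OF points lin]

lemma point_bounds: "p \<in> P \<Longrightarrow> fst p < k" "p \<in> P \<Longrightarrow> snd p < l"
  using baxter_points_bounded[OF points, of "fst p" "snd p"] by simp_all

lemma mem_tile: "p \<in> P \<Longrightarrow> (i, j) \<in> tile k l P lab p \<longleftrightarrow> fst p \<le> i \<and> i < btm p \<and> snd p \<le> j \<and> j < rgt p"
  using tile_eq_cells[OF points lin] by (auto simp: cells_def tile_box_def)

lemma tile_no_later:
  assumes "p \<in> P" "q \<in> P" "lab p < lab q" "fst p \<le> i" "i < btm p" "snd p \<le> j" "j < rgt p" "fst q \<le> i" "snd q \<le> j"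
  shows False
proof -
  have "(i, j) \<in> tile k l P lab p" using mem_tile[OF assms(1)] assms by simp
  moreover have "q \<le> (i, j)" using assms by (simp add: less_eq_prod_def)
  ultimately show False using assms(2,3) by (simp add: tile_def)
qed

text \<open>Take the owner of the cell just right of the top-right cell of \<open>p\<close>. It is
  at least as late as the point that bounds \<open>p\<close> on the right, hence later than
  \<open>p\<close>; if it began further left it would cut off a cell of \<open>p\<close>. Its left
  edge is what stops the segment going east.\<close>

lemma right_neighbour:
  assumes p: "p \<in> P" and "rgt p < l"
  obtains q where "q \<in> P" "lab p < lab q" "snd q = rgt p" "fst q \<le> fst p" "fst p < btm q"
proof -
  have "(fst p, rgt p) \<in> {..<k} \<times> {..<l}" using assms point_bounds[OF p] by simp
  then obtain q where q: "q \<in> P" "(fst p, rgt p) \<in> tile k l P lab q" by (rule tile_exists[OF points lin])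
  have qb: "fst q \<le> fst p" "fst p < btm q" "snd q \<le> rgt p" using mem_tile[OF q(1)] q(2) by simp_all
  obtain v where v: "v \<in> P" "lab p < lab v" "fst v \<le> fst p" "snd v = rgt p"
    by (rule tile_right_attained[OF points lin assms(2)])
  have "\<not> lab q < lab v"
    using tile_no_later[OF q(1) v(1), of "fst p" "rgt p"] mem_tile[OF q(1)] q(2) v by auto
  then have lq: "lab p < lab q" using v(2) by simp
  have "snd q = rgt p"
  proof (rule ccontr)
    assume "snd q \<noteq> rgt p"
    then have "snd q \<le> rgt p - 1" "snd p \<le> rgt p - 1" "rgt p - 1 < rgt p"
      using qb(3) tile_bounds(2)[OF p] by simp_all
    then show False
      using tile_no_later[OF p q(1) lq, of "fst p" "rgt p - 1"] qb(1) tile_bounds(1)[OF p] by simp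
  qed
  then show ?thesis using that q(1) lq qb by blast
qed

lemma lower_neighbour:
  assumes p: "p \<in> P" and "btm p < k"
  obtains q where "q \<in> P" "lab p < lab q" "fst q = btm p" "snd q \<le> snd p" "snd p < rgt q"
proof -
  have "(btm p, snd p) \<in> {..<k} \<times> {..<l}" using assms point_bounds[OF p] by simp
  then obtain q where q: "q \<in> P" "(btm p, snd p) \<in> tile k l P lab q" by (rule tile_exists[OF points lin])
  have qb: "snd q \<le> snd p" "snd p < rgt q" "fst q \<le> btm p" using mem_tile[OF q(1)] q(2) by simp_all
  obtain v where v: "v \<in> P" "lab p < lab v" "snd v \<le> snd p" "fst v = btm p"
    by (rule tile_bottom_attained[OF points lin assms(2)])
  have "\<not> lab q < lab v"
    using tile_no_later[OF q(1) v(1), of "btm p" "snd p"] mem_tile[OF q(1)] q(2) v by auto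
  then have lq: "lab p < lab q" using v(2) by simp
  have "fst q = btm p"
  proof (rule ccontr)
    assume "fst q \<noteq> btm p"
    then have "fst q \<le> btm p - 1" "fst p \<le> btm p - 1" "btm p - 1 < btm p"
      using qb(3) tile_bounds(1)[OF p] by simp_all
    then show False
      using tile_no_later[OF p q(1) lq, of "btm p - 1" "snd p"] qb(1) tile_bounds(2)[OF p] by simp
  qed
  then show ?thesis using that q(1) lq qb by blast
qed

definition top_edge :: "cell \<Rightarrow> (real \<times> real) set" where
  "top_edge p = {real (snd p)..real (rgt p)} \<times> {real k - real (fst p)}"

definition left_edge :: "cell \<Rightarrow> (real \<times> real) set" where
  "left_edge p = {real (snd p)} \<times> {real k - real (btm p)..real k - real (fst p)}"

definition drawn :: "nat \<Rightarrow> (real \<times> real) set" where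
  "drawn m = frontier (rectangle k l) \<union> (\<Union>p\<in>{p \<in> P. m \<le> lab p}. top_edge p \<union> left_edge p)"

definition corner :: "cell \<Rightarrow> real \<times> real" where
  "corner p = (real (snd p), real k - real (fst p))"

lemma drawn_cases:
  assumes "(x, y) \<in> drawn m"
  obtains "(x, y) \<in> frontier (rectangle k l)"
  | q where "q \<in> P" "m \<le> lab q" "real (snd q) \<le> x" "x \<le> real (rgt q)" "y = real k - real (fst q)"
  | q where "q \<in> P" "m \<le> lab q" "x = real (snd q)" "real k - real (btm q) \<le> y" "y \<le> real k - real (fst q)"
  using assms by (auto simp: drawn_def top_edge_def left_edge_def)

lemma frame_drawn: "(x, y) \<in> frontier (rectangle k l) \<Longrightarrow> (x, y) \<in> drawn m"
  by (simp add: drawn_def)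

lemma top_edge_drawn:
  assumes "q \<in> P" "m \<le> lab q" "real (snd q) \<le> x" "x \<le> real (rgt q)" "y = real k - real (fst q)"
  shows "(x, y) \<in> drawn m"
proof -
  have "(x, y) \<in> top_edge q" using assms by (simp add: top_edge_def)
  then show ?thesis using assms(1,2) unfolding drawn_def by blast
qed

lemma left_edge_drawn:
  assumes "q \<in> P" "m \<le> lab q" "x = real (snd q)" "real k - real (btm q) \<le> y" "y \<le> real k - real (fst q)"
  shows "(x, y) \<in> drawn m"
proof -
  have "(x, y) \<in> left_edge q" using assms by (simp add: left_edge_def)
  then show ?thesis using assms(1,2) unfolding drawn_def by blast
qed

text \<open>By \<open>right_neighbour\<close> the ray is stopped at the right end of
  \<open>p\<close>. It is not stopped earlier, because a later corner whose edge is met before would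
  cut off a cell in the top row of the tile of \<open>p\<close>.\<close>

lemma draw_east:
  assumes p: "p \<in> P"
  shows "drawn (Suc (lab p)) \<union> extended_segment (drawn (Suc (lab p))) (corner p) (1, 0) =
    drawn (Suc (lab p)) \<union> top_edge p"
proof -
  let ?S = "drawn (Suc (lab p))"
  let ?x = "real (snd p)" and ?y = "real k - real (fst p)"
  let ?A = "{t. 0 < t \<and> (?x + t, ?y) \<in> ?S}"
  note b = point_bounds[OF p] tile_bounds[of p] p
  note tb = tile_bounds(1,2)[OF p]
  show ?thesis
  proof (cases "fst p = 0")
    case True
    \<comment> \<open>In the top row the ray runs along the frame, and so does the top edge of the
      tile. The far corner bounds the infimum, so whatever is drawn stays inside the frame.\<close>
    have mem: "real l - ?x \<in> ?A"
      using True b by (auto intro!: frame_drawn simp: mem_frame mem_rectangle)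
    then have ne: "?A \<noteq> {}" by blast
    have "Inf ?A \<le> real l - ?x" using mem by (intro cInf_lower bdd_belowI[of _ 0]) auto
    then have "extended_segment ?S (?x, ?y) (1, 0) \<subseteq> frontier (rectangle k l)"
      unfolding extended_segment_east(1)[OF ne] using True by (auto simp: mem_frame mem_rectangle)
    moreover have "top_edge p \<subseteq> frontier (rectangle k l)"
      using True tile_bounds(4)[of p] by (auto simp: mem_frame mem_rectangle top_edge_def)
    ultimately show ?thesis unfolding corner_def by (auto simp: drawn_def)
  next
    case False
    have mem: "real (rgt p) - ?x \<in> ?A"
    proof (cases "rgt p = l")
      case True
      then show ?thesis using b tb by (auto intro!: frame_drawn simp: mem_frame mem_rectangle)
    next
      case False
      then have "rgt p < l" using tile_bounds(4)[of p] by simp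
      then obtain q where q: "q \<in> P" "lab p < lab q" "snd q = rgt p" "fst q \<le> fst p" "fst p < btm q"
        by (rule right_neighbour[OF p])
      have "(real (rgt p), ?y) \<in> ?S" by (rule left_edge_drawn[OF q(1)]) (use q in simp_all)
      then show ?thesis using tb by simp
    qed
    have min: "real (rgt p) - ?x \<le> t" if t: "t \<in> ?A" for t
    proof (rule ccontr)
      assume "\<not> ?thesis"
      then have lt: "?x + t < real (rgt p)" "0 < t" "(?x + t, ?y) \<in> ?S" using t by auto
      from lt(3) show False
      proof (cases rule: drawn_cases)
        case 1
        then show False using False lt(1,2) b tile_bounds(4)[of p] by (auto simp: mem_frame mem_rectangle)
      next
        case (2 q)
        have row: "fst q = fst p" using 2(5) by simp
        have lq: "lab p < lab q" using 2(2) by simp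
        have "snd p < snd q"
        proof (rule ccontr)
          assume "\<not> ?thesis"
          then have "q \<le> p" using row by (simp add: less_eq_prod_def)
          then show False using later_not_le[OF points lin p 2(1) lq] by simp
        qed
        moreover have "snd q < rgt p" using 2(3) lt(1) by linarith
        ultimately show False using tile_no_later[OF p 2(1) lq, of "fst p" "snd q"] tb row by simp
      next
        case (3 q)
        have lq: "lab p < lab q" using 3(2) by simp
        have "snd p < snd q" "snd q < rgt p" "fst q \<le> fst p" using 3 lt by linarith+
        then show False using tile_no_later[OF p 3(1) lq, of "fst p" "snd q"] tb by simp
      qed
    qed
    have I: "Inf ?A = real (rgt p) - ?x" by (rule cInf_eq_minimum[OF mem min])
    have "?A \<noteq> {}" using mem by blast
    from extended_segment_east(1)[OF this] show ?thesis unfolding corner_def I by (simp add: top_edge_def)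
  qed
qed

lemma draw_south:
  assumes p: "p \<in> P"
  shows "drawn (Suc (lab p)) \<union> extended_segment (drawn (Suc (lab p))) (corner p) (0, -1) =
    drawn (Suc (lab p)) \<union> left_edge p"
proof -
  let ?S = "drawn (Suc (lab p))"
  let ?x = "real (snd p)" and ?y = "real k - real (fst p)"
  let ?A = "{t. 0 < t \<and> (?x, ?y - t) \<in> ?S}"
  note b = point_bounds[OF p] tile_bounds[of p] p
  note tb = tile_bounds(1,2)[OF p]
  show ?thesis
  proof (cases "snd p = 0")
    case True
    have mem: "?y \<in> ?A"
      using True b by (auto intro!: frame_drawn simp: mem_frame mem_rectangle)
    then have ne: "?A \<noteq> {}" by blast
    have "Inf ?A \<le> ?y" using mem by (intro cInf_lower bdd_belowI[of _ 0]) auto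
    then have "extended_segment ?S (?x, ?y) (0, -1) \<subseteq> frontier (rectangle k l)"
      unfolding extended_segment_south(1)[OF ne] using True by (auto simp: mem_frame mem_rectangle)
    moreover have "left_edge p \<subseteq> frontier (rectangle k l)"
      using True tile_bounds(3)[of p] by (auto simp: mem_frame mem_rectangle left_edge_def)
    ultimately show ?thesis unfolding corner_def by (auto simp: drawn_def)
  next
    case False
    have mem: "real (btm p) - real (fst p) \<in> ?A"
    proof (cases "btm p = k")
      case True
      then show ?thesis using b tb by (auto intro!: frame_drawn simp: mem_frame mem_rectangle)
    next
      case False
      then have "btm p < k" using tile_bounds(3)[of p] by simp
      then obtain q where q: "q \<in> P" "lab p < lab q" "fst q = btm p" "snd q \<le> snd p" "snd p < rgt q"
        by (rule lower_neighbour[OF p])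
      have "(?x, real k - real (btm p)) \<in> ?S" by (rule top_edge_drawn[OF q(1)]) (use q in simp_all)
      then show ?thesis using tb by simp
    qed
    have min: "real (btm p) - real (fst p) \<le> t" if t: "t \<in> ?A" for t
    proof (rule ccontr)
      assume "\<not> ?thesis"
      then have lt: "real (fst p) + t < real (btm p)" "0 < t" "(?x, ?y - t) \<in> ?S" using t by auto
      from lt(3) show False
      proof (cases rule: drawn_cases)
        case 1
        then show False using False lt(1,2) b tile_bounds(3)[of p] by (auto simp: mem_frame mem_rectangle)
      next
        case (2 q)
        have lq: "lab p < lab q" using 2(2) by simp
        have "fst p < fst q" "fst q < btm p" "snd q \<le> snd p" using 2 lt by linarith+
        then show False using tile_no_later[OF p 2(1) lq, of "fst q" "snd p"] tb by simp
      next
        case (3 q)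
        have col: "snd q = snd p" using 3(3) by simp
        have lq: "lab p < lab q" using 3(2) by simp
        have "fst p < fst q"
        proof (rule ccontr)
          assume "\<not> ?thesis"
          then have "q \<le> p" using col by (simp add: less_eq_prod_def)
          then show False using later_not_le[OF points lin p 3(1) lq] by simp
        qed
        moreover have "fst q < btm p" using 3(5) lt(1) by linarith
        ultimately show False using tile_no_later[OF p 3(1) lq, of "fst q" "snd p"] tb col by simp
      qed
    qed
    have I: "Inf ?A = real (btm p) - real (fst p)" by (rule cInf_eq_minimum[OF mem min])
    have "?A \<noteq> {}" using mem by blast
    from extended_segment_south(1)[OF this] show ?thesis unfolding corner_def I by (simp add: left_edge_def)
  qed
qed

lemma draw_step:
  assumes p: "p \<in> P"
  shows "draw_segments (corner p) (drawn (Suc (lab p))) = drawn (lab p)"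
proof -
  have "{q \<in> P. lab p \<le> lab q} = insert p {q \<in> P. Suc (lab p) \<le> lab q}"
    using p linext_inj[OF lin p] by (auto simp: Suc_le_eq) (metis le_neq_implies_less)
  then have "drawn (lab p) = drawn (Suc (lab p)) \<union> top_edge p \<union> left_edge p" unfolding drawn_def by auto
  then show ?thesis using draw_east[OF p] draw_south[OF p] unfolding draw_segments_def by blast
qed

lemma draw_all:
  assumes c: "\<And>m. 1 \<le> m \<Longrightarrow> m \<le> card P \<Longrightarrow> c m \<in> P \<and> lab (c m) = m" and "m \<le> card P"
  shows "fold (\<lambda>m. draw_segments (corner (c m))) (rev [Suc (card P - m)..<Suc (card P)]) (frontier (rectangle k l)) =
    drawn (Suc (card P - m))"
  using assms(2)
proof (induction m)
  case 0
  have "{p \<in> P. Suc (card P) \<le> lab p} = {}" using linext_range[OF lin] by (auto simp: Suc_le_eq not_less)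
  then have "drawn (Suc (card P)) = frontier (rectangle k l)" unfolding drawn_def by (simp only:) simp
  then show ?case by simp
next
  case (Suc m)
  define j where "j = Suc (card P - Suc m)"
  have j: "Suc (card P - m) = Suc j" "j < Suc (card P)" "1 \<le> j" "j \<le> card P" using Suc(2) by (auto simp: j_def)
  have "rev [j..<Suc (card P)] = rev [Suc j..<Suc (card P)] @ [j]" using j(2) by (simp only: upt_conv_Cons rev.simps)
  then have "fold (\<lambda>m. draw_segments (corner (c m))) (rev [j..<Suc (card P)]) (frontier (rectangle k l)) =
    draw_segments (corner (c j)) (drawn (Suc j))"
    using Suc(1)[unfolded j(1)] Suc(2) by simp
  also have "\<dots> = drawn j" using draw_step[of "c j"] c[OF j(3,4)] by simp
  finally show ?case by (simp only: j_def)
qed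

section \<open>Open tiles as the components of the complement\<close>

definition open_tile :: "cell \<Rightarrow> (real \<times> real) set" where
  "open_tile p = box (real (snd p), real k - real (btm p)) (real (rgt p), real k - real (fst p))"

lemma mem_open_tile: "(x, y) \<in> open_tile p \<longleftrightarrow>
    real (snd p) < x \<and> x < real (rgt p) \<and> real k - real (btm p) < y \<and> y < real k - real (fst p)"
  by (simp add: open_tile_def mem_box_pair)

text \<open>If an edge of \<open>q\<close> ran through the interior of \<open>p\<close>, the
  componentwise maximum of the two corners would be a cell in the tile of the earlier point although
  it lies weakly south-east of the later one.\<close>

lemma open_tile_undrawn:
  assumes p: "p \<in> P" and xy: "(x, y) \<in> open_tile p"
  shows "(x, y) \<notin> drawn m"
proof
  assume "(x, y) \<in> drawn m"
  note o = xy[unfolded mem_open_tile]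
  note tb = tile_bounds(1,2)[OF p] tile_bounds(3,4)[of p]
  from \<open>(x, y) \<in> drawn m\<close> show False
  proof (cases rule: drawn_cases)
    case 1
    then show False using o tb by (auto simp: mem_frame mem_rectangle)
  next
    case (2 q)
    note tq = tile_bounds(1,2)[OF 2(1)]
    have row: "fst p < fst q" "fst q < btm p" using o 2(5) by linarith+
    have col: "snd p < rgt q" "snd q < rgt p" using o 2(3,4) by linarith+
    have "lab p \<noteq> lab q" using linext_inj[OF lin p 2(1)] row by auto
    then consider "lab p < lab q" | "lab q < lab p" by linarith
    then show False
    proof cases
      case a: 1
      show False by (rule tile_no_later[OF p 2(1) a, of "fst q" "max (snd p) (snd q)"]) (use row col tb in auto)
    next
      case a: 2
      show False by (rule tile_no_later[OF 2(1) p a, of "fst q" "max (snd p) (snd q)"]) (use row col tq in auto)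
    qed
  next
    case (3 q)
    note tq = tile_bounds(1,2)[OF 3(1)]
    have row: "fst q < btm p" "fst p < btm q" using o 3(4,5) by linarith+
    have col: "snd p < snd q" "snd q < rgt p" using o 3(3) by linarith+
    have "lab p \<noteq> lab q" using linext_inj[OF lin p 3(1)] col by auto
    then consider "lab p < lab q" | "lab q < lab p" by linarith
    then show False
    proof cases
      case a: 1
      show False by (rule tile_no_later[OF p 3(1) a, of "max (fst p) (fst q)" "snd q"]) (use row col tb in auto)
    next
      case a: 2
      show False by (rule tile_no_later[OF 3(1) p a, of "max (fst p) (fst q)" "snd q"]) (use row col tq in auto)
    qed
  qed
qed

lemma undrawn_eq: "rectangle k l - drawn 1 = (\<Union>p\<in>P. open_tile p)"
proof
  note kl = baxter_points_card(2,3)[OF points]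
  show "rectangle k l - drawn 1 \<subseteq> (\<Union>p\<in>P. open_tile p)"
  proof
    fix z assume z: "z \<in> rectangle k l - drawn 1"
    obtain x y where xy: "z = (x, y)" by (cases z)
    have nf: "(x, y) \<notin> frontier (rectangle k l)" using z frame_drawn unfolding xy by blast
    have r: "0 \<le> x" "x < real l" "0 < y" "y \<le> real k"
      using z nf by (auto simp: xy mem_frame mem_rectangle)
    obtain j where j: "j < l" "real j \<le> x" "x < real (Suc j)" using grid_cell[OF r(1) _ kl(2)] r(2) by (metis less_imp_le)
    obtain i where i: "i < k" "real i \<le> real k - y" "real k - y < real (Suc i)"
      using grid_cell[of "real k - y" k] r(3,4) kl(1) by (metis diff_ge_0_iff_ge diff_less_eq less_add_same_cancel1 less_imp_le)
    have "(i, j) \<in> {..<k} \<times> {..<l}" using i j by simp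
    then obtain p where p: "p \<in> P" "(i, j) \<in> tile k l P lab p" by (rule tile_exists[OF points lin])
    have b: "fst p \<le> i" "Suc i \<le> btm p" "snd p \<le> j" "Suc j \<le> rgt p" using mem_tile[OF p(1)] p(2) by simp_all
    have lp: "1 \<le> lab p" using linext_range[OF lin p(1)] by simp
    have in_closed: "real (snd p) \<le> x" "x < real (rgt p)" "real k - real (btm p) < y" "y \<le> real k - real (fst p)"
      using b i j by linarith+
    \<comment> \<open>The half-open choice of the grid cell leaves only the left and top edges of
      the tile to exclude, and these are exactly the ones drawn for \<open>p\<close>.\<close>
    have "x \<noteq> real (snd p)" using left_edge_drawn[OF p(1) lp, of x y] in_closed z xy by auto
    moreover have "y \<noteq> real k - real (fst p)" using top_edge_drawn[OF p(1) lp, of x y] in_closed z xy by auto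
    ultimately have "(x, y) \<in> open_tile p" using in_closed by (simp add: mem_open_tile)
    then show "z \<in> (\<Union>p\<in>P. open_tile p)" using p(1) xy by blast
  qed
  show "(\<Union>p\<in>P. open_tile p) \<subseteq> rectangle k l - drawn 1"
  proof
    fix z assume "z \<in> (\<Union>p\<in>P. open_tile p)"
    then obtain x y p where xy: "z = (x, y)" "p \<in> P" "(x, y) \<in> open_tile p" by (cases z) auto
    have "(x, y) \<in> rectangle k l"
      using xy(3) tile_bounds(3,4)[of p] by (auto simp: mem_open_tile mem_rectangle)
    then show "z \<in> rectangle k l - drawn 1" using open_tile_undrawn[OF xy(2,3)] xy(1) by blast
  qed
qed

lemma open_tile_nonempty: "p \<in> P \<Longrightarrow> open_tile p \<noteq> {}"
  using tile_bounds(1,2)[of p] unfolding open_tile_def by (simp add: box_prod)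

lemma open_tile_disjoint:
  assumes p: "p \<in> P" and q: "q \<in> P" and "open_tile p \<inter> open_tile q \<noteq> {}"
  shows "p = q"
proof (rule ccontr)
  assume "p \<noteq> q"
  obtain x y where xy: "(x, y) \<in> open_tile p" "(x, y) \<in> open_tile q" using assms(3) by fast
  note o = xy[unfolded mem_open_tile]
  have c: "snd p < rgt q" "snd q < rgt p" "fst p < btm q" "fst q < btm p" using o by linarith+
  have "(max (fst p) (fst q), max (snd p) (snd q)) \<in> tile k l P lab p"
    "(max (fst p) (fst q), max (snd p) (snd q)) \<in> tile k l P lab q"
    using mem_tile[OF p] mem_tile[OF q] c tile_bounds(1,2)[OF p] tile_bounds(1,2)[OF q] by simp_all
  then show False using tile_unique[OF points lin p q] \<open>p \<noteq> q\<close> by blast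
qed

lemma components_undrawn: "components (rectangle k l - drawn 1) = open_tile ` P"
proof (rule components_open_unique)
  show "pairwise disjnt (open_tile ` P)"
    unfolding pairwise_image by (auto simp: pairwise_def disjnt_def dest: open_tile_disjoint)
  show "\<Union> (open_tile ` P) = rectangle k l - drawn 1" by (simp only: undrawn_eq)
  fix X assume "X \<in> open_tile ` P"
  then obtain p where "p \<in> P" "X = open_tile p" by blast
  then show "open X \<and> connected X \<and> X \<noteq> {}"
    using open_tile_nonempty by (simp add: open_tile_def open_box convex_box convex_connected)
qed

lemma closure_components: "closure ` components (rectangle k l - drawn 1) = real_box k ` tile_box k l P lab ` P"
proof -
  have "closure (open_tile p) = real_box k (tile_box k l P lab p)" if "p \<in> P" for p
    using open_tile_nonempty[OF that] unfolding open_tile_def real_box_def tile_box_def by simp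
  then show ?thesis unfolding components_undrawn image_image by simp
qed

end

section \<open>The drawing of a tableau in terms of its labeled tiles\<close>

lemma Phi_F_eq:
  assumes sh: "shape k l P D"
  shows "Phi_F (Tableau D P) = real_box k ` tile_box k l P (insertion_label (Tableau D P)) ` P"
proof -
  let ?T = "Tableau D P"
  let ?lab = "insertion_label ?T"
  interpret labeled_points k l P ?lab by unfold_locales (rule shapeD(1)[OF sh], rule insertion_labeling(1)[OF sh])
  have nk: "num_rows ?T = k" "num_cols ?T = l" by (rule shape_baxter_tlt[OF sh])+
  have corner: "top_left_corner ?T = corner" by (simp add: fun_eq_iff top_left_corner_def corner_def nk)
  have c: "labeled_cell ?T m \<in> P \<and> ?lab (labeled_cell ?T m) = m" if m: "1 \<le> m" "m \<le> card P" for m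
  proof -
    obtain p where p: "p \<in> P" "?lab p = m" by (rule linext_obtain[OF lin m])
    have "labeled_cell ?T m = p" unfolding labeled_cell_def
      by (rule the_equality) (use p linext_inj[OF lin] in auto)
    then show ?thesis using p by simp
  qed
  have "drawing ?T = drawn 1"
    using draw_all[of "labeled_cell ?T" "card P", OF c] unfolding drawing_def corner nk tableau_size_def by simp
  then show ?thesis unfolding Phi_F_def nk using closure_components by simp
qed

section \<open>Packed floorplans on the integer grid\<close>

lemma floorplan_packed:
  assumes F: "floorplan k l B"
  shows "packed_floorplan k l (real_box k ` B)"
proof -
  note FD = floorplanD[OF F]
  have le: "fst (snd b) \<le> k" "snd (snd b) \<le> l" if "b \<in> B" for b
    using FD(6)[OF that] by (simp_all add: less_eq_prod_def)
  have inj: "inj_on (real_box k) B"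
    by (rule inj_onI) (use real_box_eq_iff FD(4,5) le in blast)
  have int: "interior (real_box k b) = box (real (snd (fst b)), real k - real (fst (snd b))) (real (snd (snd b)), real k - real (fst (fst b)))" for b
    by (simp add: real_box_def)
  have rect: "real_box k b \<subseteq> rectangle k l" if "b \<in> B" for b
    using le[OF that] by (auto simp: mem_real_box mem_rectangle)
  have ne: "real_box k b \<noteq> {}" if "b \<in> B" for b
    using FD(4,5)[OF that] by (auto simp: real_box_def cbox_Pair_eq_0)
  have disj: "interior (real_box k b) \<inter> interior (real_box k b') = {}" if b: "b \<in> B" "b' \<in> B" "b \<noteq> b'" for b b'
  proof (rule ccontr)
    assume "\<not> ?thesis"
    then obtain x y where "(x, y) \<in> interior (real_box k b)" "(x, y) \<in> interior (real_box k b')" by fast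
    note o = this[unfolded int mem_box_pair]
    have c: "snd (fst b) < snd (snd b')" "snd (fst b') < snd (snd b)" "fst (fst b) < fst (snd b')" "fst (fst b') < fst (snd b)"
      using o by linarith+
    let ?x = "(max (fst (fst b)) (fst (fst b')), max (snd (fst b)) (snd (fst b')))"
    have "?x \<in> cells b" "?x \<in> cells b'" using c FD(4,5)[OF b(1)] FD(4,5)[OF b(2)] by (simp_all add: cells_def)
    then show False using FD(8)[OF b(1,2)] b(3) by blast
  qed
  have cover: "\<Union> (real_box k ` B) = rectangle k l"
  proof
    show "\<Union> (real_box k ` B) \<subseteq> rectangle k l" using rect by blast
    show "rectangle k l \<subseteq> \<Union> (real_box k ` B)"
    proof
      fix z assume z: "z \<in> rectangle k l"
      obtain x y where xy: "z = (x, y)" by (cases z)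
      have r: "0 \<le> x" "x \<le> real l" "0 \<le> real k - y" "real k - y \<le> real k" using z by (auto simp: xy mem_rectangle)
      obtain j where j: "j < l" "real j \<le> x" "x \<le> real (Suc j)" by (rule grid_cell[OF r(1,2) FD(2)])
      obtain i where i: "i < k" "real i \<le> real k - y" "real k - y \<le> real (Suc i)" by (rule grid_cell[OF r(3,4) FD(1)])
      have "(i, j) \<in> {..<k} \<times> {..<l}" using i j by simp
      from FD(7)[OF this] obtain b where b: "b \<in> B" "(i, j) \<in> cells b" by (rule bexE)
      have "fst (fst b) \<le> i" "Suc i \<le> fst (snd b)" "snd (fst b) \<le> j" "Suc j \<le> snd (snd b)"
        using b(2) by (auto simp: cells_def)
      then have "(x, y) \<in> real_box k b" using i j unfolding mem_real_box by linarith
      then show "z \<in> \<Union> (real_box k ` B)" using b(1) xy by blast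
    qed
  qed
  show ?thesis unfolding packed_floorplan_def
  proof (intro conjI)
    show "0 < k" "0 < l" by (rule FD)+
    show "card (real_box k ` B) = k + l - 1" using card_image[OF inj] FD(3) by simp
    show "real_box k ` B division_of rectangle k l"
    proof (rule division_ofI)
      show "finite (real_box k ` B)" using FD(10) by simp
      show "\<Union> (real_box k ` B) = rectangle k l" by (rule cover)
      fix K assume K: "K \<in> real_box k ` B"
      then show "K \<subseteq> rectangle k l" "K \<noteq> {}" using rect ne by blast+
      show "\<exists>a b. K = cbox a b" using K by (auto simp: real_box_def)
      fix K' assume "K' \<in> real_box k ` B" "K \<noteq> K'"
      then show "interior K \<inter> interior K' = {}" using disj K by blast
    qed
    show "\<forall>t\<in>real_box k ` B. \<exists>x1 y1 x2 y2. t = cbox (x1, y1) (x2, y2) \<and>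
        0 < x2 - x1 \<and> x2 - x1 \<in> \<int> \<and> 0 < y2 - y1 \<and> y2 - y1 \<in> \<int>"
    proof
      fix t assume "t \<in> real_box k ` B"
      then obtain b where b: "b \<in> B" "t = real_box k b" by blast
      show "\<exists>x1 y1 x2 y2. t = cbox (x1, y1) (x2, y2) \<and>
        0 < x2 - x1 \<and> x2 - x1 \<in> \<int> \<and> 0 < y2 - y1 \<and> y2 - y1 \<in> \<int>"
        unfolding b(2) real_box_def using FD(4,5)[OF b(1)]
        by (intro exI[of _ "real (snd (fst b))"] exI[of _ "real k - real (fst (snd b))"]
            exI[of _ "real (snd (snd b))"] exI[of _ "real k - real (fst (fst b))"]) simp
    qed
    show "\<not> (\<exists>l1 b1 r1 t1 l2 b2 r2 t2.
          cbox (l1, b1) (r1, t1) \<in> real_box k ` B \<and> cbox (l2, b2) (r2, t2) \<in> real_box k ` B \<and> r1 \<le> l2 \<and> b1 \<ge> t2)"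
    proof
      assume "\<exists>l1 b1 r1 t1 l2 b2 r2 t2.
          cbox (l1, b1) (r1, t1) \<in> real_box k ` B \<and> cbox (l2, b2) (r2, t2) \<in> real_box k ` B \<and> r1 \<le> l2 \<and> b1 \<ge> t2"
      then obtain l1 b1 r1 t1 l2 b2 r2 t2 where
        1: "cbox (l1, b1) (r1, t1) \<in> real_box k ` B" and 2: "cbox (l2, b2) (r2, t2) \<in> real_box k ` B" and
        3: "r1 \<le> l2" "t2 \<le> b1" by blast
      obtain c where c: "c \<in> B" "cbox (l1, b1) (r1, t1) = real_box k c" using 1 by blast
      obtain d where d: "d \<in> B" "cbox (l2, b2) (r2, t2) = real_box k d" using 2 by blast
      have "r1 = real (snd (snd c))" "b1 = real k - real (fst (snd c))"
        using c(2) ne[OF c(1)] unfolding real_box_def eq_cbox by (simp_all only: prod.inject simp_thms)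
      moreover have "l2 = real (snd (fst d))" "t2 = real k - real (fst (fst d))"
        using d(2) ne[OF d(1)] unfolding real_box_def eq_cbox by (simp_all only: prod.inject simp_thms)
      ultimately have "snd c \<le> fst d" using 3 by (simp add: less_eq_prod_def)
      then show False using FD(9)[OF c(1) d(1)] by simp
    qed
  qed
qed

text \<open>Just to the left of a tile there is a tile ending where it begins, and widths are integers.\<close>

lemma integer_left_edges:
  fixes xl xr yl yr :: "'t \<Rightarrow> real"
  assumes fin: "finite F"
    and pos: "\<And>t. t \<in> F \<Longrightarrow> xl t < xr t" "\<And>t. t \<in> F \<Longrightarrow> yl t < yr t"
    and width: "\<And>t. t \<in> F \<Longrightarrow> xr t - xl t \<in> \<int>"
    and low: "\<And>t. t \<in> F \<Longrightarrow> 0 \<le> xl t"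
    and cover: "\<And>t x y. t \<in> F \<Longrightarrow> 0 \<le> x \<Longrightarrow> x \<le> xl t \<Longrightarrow> yl t < y \<Longrightarrow> y < yr t \<Longrightarrow>
        \<exists>t'\<in>F. xl t' \<le> x \<and> x \<le> xr t' \<and> yl t' \<le> y \<and> y \<le> yr t'"
    and disj: "\<And>t t'. t \<in> F \<Longrightarrow> t' \<in> F \<Longrightarrow> max (xl t) (xl t') < min (xr t) (xr t') \<Longrightarrow>
        max (yl t) (yl t') < min (yr t) (yr t') \<Longrightarrow> t = t'"
    and "t \<in> F"
  shows "xl t \<in> \<int>"
  using \<open>t \<in> F\<close>
proof (induction "card {t' \<in> F. xl t' < xl t}" arbitrary: t rule: less_induct)
  case less
  show ?case
  proof (cases "xl t = 0")
    case False
    then have x0: "0 < xl t" using low[OF less(2)] by simp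
    define y where "y = (yl t + yr t) / 2"
    have y: "yl t < y" "y < yr t" using pos(2)[OF less(2)] by (simp_all add: y_def)
    \<comment> \<open>The last right edge before \<open>xl t\<close>, or the left side 0 of the
      rectangle. A tile found strictly between \<open>m\<close> and \<open>xl t\<close> must reach
      \<open>xl t\<close>, since no right edge lies in between, and disjointness makes it end there.
      It starts further left, which is where the induction applies.\<close>
    define m where "m = Max (insert 0 {xr t' | t'. t' \<in> F \<and> xr t' < xl t})"
    have finm: "finite (insert 0 {xr t' | t'. t' \<in> F \<and> xr t' < xl t})"
      using finite_subset[of "{xr t' | t'. t' \<in> F \<and> xr t' < xl t}" "xr ` F"] fin by auto
    have "m \<in> insert 0 {xr t' | t'. t' \<in> F \<and> xr t' < xl t}" unfolding m_def using finm by (intro Max_in) auto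
    then have mx: "m < xl t" using x0 by auto
    have m0: "0 \<le> m" unfolding m_def using finm by (intro Max_ge) auto
    define x where "x = (m + xl t) / 2"
    have x: "m < x" "x < xl t" "0 \<le> x" using mx m0 by (simp_all add: x_def)
    obtain t' where t': "t' \<in> F" "xl t' \<le> x" "x \<le> xr t'" "yl t' \<le> y" "y \<le> yr t'"
      using cover[OF less(2) x(3) _ y] x(2) by auto
    have "xl t \<le> xr t'"
    proof (rule ccontr)
      assume "\<not> ?thesis"
      then have "xr t' \<le> m" unfolding m_def using t'(1) finm by (intro Max_ge) auto
      then show False using x(1) t'(3) by simp
    qed
    moreover have "xr t' \<le> xl t"
    proof (rule ccontr)
      assume gt: "\<not> ?thesis"
      have "t = t'"
      proof (rule disj[OF less(2) t'(1)])
        show "max (xl t) (xl t') < min (xr t) (xr t')" using gt t'(2) x(2) pos(1)[OF less(2)] by auto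
        show "max (yl t) (yl t') < min (yr t) (yr t')"
          using t'(4,5) y pos(2)[OF less(2)] pos(2)[OF t'(1)] by auto
      qed
      then show False using t'(2) x(2) by simp
    qed
    ultimately have eq: "xr t' = xl t" by simp
    have lt: "xl t' < xl t" using t'(2) x(2) by simp
    have "{u \<in> F. xl u < xl t'} \<subset> {u \<in> F. xl u < xl t}"
    proof (rule psubsetI)
      show "{u \<in> F. xl u < xl t'} \<subseteq> {u \<in> F. xl u < xl t}" using lt by fastforce
      show "{u \<in> F. xl u < xl t'} \<noteq> {u \<in> F. xl u < xl t}" using lt t'(1) by blast
    qed
    then have "xl t' \<in> \<int>" using fin by (intro less(1)[OF _ t'(1)] psubset_card_mono) auto
    then have "xl t' + (xr t' - xl t') \<in> \<int>" using width[OF t'(1)] by (rule Ints_add)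
    then show ?thesis using eq by simp
  qed simp
qed

lemma nat_of_Ints: "x \<in> \<int> \<Longrightarrow> 0 \<le> x \<Longrightarrow> real (nat \<lfloor>x\<rfloor>) = x"
  by (auto elim: Ints_cases)

text \<open>Only the side lengths of the tiles are known to be integers. Their positions follow from
  \<open>integer_left_edges\<close>, applied once for each axis, and the tiles can then be read as
  sets of unit cells.\<close>

lemma packed_floorplan_grid:
  assumes "packed_floorplan k l F"
  obtains B where "floorplan k l B" "F = real_box k ` B"
proof -
  note pf = assms[unfolded packed_floorplan_def]
  note kl = pf[THEN conjunct1] pf[THEN conjunct2, THEN conjunct1]
  note rest = pf[THEN conjunct2, THEN conjunct2]
  note div = rest[THEN conjunct1] and card = rest[THEN conjunct2, THEN conjunct1]
    and sides = rest[THEN conjunct2, THEN conjunct2, THEN conjunct1, rule_format]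
    and no_pair = rest[THEN conjunct2, THEN conjunct2, THEN conjunct2]
  have packed: False if "cbox (l1, b1) (r1, t1) \<in> F" "cbox (l2, b2) (r2, t2) \<in> F" "r1 \<le> l2" "t2 \<le> b1"
    for l1 b1 r1 t1 l2 b2 r2 t2
    by (rule notE[OF no_pair], intro exI conjI) (rule that)+
  have "\<forall>t\<in>F. \<exists>c. t = cbox (fst (fst c), snd (fst c)) (fst (snd c), snd (snd c)) \<and>
      0 < fst (snd c) - fst (fst c) \<and> fst (snd c) - fst (fst c) \<in> \<int> \<and>
      0 < snd (snd c) - snd (fst c) \<and> snd (snd c) - snd (fst c) \<in> \<int>"
  proof
    fix t assume "t \<in> F"
    from sides[OF this] obtain x1 y1 x2 y2 where "t = cbox (x1, y1) (x2, y2) \<and>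
        0 < x2 - x1 \<and> x2 - x1 \<in> \<int> \<and> 0 < y2 - y1 \<and> y2 - y1 \<in> \<int>" by (elim exE)
    then show "\<exists>c. t = cbox (fst (fst c), snd (fst c)) (fst (snd c), snd (snd c)) \<and>
      0 < fst (snd c) - fst (fst c) \<and> fst (snd c) - fst (fst c) \<in> \<int> \<and>
      0 < snd (snd c) - snd (fst c) \<and> snd (snd c) - snd (fst c) \<in> \<int>"
      by (intro exI[of _ "((x1, y1), (x2, y2))"]) simp
  qed
  from bchoice[OF this] obtain c where "\<forall>t\<in>F. t = cbox (fst (fst (c t)), snd (fst (c t))) (fst (snd (c t)), snd (snd (c t))) \<and>
      0 < fst (snd (c t)) - fst (fst (c t)) \<and> fst (snd (c t)) - fst (fst (c t)) \<in> \<int> \<and>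
      0 < snd (snd (c t)) - snd (fst (c t)) \<and> snd (snd (c t)) - snd (fst (c t)) \<in> \<int>" by (elim exE)
  note c = this[rule_format]
  define xl where "xl t = fst (fst (c t))" for t
  define yl where "yl t = snd (fst (c t))" for t
  define xr where "xr t = fst (snd (c t))" for t
  define yr where "yr t = snd (snd (c t))" for t
  have box: "t = cbox (xl t, yl t) (xr t, yr t)" and posx: "xl t < xr t" and posy: "yl t < yr t"
    and wx: "xr t - xl t \<in> \<int>" and wy: "yr t - yl t \<in> \<int>" if "t \<in> F" for t
    using c[OF that] unfolding xl_def xr_def yl_def yr_def by (blast, simp_all)
  note fin = division_ofD(1)[OF div]
  have mem: "(x, y) \<in> t \<longleftrightarrow> xl t \<le> x \<and> x \<le> xr t \<and> yl t \<le> y \<and> y \<le> yr t" if "t \<in> F" for t x y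
    using box[OF that] mem_cbox_pair by metis
  have inside: "0 \<le> xl t" "xr t \<le> real l" "0 \<le> yl t" "yr t \<le> real k" if t: "t \<in> F" for t
  proof -
    have "(xl t, yl t) \<in> t" "(xr t, yr t) \<in> t" using mem[OF t] posx[OF t] posy[OF t] by simp_all
    then have "(xl t, yl t) \<in> rectangle k l" "(xr t, yr t) \<in> rectangle k l"
      using division_ofD(2)[OF div t] by blast+
    then show "0 \<le> xl t" "xr t \<le> real l" "0 \<le> yl t" "yr t \<le> real k" by (simp_all add: mem_rectangle)
  qed
  have cover: "\<exists>t\<in>F. xl t \<le> x \<and> x \<le> xr t \<and> yl t \<le> y \<and> y \<le> yr t"
    if "0 \<le> x" "x \<le> real l" "0 \<le> y" "y \<le> real k" for x y
  proof -
    have "(x, y) \<in> \<Union> F" unfolding division_ofD(6)[OF div] using that by (simp add: mem_rectangle)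
    then show ?thesis using mem by blast
  qed
  have disj: "t = t'" if t: "t \<in> F" "t' \<in> F" "max (xl t) (xl t') < min (xr t) (xr t')" "max (yl t) (yl t') < min (yr t) (yr t')" for t t'
  proof (rule ccontr)
    assume "t \<noteq> t'"
    then have e: "interior t \<inter> interior t' = {}" by (rule division_ofD(5)[OF div t(1,2)])
    let ?z = "((max (xl t) (xl t') + min (xr t) (xr t')) / 2, (max (yl t) (yl t') + min (yr t) (yr t')) / 2)"
    have i: "interior t = box (xl t, yl t) (xr t, yr t)" if "t \<in> F" for t
      using box[OF that] interior_cbox by metis
    have "?z \<in> interior t" "?z \<in> interior t'"
      unfolding i[OF t(1)] i[OF t(2)] mem_box_pair using t(3,4) by (auto simp: field_simps max_def min_def split: if_splits)
    then show False using e by blast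
  qed
  have xl_int: "xl t \<in> \<int>" if "t \<in> F" for t
  proof (rule integer_left_edges[of F xl xr yl yr])
    show "\<exists>t'\<in>F. xl t' \<le> x \<and> x \<le> xr t' \<and> yl t' \<le> y \<and> y \<le> yr t'"
      if "t \<in> F" "0 \<le> x" "x \<le> xl t" "yl t < y" "y < yr t" for t x y
      using cover[of x y] inside[OF that(1)] posx[OF that(1)] that by simp
  qed (use fin posx posy wx inside disj that in \<open>simp_all\<close>)
  have yl_int: "yl t \<in> \<int>" if "t \<in> F" for t
  proof (rule integer_left_edges[of F yl yr xl xr])
    show "\<exists>t'\<in>F. yl t' \<le> x \<and> x \<le> yr t' \<and> xl t' \<le> y \<and> y \<le> xr t'"
      if "t \<in> F" "0 \<le> x" "x \<le> yl t" "xl t < y" "y < xr t" for t x y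
      using cover[of y x] inside[OF that(1)] posy[OF that(1)] that by fastforce
  qed (use fin posx posy wy inside disj that in \<open>simp_all\<close>)
  have xr_int: "xr t \<in> \<int>" and yr_int: "yr t \<in> \<int>" if "t \<in> F" for t
    using Ints_add[OF xl_int[OF that] wx[OF that]] Ints_add[OF yl_int[OF that] wy[OF that]] by simp_all
  define g where "g t = ((nat \<lfloor>real k - yr t\<rfloor>, nat \<lfloor>xl t\<rfloor>), (nat \<lfloor>real k - yl t\<rfloor>, nat \<lfloor>xr t\<rfloor>))" for t
  have gsel: "real (snd (fst (g t))) = xl t" "real (snd (snd (g t))) = xr t"
    "real (fst (fst (g t))) = real k - yr t" "real (fst (snd (g t))) = real k - yl t" if t: "t \<in> F" for t
    unfolding g_def fst_conv snd_conv
    using inside[OF t] posx[OF t] posy[OF t] xl_int[OF t] xr_int[OF t] yl_int[OF t] yr_int[OF t]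
    by (intro nat_of_Ints; simp)+
  have rg: "real_box k (g t) = t" if t: "t \<in> F" for t
    unfolding real_box_def gsel[OF t] using box[OF t] by simp
  have inj: "inj_on g F" by (rule inj_on_inverseI[of _ "real_box k"]) (rule rg)
  have memg: "(i, j) \<in> cells (g t) \<longleftrightarrow> real k - yr t \<le> real i \<and> real i < real k - yl t \<and> xl t \<le> real j \<and> real j < xr t"
    if t: "t \<in> F" for t i j
    unfolding cells_def using gsel[OF t, symmetric] by (simp add: mem_Times_iff)
  have "floorplan k l (g ` F)" unfolding floorplan_def
  proof (intro conjI ballI impI)
    show "0 < k" "0 < l" by (rule kl)+
    show "card (g ` F) = k + l - 1" using card_image[OF inj] card by simp
    fix b assume "b \<in> g ` F"
    then obtain t where t: "t \<in> F" "b = g t" by blast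
    have "real (fst (fst b)) < real (fst (snd b))" "real (snd (fst b)) < real (snd (snd b))"
      "real (fst (snd b)) \<le> real k" "real (snd (snd b)) \<le> real l"
      unfolding t(2) gsel[OF t(1)] using posx[OF t(1)] posy[OF t(1)] inside[OF t(1)] by simp_all
    then show "fst (fst b) < fst (snd b)" "snd (fst b) < snd (snd b)" "snd b \<le> (k, l)"
      by (simp_all add: less_eq_prod_def)
    fix b' assume "b' \<in> g ` F"
    then obtain t' where t': "t' \<in> F" "b' = g t'" by blast
    show "b = b'" if ne: "cells b \<inter> cells b' \<noteq> {}"
    proof -
      obtain i j where "(i, j) \<in> cells b" "(i, j) \<in> cells b'" using ne by fast
      then have 1: "real k - yr t \<le> real i" "real i < real k - yl t" "xl t \<le> real j" "real j < xr t"
        and 2: "real k - yr t' \<le> real i" "real i < real k - yl t'" "xl t' \<le> real j" "real j < xr t'"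
        using memg t t' by simp_all
      have "t = t'" by (rule disj[OF t(1) t'(1)]) (use 1 2 in auto)
      then show ?thesis using t t' by simp
    qed
    show "\<not> snd b \<le> fst b'"
    proof
      assume "snd b \<le> fst b'"
      then have "real (fst (snd b)) \<le> real (fst (fst b'))" "real (snd (snd b)) \<le> real (snd (fst b'))"
        by (simp_all add: less_eq_prod_def)
      then have "yr t' \<le> yl t" "xr t \<le> xl t'"
        unfolding t(2) t'(2) gsel[OF t(1)] gsel[OF t'(1)] by simp_all
      moreover have "cbox (xl t, yl t) (xr t, yr t) \<in> F" "cbox (xl t', yl t') (xr t', yr t') \<in> F"
        using box t(1) t'(1) by metis+
      ultimately show False using packed by blast
    qed
  next
    fix x assume x: "x \<in> {..<k} \<times> {..<l}"
    obtain i j where ij: "x = (i, j)" by (cases x)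
    have bd: "Suc i \<le> k" "Suc j \<le> l" using x ij by auto
    \<comment> \<open>The centre of the unit cell is half a unit away from every integer line, so
      weak inequalities for the closed tile round to membership in the half-open set of
      cells.\<close>
    obtain t where t: "t \<in> F" "xl t \<le> real j + 1/2" "real j + 1/2 \<le> xr t"
      "yl t \<le> real k - real i - 1/2" "real k - real i - 1/2 \<le> yr t"
      using cover[of "real j + 1/2" "real k - real i - 1/2"] bd by force
    have half: "m \<le> n" if "real m \<le> real n + 1/2" for m n :: nat using that by linarith
    have half': "m < n" if "real m + 1/2 \<le> real n" for m n :: nat using that by linarith
    have "snd (fst (g t)) \<le> j" by (rule half) (use t gsel[OF t(1)] in simp)
    moreover have "j < snd (snd (g t))" by (rule half') (use t gsel[OF t(1)] in simp)
    moreover have "fst (fst (g t)) \<le> i" by (rule half) (use t gsel[OF t(1)] in simp)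
    moreover have "i < fst (snd (g t))" by (rule half') (use t gsel[OF t(1)] in simp)
    ultimately have "x \<in> cells (g t)" by (simp add: cells_def ij)
    then show "\<exists>b\<in>g ` F. x \<in> cells b" using t(1) by blast
  qed
  moreover have "F = real_box k ` g ` F" unfolding image_image using rg by simp
  ultimately show ?thesis by (rule that)
qed

section \<open>The bijection\<close>

lemma tile_box_cong:
  assumes P: "baxter_points k l P" and "linext P lab1" "linext P lab2" and p: "p \<in> P"
    and eq: "tile k l P lab1 p = tile k l P lab2 p"
  shows "tile_box k l P lab1 p = tile_box k l P lab2 p"
proof -
  interpret A: labeled_points k l P lab1 by unfold_locales fact+
  interpret B: labeled_points k l P lab2 by unfold_locales fact+
  note a = A.tile_bounds(1,2)[OF p] and b = B.tile_bounds(1,2)[OF p]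
  have i: "i < A.btm p \<longleftrightarrow> i < B.btm p" if "fst p \<le> i" for i
    using A.mem_tile[OF p, of i "snd p"] B.mem_tile[OF p, of i "snd p"] eq that a b by simp
  have j: "j < A.rgt p \<longleftrightarrow> j < B.rgt p" if "snd p \<le> j" for j
    using A.mem_tile[OF p, of "fst p" j] B.mem_tile[OF p, of "fst p" j] eq that a b by simp
  \<comment> \<open>The bounds of a nonempty box can be read off by testing each against the other
    as a coordinate.\<close>
  have "A.btm p = B.btm p" using i[of "A.btm p"] i[of "B.btm p"] a(1) b(1) by auto
  moreover have "A.rgt p = B.rgt p" using j[of "A.rgt p"] j[of "B.rgt p"] a(2) b(2) by auto
  ultimately show ?thesis by (simp add: tile_box_def)
qed

lemma rectangle_inj:
  assumes "rectangle k l = rectangle k' l'" shows "k = k'" "l = l'"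
proof -
  have "(real l, real k) \<in> rectangle k' l'" "(real l', real k') \<in> rectangle k l"
    unfolding assms[symmetric] by (simp add: mem_rectangle) (simp add: assms mem_rectangle)
  then show "k = k'" "l = l'" by (simp_all add: mem_rectangle)
qed

lemma Phi_F_packed:
  assumes "T \<in> baxter_tlts n"
  shows "Phi_F T \<in> packed_floorplans n" "\<Union> (Phi_F T) = rectangle (num_rows T) (num_cols T)"
proof -
  note sh = baxter_tlt_shape(1)[OF assms]
  have T: "T = Tableau (diagram T) (points T)" by simp
  have "Phi_F T = real_box (num_rows T) ` tile_box (num_rows T) (num_cols T) (points T) (insertion_label T) ` points T"
    using Phi_F_eq[OF sh] T by simp
  moreover have "linext (points T) (insertion_label T)" using insertion_labeling(1)[OF sh] T by simp
  ultimately have pf: "packed_floorplan (num_rows T) (num_cols T) (Phi_F T)"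
    using floorplan_packed[OF floorplan_tiles[OF shapeD(1)[OF sh]]] by simp
  then have "Phi_F T division_of rectangle (num_rows T) (num_cols T)"
    unfolding packed_floorplan_def by (elim conjE)
  then show "\<Union> (Phi_F T) = rectangle (num_rows T) (num_cols T)" by (rule division_ofD(6))
  have "num_rows T + num_cols T - 1 = n"
    using baxter_points_card(1)[OF shapeD(1)[OF sh]] baxter_tlt_shape(2)[OF assms] by simp
  then show "Phi_F T \<in> packed_floorplans n" using pf unfolding packed_floorplans_def by blast
qed

text \<open>The data are recovered one after the other: the rectangle as the union of the tiles, the
  points as their top-left corners, the labels by \<open>greedy_unique\<close>, and the diagram from
  the labels.\<close>

lemma Phi_F_inj: "inj_on Phi_F (baxter_tlts n)"
proof (rule inj_onI)
  fix T1 T2 assume T: "T1 \<in> baxter_tlts n" "T2 \<in> baxter_tlts n" and eq: "Phi_F T1 = Phi_F T2"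
  let ?k = "num_rows T1" and ?l = "num_cols T1" and ?lab1 = "insertion_label T1" and ?lab2 = "insertion_label T2"
  let ?P1 = "points T1" and ?P2 = "points T2"
  have rect: "rectangle ?k ?l = rectangle (num_rows T2) (num_cols T2)"
    using Phi_F_packed(2)[OF T(1)] Phi_F_packed(2)[OF T(2)] eq by simp
  note kl = rectangle_inj[OF rect]
  have sh: "shape ?k ?l ?P1 (diagram T1)" "shape ?k ?l ?P2 (diagram T2)"
    using baxter_tlt_shape(1)[OF T(1)] baxter_tlt_shape(1)[OF T(2)] kl by simp_all
  note P = shapeD(1)[OF sh(1)] shapeD(1)[OF sh(2)]
  have lin: "linext ?P1 ?lab1" "linext ?P2 ?lab2" and gr: "greedy ?P1 ?lab1" "greedy ?P2 ?lab2"
    using insertion_labeling(1,2)[OF sh(1)] insertion_labeling(1,2)[OF sh(2)] by simp_all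
  have F: "floorplan ?k ?l (tile_box ?k ?l ?P1 ?lab1 ` ?P1)" "floorplan ?k ?l (tile_box ?k ?l ?P2 ?lab2 ` ?P2)"
    by (rule floorplan_tiles[OF P(1) lin(1)], rule floorplan_tiles[OF P(2) lin(2)])
  have ph: "real_box ?k ` tile_box ?k ?l ?P1 ?lab1 ` ?P1 = real_box ?k ` tile_box ?k ?l ?P2 ?lab2 ` ?P2"
    using Phi_F_eq[OF sh(1)] Phi_F_eq[OF sh(2)] eq by simp
  have bd: "fst (fst b) < fst (snd b) \<and> snd (fst b) < snd (snd b) \<and> fst (snd b) \<le> ?k"
    if "b \<in> tile_box ?k ?l ?P1 ?lab1 ` ?P1 \<union> tile_box ?k ?l ?P2 ?lab2 ` ?P2" for b
    using that floorplanD(4-6)[OF F(1), of b] floorplanD(4-6)[OF F(2), of b] by (auto simp: less_eq_prod_def)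
  have "inj_on (real_box ?k) (tile_box ?k ?l ?P1 ?lab1 ` ?P1 \<union> tile_box ?k ?l ?P2 ?lab2 ` ?P2)"
    by (rule inj_onI) (use real_box_eq_iff bd in blast)
  then have boxes: "tile_box ?k ?l ?P1 ?lab1 ` ?P1 = tile_box ?k ?l ?P2 ?lab2 ` ?P2"
    by (rule inj_on_image_eq_iff[THEN iffD1, OF _ _ _ ph]) blast+
  have "fst ` tile_box k l P lab ` P = P" for k l P lab by (simp add: image_image tile_box_def)
  then have PP: "?P1 = ?P2" using boxes by metis
  have tiles: "tile ?k ?l ?P1 ?lab1 p = tile ?k ?l ?P1 ?lab2 p" if p: "p \<in> ?P1" for p
  proof -
    have "tile_box ?k ?l ?P1 ?lab1 p \<in> tile_box ?k ?l ?P1 ?lab2 ` ?P1" using boxes p PP by auto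
    then have "tile_box ?k ?l ?P1 ?lab1 p = tile_box ?k ?l ?P1 ?lab2 p" by (auto simp: tile_box_def)
    then show ?thesis using tile_eq_cells[OF P(1) lin(1) p] tile_eq_cells[OF P(1) _ p] lin(2) PP by simp
  qed
  have "?P1 \<subseteq> {..<?k} \<times> {..<?l}" using shapeD(2,3)[OF sh(1)] by blast
  then have lab: "?lab1 p = ?lab2 p" if "p \<in> ?P1" for p
    using greedy_unique[OF lin(1) gr(1) _ _ tiles _ that] lin(2) gr(2) PP by metis
  have "diagram T1 = diagram T2"
  proof (rule insertion_label_determines_diagram[OF sh(1) sh(2)[folded PP]])
    have "Tableau (diagram T1) ?P1 = T1" "Tableau (diagram T2) ?P1 = T2" by simp (simp add: PP)
    then show "insertion_label (Tableau (diagram T1) ?P1) p = insertion_label (Tableau (diagram T2) ?P1) p"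
      if "p \<in> ?P1" for p using lab[OF that] by (simp only:)
  qed
  then show "T1 = T2" using PP by (simp add: tableau.expand)
qed

lemma Phi_F_surj:
  assumes "F \<in> packed_floorplans n"
  shows "F \<in> Phi_F ` baxter_tlts n"
proof -
  obtain k l where kl: "packed_floorplan k l F" "k + l - 1 = n" using assms unfolding packed_floorplans_def by blast
  obtain B where B: "floorplan k l B" "F = real_box k ` B" by (rule packed_floorplan_grid[OF kl(1)])
  let ?P = "fst ` B"
  have P: "baxter_points k l ?P" by (rule floorplan_points[OF B(1)])
  obtain lab0 where lab0: "linext ?P lab0" "tile_box k l ?P lab0 ` ?P = B" by (rule floorplan_labeling[OF B(1)])
  obtain lab where lab: "linext ?P lab" "greedy ?P lab" "\<And>p. p \<in> ?P \<Longrightarrow> tile k l ?P lab p = tile k l ?P lab0 p"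
    using greedy_exists[OF baxter_points_finite[OF P] lab0(1), where k = k and l = l] by blast
  obtain D where D: "shape k l ?P D" "\<forall>p\<in>?P. insertion_label (Tableau D ?P) p = lab p"
    using greedy_labeling_realized[OF P lab(1,2)] by blast
  let ?T = "Tableau D ?P"
  \<comment> \<open>Tiles depend on a labeling only through its values on the points, where the
    realized labeling agrees with the greedy one.\<close>
  have "tile k l ?P (insertion_label ?T) p = tile k l ?P lab0 p" if p: "p \<in> ?P" for p
  proof -
    note eq = D(2)[rule_format]
    have "tile k l ?P (insertion_label ?T) p = tile k l ?P lab p"
      unfolding tile_def by (intro Collect_cong conj_cong[OF refl] ball_cong[OF refl]) (simp only: eq[OF p] eq)
    then show ?thesis using lab(3)[OF p] by simp
  qed
  then have "tile_box k l ?P (insertion_label ?T) p = tile_box k l ?P lab0 p" if "p \<in> ?P" for p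
    using tile_box_cong[OF P insertion_labeling(1)[OF D(1)] lab0(1) that] that by blast
  then have "tile_box k l ?P (insertion_label ?T) ` ?P = tile_box k l ?P lab0 ` ?P" by (rule image_cong[OF refl])
  then have "Phi_F ?T = F" using Phi_F_eq[OF D(1)] lab0(2) B(2) by simp
  moreover have "?T \<in> baxter_tlts n"
    using shape_baxter_tlt(1)[OF D(1)] baxter_points_card(1)[OF P] kl(2) by simp
  ultimately show ?thesis by blast
qed

theorem theorem3p4:
  fixes n :: nat
  assumes "0 < n"
  shows "bij_betw Phi_F (baxter_tlts n) (packed_floorplans n)"
  unfolding bij_betw_def
proof
  show "inj_on Phi_F (baxter_tlts n)" by (rule Phi_F_inj)
  show "Phi_F ` baxter_tlts n = packed_floorplans n" using Phi_F_packed(1) Phi_F_surj by blast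
qed

end
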